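(* Let $A_\ell,U,A_r$ be unital complex associative algebras, $\mathfrak{a}\subseteq U$ a finite dimensional linear subspace, and let $r^{\pm}:\mathfrak{a}^*\to U^{\otimes2}$ and $\kappa:\mathfrak{a}^*\to A_\ell\otimes U\otimes A_r$ be meromorphic functions. For $N\ge1$ and $1\le i\le N$ define the first order differential operator $$\mathcal{D}_i^{(N)}:=E_i-\sum_{s=1}^{i-1}r^+_{si}-\kappa_i-\sum_{s=i+1}^N r^-_{is}\in\mathbb{D}_N .$$ The following statements are equivalent: (1) $[\mathcal{D}_i^{(N)},\mathcal{D}_j^{(N)}]=0$ in $\mathbb{D}_N$ for all $N\ge2$ and all $1\le i,j\le N$. (2) $r^{\pm}$ and $\kappa$ satisfy $[x\otimes1,r^+]=[1\otimes x,r^-]$ for all $x\in\mathfrak{a}$ ($\mathfrak{a}$-compatibility); $\mathrm{CYB}[t](r^+,r^-)=0$ for $1\le t\le 3$ (the coupled classical dynamical Yang-Baxter equations); and $\mathrm{CR}(r^+,r^-;\kappa)=0$ (the classical dynamical reflection equation for $\kappa$ relative to $(r^+,r^-)$).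
   Context: All tensor products are over $\mathbb{C}$. $\mathcal{M}$ is the field of meromorphic functions on $\mathfrak{a}^*$; for a complex algebra $B$, a meromorphic function $\mathfrak{a}^*\to B$ means an element of the algebraic tensor product $\mathcal{M}\otimes B$. $\mathbb{D}_N$ is the algebra of differential operators on $\mathfrak{a}^*$ with coefficients in the ring of meromorphic $A_\ell\otimes U^{\otimes N}\otimes A_r$-valued functions on $\mathfrak{a}^*$; $\partial_\lambda\in\mathbb{D}_N$ is the directional derivative in direction $\lambda\in\mathfrak{a}^*$. Subscripts indicate placement: for $z\in U^{\otimes k}$, $z_{i_1\cdots i_k}$ has the $j$-th tensor component of $z$ in the $i_j$-th $U$-position and $1$ elsewhere; $\kappa_i$ has the $A_\ell$- and $A_r$-components of $\kappa$ in the outer positions and its $U$-component in the $i$-th $U$-position. With $\{x_k\}_{k=1}^d$ a basis of $\mathfrak{a}$ and $\{\lambda_k\}_{k=1}^d$ the dual basis of $\mathfrak{a}^*$, $E_i:=\sum_{k=1}^d (x_k)_i\,\partial_{\lambda_k}\in\mathbb{D}_N$ (independent of the choice of basis); for a function $f$, $E_i(f):=\sum_k (x_k)_i\,\partial_{\lambda_k}(f)$ denotes the function obtained by applying $E_i$ to $f$. Definitions ($\mathrm{CYB}[t]$ is $U^{\otimes3}$-valued, $\mathrm{CR}$ is $A_\ell\otimes U^{\otimes2}\otimes A_r$-valued with $r^{\pm}=r^{\pm}_{12}$): $$\mathrm{CYB}[1](r^+,r^-):=[r_{12}^+,r_{13}^+]+[r_{12}^+,r_{23}^+]-[r_{13}^+,r_{23}^-]+E_3(r_{12}^+)-E_2(r_{13}^+),$$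 $$\mathrm{CYB}[2](r^+,r^-):=[r_{12}^-,r_{13}^+]+[r_{12}^-,r_{23}^+]+[r_{13}^-,r_{23}^+]+E_3(r_{12}^-)-E_1(r_{23}^+),$$ $$\mathrm{CYB}[3](r^+,r^-):=-[r_{12}^+,r_{13}^-]+[r_{12}^-,r_{23}^-]+[r_{13}^-,r_{23}^-]+E_2(r_{13}^-)-E_1(r_{23}^-),$$ $$\mathrm{CR}(r^+,r^-;\kappa):=[\kappa_1+r^-,\kappa_2+r^+]+E_2(r^-+\kappa_1)-E_1(r^++\kappa_2).$$ *)

theory Defs
  imports "HOL-Analysis.Analysis" "HOL-Library.Poly_Mapping"
begin

section \<open>Complex vector spaces and algebras\<close>

class scaleC =
  fixes scaleC :: "complex \<Rightarrow> 'a \<Rightarrow> 'a" (infixr "*\<^sub>C" 75)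

class complex_vector = ab_group_add + scaleC +
  assumes scaleC_add_right: "a *\<^sub>C (x + y) = a *\<^sub>C x + a *\<^sub>C y"
    and scaleC_add_left: "(a + b) *\<^sub>C x = a *\<^sub>C x + b *\<^sub>C x"
    and scaleC_scaleC: "a *\<^sub>C (b *\<^sub>C x) = (a * b) *\<^sub>C x"
    and scaleC_one: "1 *\<^sub>C x = x"

global_interpretation cvec: vector_space "scaleC :: complex \<Rightarrow> 'a \<Rightarrow> 'a::complex_vector"
  by unfold_locales (auto simp: scaleC_add_right scaleC_add_left scaleC_scaleC scaleC_one)

class complex_algebra = complex_vector + ring +
  assumes mult_scaleC_left: "(a *\<^sub>C x) * y = a *\<^sub>C (x * y)"
    and mult_scaleC_right: "x * (a *\<^sub>C y) = a *\<^sub>C (x * y)"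

text \<open>Unital algebras; as everywhere in HOL, \<^class>\<open>ring_1\<close> includes \<^prop>\<open>(0::'a::zero_neq_one) \<noteq> 1\<close>.\<close>

class complex_algebra_1 = complex_algebra + ring_1

class complex_normed_vector = complex_vector + real_normed_vector +
  assumes scaleR_scaleC: "r *\<^sub>R x = complex_of_real r *\<^sub>C x"
    and norm_scaleC: "norm (a *\<^sub>C x) = cmod a * norm x"

definition lie_comm :: "'a::ring \<Rightarrow> 'a \<Rightarrow> 'a" where
  "lie_comm x y = x * y - y * x"


section \<open>Meromorphic functions on a complex vector space\<close>

definition holo_on :: "'v::complex_normed_vector set \<Rightarrow> ('v \<Rightarrow> complex) \<Rightarrow> bool" where
  "holo_on V f \<longleftrightarrow>
     (\<forall>p\<in>V. \<exists>L. (f has_derivative L) (at p) \<and> (\<forall>c h. L (c *\<^sub>C h) = c * L h))"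

text \<open>\<open>mero_fun f\<close>: locally, \<open>f\<close> is a quotient \<open>g/h\<close> of holomorphic functions, where \<open>h\<close> vanishes
  identically on no nonempty open set. The values of \<open>f\<close> at zeros of the denominators are arbitrary;
  accordingly, functions agreeing on a dense open set are identified in the type \<open>mero\<close> below.\<close>

definition mero_fun :: "('v::complex_normed_vector \<Rightarrow> complex) \<Rightarrow> bool" where
  "mero_fun f \<longleftrightarrow>
     (\<forall>p. \<exists>V g h. open V \<and> p \<in> V \<and> holo_on V g \<and> holo_on V h \<and>
        (\<forall>W. open W \<and> W \<subseteq> V \<and> W \<noteq> {} \<longrightarrow> (\<exists>q\<in>W. h q \<noteq> 0)) \<and>
        (\<forall>q\<in>V. h q \<noteq> 0 \<longrightarrow> f q = g q / h q))"

definition agree_dense :: "('v::topological_space \<Rightarrow> 'b) \<Rightarrow> ('v \<Rightarrow> 'b) \<Rightarrow> bool" where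
  "agree_dense f g \<longleftrightarrow> (\<exists>W. open W \<and> closure W = UNIV \<and> (\<forall>q\<in>W. f q = g q))"

definition mero_eq :: "('v::complex_normed_vector \<Rightarrow> complex) \<Rightarrow> ('v \<Rightarrow> complex) \<Rightarrow> bool" where
  "mero_eq f g \<longleftrightarrow> mero_fun f \<and> mero_fun g \<and> agree_dense f g"

lemma holo_on_subset: "holo_on V f \<Longrightarrow> W \<subseteq> V \<Longrightarrow> holo_on W f"
  by (auto simp: holo_on_def)

lemma holo_on_continuous: "holo_on V f \<Longrightarrow> continuous_on V f"
  unfolding holo_on_def
  by (meson continuous_at_imp_continuous_on has_derivative_continuous)

lemma holo_on_const: "holo_on V (\<lambda>_. c)"
  unfolding holo_on_def by (auto intro!: exI[of _ "\<lambda>_. 0"])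

lemma holo_on_add:
  assumes "holo_on V f" "holo_on V g" shows "holo_on V (\<lambda>q. f q + g q)"
  unfolding holo_on_def
proof
  fix p assume "p \<in> V"
  then obtain L M where L: "(f has_derivative L) (at p)" "\<forall>c h. L (c *\<^sub>C h) = c * L h"
    and M: "(g has_derivative M) (at p)" "\<forall>c h. M (c *\<^sub>C h) = c * M h"
    using assms unfolding holo_on_def by blast
  show "\<exists>L. ((\<lambda>q. f q + g q) has_derivative L) (at p) \<and> (\<forall>c h. L (c *\<^sub>C h) = c * L h)"
    using has_derivative_add[OF L(1) M(1)] L(2) M(2)
    by (intro exI[of _ "\<lambda>h. L h + M h"]) (simp add: distrib_left)
qed

lemma holo_on_mult:
  assumes "holo_on V f" "holo_on V g" shows "holo_on V (\<lambda>q. f q * g q)"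
  unfolding holo_on_def
proof
  fix p assume "p \<in> V"
  then obtain L M where L: "(f has_derivative L) (at p)" "\<forall>c h. L (c *\<^sub>C h) = c * L h"
    and M: "(g has_derivative M) (at p)" "\<forall>c h. M (c *\<^sub>C h) = c * M h"
    using assms unfolding holo_on_def by blast
  show "\<exists>L. ((\<lambda>q. f q * g q) has_derivative L) (at p) \<and> (\<forall>c h. L (c *\<^sub>C h) = c * L h)"
    using has_derivative_mult[OF L(1) M(1)] L(2) M(2)
    by (intro exI[of _ "\<lambda>h. f p * M h + L h * g p"]) (simp add: algebra_simps)
qed

lemma mero_fun_const: "mero_fun (\<lambda>_. c)"
  unfolding mero_fun_def
  by (intro allI exI[of _ UNIV] exI[of _ "\<lambda>_. c"] exI[of _ "\<lambda>_. 1"]) (auto intro: holo_on_const)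

lemma nonvanishing_mult:
  fixes h1 h2 :: "'v::complex_normed_vector \<Rightarrow> complex"
  assumes "open V" "holo_on V h1" "open V'"
    and 1: "\<forall>W. open W \<and> W \<subseteq> V \<and> W \<noteq> {} \<longrightarrow> (\<exists>q\<in>W. h1 q \<noteq> 0)"
    and 2: "\<forall>W. open W \<and> W \<subseteq> V' \<and> W \<noteq> {} \<longrightarrow> (\<exists>q\<in>W. h2 q \<noteq> 0)"
  shows "\<forall>W. open W \<and> W \<subseteq> V \<inter> V' \<and> W \<noteq> {} \<longrightarrow> (\<exists>q\<in>W. h1 q * h2 q \<noteq> 0)"
proof (intro allI impI)
  fix W :: "'v set" assume W: "open W \<and> W \<subseteq> V \<inter> V' \<and> W \<noteq> {}"
  have "continuous_on W h1"
    using holo_on_continuous[OF assms(2)] W continuous_on_subset by blast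
  then have "open (W \<inter> h1 -` (- {0}))"
    using W continuous_open_preimage[of W h1 "- {0}"] by auto
  moreover have "W \<inter> h1 -` (- {0}) \<noteq> {}" using 1 W by blast
  ultimately obtain q where "q \<in> W \<inter> h1 -` (- {0})" "h2 q \<noteq> 0"
    using 2[rule_format, of "W \<inter> h1 -` (- {0})"] W by blast
  then show "\<exists>q\<in>W. h1 q * h2 q \<noteq> 0" by auto
qed

lemma mero_fun_binop:
  fixes f1 f2 :: "'v::complex_normed_vector \<Rightarrow> complex"
  assumes f: "mero_fun f1" "mero_fun f2"
    and k: "\<And>(V::'v set) g1 h1 g2 h2. holo_on V g1 \<Longrightarrow> holo_on V h1 \<Longrightarrow> holo_on V g2 \<Longrightarrow> holo_on V h2
               \<Longrightarrow> holo_on V (\<lambda>q. k (g1 q) (h1 q) (g2 q) (h2 q) :: complex)"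
    and F: "\<And>g1 h1 g2 h2. h1 \<noteq> 0 \<Longrightarrow> h2 \<noteq> 0
               \<Longrightarrow> F (g1 / h1) (g2 / h2) = k g1 h1 g2 h2 / (h1 * h2)"
  shows "mero_fun (\<lambda>q. F (f1 q) (f2 q))"
  unfolding mero_fun_def
proof
  fix p
  obtain V g h where 1: "open V" "p \<in> V" "holo_on V g" "holo_on V h"
      "\<forall>W. open W \<and> W \<subseteq> V \<and> W \<noteq> {} \<longrightarrow> (\<exists>q\<in>W. h q \<noteq> 0)"
      "\<forall>q\<in>V. h q \<noteq> 0 \<longrightarrow> f1 q = g q / h q"
    using f(1)[unfolded mero_fun_def, THEN spec, of p] by (elim exE conjE) (rule that, assumption+)
  obtain V' g' h' where 2: "open V'" "p \<in> V'" "holo_on V' g'" "holo_on V' h'"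
      "\<forall>W. open W \<and> W \<subseteq> V' \<and> W \<noteq> {} \<longrightarrow> (\<exists>q\<in>W. h' q \<noteq> 0)"
      "\<forall>q\<in>V'. h' q \<noteq> 0 \<longrightarrow> f2 q = g' q / h' q"
    using f(2)[unfolded mero_fun_def, THEN spec, of p] by (elim exE conjE) (rule that, assumption+)
  have sub: "holo_on (V \<inter> V') g" "holo_on (V \<inter> V') h" "holo_on (V \<inter> V') g'" "holo_on (V \<inter> V') h'"
    using 1(3,4) 2(3,4) by (auto elim: holo_on_subset)
  show "\<exists>V g h. open V \<and> p \<in> V \<and> holo_on V g \<and> holo_on V h \<and>
        (\<forall>W. open W \<and> W \<subseteq> V \<and> W \<noteq> {} \<longrightarrow> (\<exists>q\<in>W. h q \<noteq> 0)) \<and>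
        (\<forall>q\<in>V. h q \<noteq> 0 \<longrightarrow> F (f1 q) (f2 q) = g q / h q)"
  proof (intro exI conjI)
    show "open (V \<inter> V')" "p \<in> V \<inter> V'" using 1 2 by auto
    show "holo_on (V \<inter> V') (\<lambda>q. k (g q) (h q) (g' q) (h' q))" using k[OF sub] .
    show "holo_on (V \<inter> V') (\<lambda>q. h q * h' q)" using holo_on_mult[OF sub(2,4)] .
    show "\<forall>W. open W \<and> W \<subseteq> V \<inter> V' \<and> W \<noteq> {} \<longrightarrow> (\<exists>q\<in>W. h q * h' q \<noteq> 0)"
      using nonvanishing_mult[OF 1(1,4) 2(1) 1(5) 2(5)] .
    show "\<forall>q\<in>V \<inter> V'. h q * h' q \<noteq> 0 \<longrightarrow>
            F (f1 q) (f2 q) = k (g q) (h q) (g' q) (h' q) / (h q * h' q)"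
      using 1(6) 2(6) F by auto
  qed
qed

lemma mero_fun_add: "mero_fun f \<Longrightarrow> mero_fun g \<Longrightarrow> mero_fun (\<lambda>q. f q + g q)"
  by (rule mero_fun_binop[where k = "\<lambda>g1 h1 g2 h2. g1 * h2 + g2 * h1"])
     (assumption+, intro holo_on_add holo_on_mult, assumption+, simp add: field_simps)

lemma mero_fun_mult: "mero_fun f \<Longrightarrow> mero_fun g \<Longrightarrow> mero_fun (\<lambda>q. f q * g q)"
  by (rule mero_fun_binop[where k = "\<lambda>g1 h1 g2 h2. g1 * g2"])
     (assumption+, intro holo_on_mult, assumption+, simp)

lemma mero_fun_cmult: "mero_fun f \<Longrightarrow> mero_fun (\<lambda>q. c * f q)"
  using mero_fun_mult[OF mero_fun_const] .

lemma agree_dense_refl: "agree_dense f f"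
  unfolding agree_dense_def by (intro exI[of _ UNIV]) auto

lemma agree_dense_combine:
  assumes "agree_dense f f'" "agree_dense g g'"
  shows "agree_dense (\<lambda>q. F (f q) (g q)) (\<lambda>q. F (f' q) (g' q))"
proof -
  obtain A where A: "open A" "closure A = UNIV" "\<forall>q\<in>A. f q = f' q"
    using assms(1) unfolding agree_dense_def by blast
  obtain B where B: "open B" "closure B = UNIV" "\<forall>q\<in>B. g q = g' q"
    using assms(2) unfolding agree_dense_def by blast
  have "closure (A \<inter> B) = UNIV"
    using open_Int_closure_subset[OF A(1), of B] A(2) B(2) closure_minimal[of A "closure (A \<inter> B)"]
    by auto
  then show ?thesis unfolding agree_dense_def using A B by (intro exI[of _ "A \<inter> B"]) auto
qed

lemma agree_dense_sym:
  assumes "agree_dense f g" shows "agree_dense g f"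
proof -
  obtain W where "open W" "closure W = UNIV" "\<forall>q\<in>W. f q = g q"
    using assms unfolding agree_dense_def by blast
  then show ?thesis unfolding agree_dense_def by (intro exI[of _ W]) simp
qed

lemma agree_dense_trans:
  assumes "agree_dense f g" "agree_dense g h" shows "agree_dense f h"
proof -
  have "agree_dense (\<lambda>q. (f q, g q)) (\<lambda>q. (g q, h q))"
    using agree_dense_combine[OF assms, of Pair] .
  then obtain W where "open W" "closure W = UNIV" "\<forall>q\<in>W. (f q, g q) = (g q, h q)"
    unfolding agree_dense_def by blast
  then show ?thesis unfolding agree_dense_def by (intro exI[of _ W]) simp
qed

quotient_type (overloaded) 'v mero = "'v::complex_normed_vector \<Rightarrow> complex" / partial: mero_eq
proof (rule part_equivpI)
  show "\<exists>f. mero_eq f f"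
    by (rule exI[of _ "\<lambda>_. 0"]) (simp add: mero_eq_def mero_fun_const agree_dense_refl)
  show "symp mero_eq"
    unfolding symp_def mero_eq_def using agree_dense_sym by blast
  show "transp mero_eq"
    unfolding transp_def mero_eq_def using agree_dense_trans by blast
qed

instantiation mero :: (complex_normed_vector) "{comm_ring_1, complex_algebra}"
begin

lift_definition zero_mero :: "'a mero" is "\<lambda>_. 0"
  by (auto simp: mero_eq_def mero_fun_const agree_dense_refl)

lift_definition one_mero :: "'a mero" is "\<lambda>_. 1"
  by (auto simp: mero_eq_def mero_fun_const agree_dense_refl)

lift_definition plus_mero :: "'a mero \<Rightarrow> 'a mero \<Rightarrow> 'a mero" is "\<lambda>f g q. f q + g q"
  by (simp add: mero_eq_def mero_fun_add agree_dense_combine[where F = "(+)"])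

lift_definition times_mero :: "'a mero \<Rightarrow> 'a mero \<Rightarrow> 'a mero" is "\<lambda>f g q. f q * g q"
  by (simp add: mero_eq_def mero_fun_mult agree_dense_combine[where F = "(*)"])

lift_definition scaleC_mero :: "complex \<Rightarrow> 'a mero \<Rightarrow> 'a mero" is "\<lambda>c f q. c * f q"
  by (simp add: mero_eq_def mero_fun_cmult
      agree_dense_combine[OF agree_dense_refl, where F = "(*)" and f = "\<lambda>_. _"])

definition uminus_mero :: "'a mero \<Rightarrow> 'a mero" where "uminus_mero f = (- 1) *\<^sub>C f"

definition minus_mero :: "'a mero \<Rightarrow> 'a mero \<Rightarrow> 'a mero" where "minus_mero f g = f + (- 1) *\<^sub>C g"

instance
proof
  fix a b c :: "'a mero" and s t :: complex
  note simps = mero_eq_def mero_fun_add mero_fun_mult mero_fun_cmult mero_fun_const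
    agree_dense_refl algebra_simps
  have neg: "(- 1) *\<^sub>C a + a = 0"
    by transfer (auto simp: simps)
  show "a + b + c = a + (b + c)"
    by transfer (simp add: simps)
  show "a + b = b + a"
    by transfer (simp add: simps)
  show "0 + a = a"
    by transfer (simp add: simps)
  show "a * b * c = a * (b * c)"
    by transfer (simp add: simps)
  show "a * b = b * a"
    by transfer (simp add: simps)
  show "1 * a = a"
    by transfer (simp add: simps)
  show "(a + b) * c = a * c + b * c"
    by transfer (simp add: simps)
  show "a * (b + c) = a * b + a * c"
    by transfer (simp add: simps)
  show "s *\<^sub>C (a + b) = s *\<^sub>C a + s *\<^sub>C b"
    by transfer (simp add: simps)
  show "(s + t) *\<^sub>C a = s *\<^sub>C a + t *\<^sub>C a"
    by transfer (simp add: simps)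
  show "s *\<^sub>C t *\<^sub>C a = (s * t) *\<^sub>C a"
    by transfer (simp add: simps)
  show "1 *\<^sub>C a = a"
    by transfer (simp add: simps)
  show "s *\<^sub>C a * b = s *\<^sub>C (a * b)"
    by transfer (simp add: simps)
  show "a * s *\<^sub>C b = s *\<^sub>C (a * b)"
    by transfer (simp add: simps)
  show "- a + a = 0" "a - b = a + - b"
    using neg by (auto simp: uminus_mero_def minus_mero_def)
  show "(0::'a mero) \<noteq> 1"
  proof (transfer, rule notI)
    assume "mero_eq (\<lambda>_::'a. 0) (\<lambda>_. 1)"
    then obtain W :: "'a set" where "closure W = UNIV" "\<forall>q\<in>W. (0::complex) = 1"
      unfolding mero_eq_def agree_dense_def by blast
    then show False using closure_empty by auto
  qed
qed

end

text \<open>\<open>mero_deriv v\<close> is the directional derivative \<open>\<partial>\<^sub>v\<close>, computed on an arbitrary representative: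
  off the zeros of its local denominators a representative is holomorphic, so its
  derivative is again meromorphic there, and equal on dense open sets for equivalent representatives.\<close>

definition mero_deriv :: "'v::complex_normed_vector \<Rightarrow> 'v mero \<Rightarrow> 'v mero" where
  "mero_deriv v f = abs_mero (\<lambda>q. deriv (\<lambda>t. rep_mero f (q + t *\<^sub>C v)) 0)"


section \<open>Free complex vector spaces\<close>

definition free_ext :: "('k \<Rightarrow> 'c::complex_vector) \<Rightarrow> ('k \<Rightarrow>\<^sub>0 complex) \<Rightarrow> 'c" where
  "free_ext f x = (\<Sum>k\<in>Poly_Mapping.keys x. Poly_Mapping.lookup x k *\<^sub>C f k)"

definition free_scale :: "complex \<Rightarrow> ('k \<Rightarrow>\<^sub>0 complex) \<Rightarrow> ('k \<Rightarrow>\<^sub>0 complex)" where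
  "free_scale c x = Poly_Mapping.map ((*) c) x"

lemma lookup_free_scale: "Poly_Mapping.lookup (free_scale c x) k = c * Poly_Mapping.lookup x k"
  by (simp add: free_scale_def Poly_Mapping.map.rep_eq when_def)

lemma free_scale_single: "free_scale c (Poly_Mapping.single k s) = Poly_Mapping.single k (c * s)"
  by (rule poly_mapping_eqI) (simp add: lookup_free_scale lookup_single when_def)

lemma free_scale_diff: "free_scale c (x - y) = free_scale c x - free_scale c y"
  by (rule poly_mapping_eqI) (simp add: lookup_free_scale lookup_minus algebra_simps)

lemma free_scale_add: "free_scale c (x + y) = free_scale c x + free_scale c y"
  by (rule poly_mapping_eqI) (simp add: lookup_free_scale lookup_add algebra_simps)

lemma free_scale_zero: "free_scale c 0 = 0"
  by (rule poly_mapping_eqI) (simp add: lookup_free_scale)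

lemma diff_swap: "(a - c) - (b - d) = (a - b) - (c - d)" for a b c d :: "'a::ab_group_add"
  by simp

lemma free_ext_add: "free_ext f (x + y) = free_ext f x + free_ext f y"
  unfolding free_ext_def
  by (rule setsum_keys_plus_distrib) (auto simp: scaleC_add_left)

lemma free_ext_scale: "free_ext f (free_scale c x) = c *\<^sub>C free_ext f x"
proof -
  have "free_ext f (free_scale c x) =
      (\<Sum>k\<in>Poly_Mapping.keys x. Poly_Mapping.lookup (free_scale c x) k *\<^sub>C f k)"
    unfolding free_ext_def
    by (rule sum.mono_neutral_left) (auto simp: in_keys_iff lookup_free_scale)
  then show ?thesis
    by (simp add: free_ext_def lookup_free_scale cvec.scale_sum_right scaleC_scaleC)
qed

lemma free_ext_zero [simp]: "free_ext f 0 = 0"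
  by (simp add: free_ext_def)

lemma free_ext_diff: "free_ext f (x - y) = free_ext f x - free_ext f y"
  using free_ext_add[of f "x - y" y] by (simp add: algebra_simps)

lemma free_ext_single: "free_ext f (Poly_Mapping.single k s) = s *\<^sub>C f k"
  by (simp add: free_ext_def)

lemma free_induct:
  assumes "P 0" "\<And>k s x. P x \<Longrightarrow> P (Poly_Mapping.single k s + x)"
  shows "P (x :: 'k \<Rightarrow>\<^sub>0 complex)"
proof (induction "card (Poly_Mapping.keys x)" arbitrary: x)
  case 0
  then show ?case using assms(1) by simp
next
  case (Suc n)
  then obtain k where k: "k \<in> Poly_Mapping.keys x"
    by (metis card.empty ex_in_conv nat.distinct(1))
  define y where "y = x - Poly_Mapping.single k (Poly_Mapping.lookup x k)"
  have "Poly_Mapping.keys y = Poly_Mapping.keys x - {k}"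
    unfolding y_def by (auto simp: in_keys_iff lookup_minus lookup_single when_def split: if_splits)
  then have "P y" using Suc k by simp
  then have "P (Poly_Mapping.single k (Poly_Mapping.lookup x k) + y)" by (rule assms(2))
  then show ?case by (simp add: y_def)
qed


section \<open>The tensor product of two complex vector spaces\<close>

text \<open>The algebraic tensor product: the free vector space on \<open>A \<times> B\<close> modulo the subspace spanned by
  the bilinearity relations. The subspace is generated as an additive group by all scalar multiples
  of the relations.\<close>

inductive_set tensor_null :: "('a::complex_vector \<times> 'b::complex_vector \<Rightarrow>\<^sub>0 complex) set" where
  zero: "0 \<in> tensor_null"
| diff: "x \<in> tensor_null \<Longrightarrow> y \<in> tensor_null \<Longrightarrow> x - y \<in> tensor_null"
| add_left: "Poly_Mapping.single (a + a', b) s - Poly_Mapping.single (a, b) s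
    - Poly_Mapping.single (a', b) s \<in> tensor_null"
| add_right: "Poly_Mapping.single (a, b + b') s - Poly_Mapping.single (a, b) s
    - Poly_Mapping.single (a, b') s \<in> tensor_null"
| scale_left: "Poly_Mapping.single (c *\<^sub>C a, b) s - Poly_Mapping.single (a, b) (s * c) \<in> tensor_null"
| scale_right: "Poly_Mapping.single (a, c *\<^sub>C b) s - Poly_Mapping.single (a, b) (s * c) \<in> tensor_null"

lemma tensor_null_uminus: "x \<in> tensor_null \<Longrightarrow> - x \<in> tensor_null"
  using tensor_null.diff[OF tensor_null.zero] by simp

lemma tensor_null_add: "x \<in> tensor_null \<Longrightarrow> y \<in> tensor_null \<Longrightarrow> x + y \<in> tensor_null"
  using tensor_null.diff[of x "- y"] tensor_null_uminus[of y] by simp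

lemma tensor_null_scale: "x \<in> tensor_null \<Longrightarrow> free_scale c x \<in> tensor_null"
proof (induction rule: tensor_null.induct)
  case zero
  then show ?case by (simp add: free_scale_zero tensor_null.zero)
next
  case (diff x y)
  then show ?case by (simp add: free_scale_diff tensor_null.diff)
qed (simp_all add: free_scale_diff free_scale_single mult.assoc[symmetric] tensor_null.intros)

quotient_type (overloaded) ('a, 'b) tensor =
  "'a::complex_vector \<times> 'b::complex_vector \<Rightarrow>\<^sub>0 complex" / "\<lambda>x y. x - y \<in> tensor_null"
proof (rule equivpI)
  show "reflp (\<lambda>x y::'a \<times> 'b \<Rightarrow>\<^sub>0 complex. x - y \<in> tensor_null)"
    by (auto simp: reflp_def tensor_null.zero)
  show "symp (\<lambda>x y::'a \<times> 'b \<Rightarrow>\<^sub>0 complex. x - y \<in> tensor_null)"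
    unfolding symp_def using tensor_null_uminus by fastforce
  show "transp (\<lambda>x y::'a \<times> 'b \<Rightarrow>\<^sub>0 complex. x - y \<in> tensor_null)"
    unfolding transp_def using tensor_null_add by fastforce
qed

instantiation tensor :: (complex_vector, complex_vector) complex_vector
begin

lift_definition zero_tensor :: "('a, 'b) tensor" is 0 .

lift_definition plus_tensor :: "('a, 'b) tensor \<Rightarrow> ('a, 'b) tensor \<Rightarrow> ('a, 'b) tensor" is "(+)"
  by (simp only: add_diff_add tensor_null_add)

lift_definition minus_tensor :: "('a, 'b) tensor \<Rightarrow> ('a, 'b) tensor \<Rightarrow> ('a, 'b) tensor" is "(-)"
  by (subst diff_swap) (rule tensor_null.diff)

lift_definition uminus_tensor :: "('a, 'b) tensor \<Rightarrow> ('a, 'b) tensor" is uminus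
  by (drule tensor_null_uminus) (simp add: minus_diff_commute)

lift_definition scaleC_tensor :: "complex \<Rightarrow> ('a, 'b) tensor \<Rightarrow> ('a, 'b) tensor" is free_scale
  by (drule tensor_null_scale) (simp add: free_scale_diff)

instance
proof
  fix a b c :: "('a, 'b) tensor" and s t :: complex
  have *: "x = y \<Longrightarrow> x - y \<in> tensor_null" for x y :: "'a \<times> 'b \<Rightarrow>\<^sub>0 complex"
    by (simp add: tensor_null.zero)
  show "a + b + c = a + (b + c)" "a + b = b + a" "0 + a = a" "- a + a = 0" "a - b = a + - b"
    by (transfer, rule *, simp add: algebra_simps)+
  show "s *\<^sub>C (a + b) = s *\<^sub>C a + s *\<^sub>C b" "(s + t) *\<^sub>C a = s *\<^sub>C a + t *\<^sub>C a"
    "s *\<^sub>C t *\<^sub>C a = (s * t) *\<^sub>C a" "1 *\<^sub>C a = a"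
    by (transfer, rule *, rule poly_mapping_eqI,
        simp add: lookup_free_scale lookup_add algebra_simps)+
qed

end

lift_definition tens :: "'a::complex_vector \<Rightarrow> 'b::complex_vector \<Rightarrow> ('a, 'b) tensor" (infixr "\<otimes>" 76)
  is "\<lambda>a b. Poly_Mapping.single (a, b) 1" .

definition bilin :: "('a::complex_vector \<Rightarrow> 'b::complex_vector \<Rightarrow> 'c::complex_vector) \<Rightarrow> bool" where
  "bilin f \<longleftrightarrow> (\<forall>a a' b. f (a + a') b = f a b + f a' b) \<and> (\<forall>a b b'. f a (b + b') = f a b + f a b')
     \<and> (\<forall>c a b. f (c *\<^sub>C a) b = c *\<^sub>C f a b) \<and> (\<forall>c a b. f a (c *\<^sub>C b) = c *\<^sub>C f a b)"

text \<open>For bilinear \<open>f\<close>, \<open>tensor_lift f\<close> is the linear map with \<open>a \<otimes> b \<mapsto> f a b\<close>.\<close>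

definition tensor_lift ::
    "('a::complex_vector \<Rightarrow> 'b::complex_vector \<Rightarrow> 'c::complex_vector) \<Rightarrow> ('a, 'b) tensor \<Rightarrow> 'c" where
  "tensor_lift f t = free_ext (case_prod f) (rep_tensor t)"

definition tensor_map :: "('a::complex_vector \<Rightarrow> 'c::complex_vector) \<Rightarrow>
    ('b::complex_vector \<Rightarrow> 'd::complex_vector) \<Rightarrow> ('a, 'b) tensor \<Rightarrow> ('c, 'd) tensor" where
  "tensor_map f g = tensor_lift (\<lambda>a b. f a \<otimes> g b)"

lemma tensor_abs_cases:
  obtains y where "t = abs_tensor y"
  using Quotient3_abs_rep[OF Quotient3_tensor] by metis

lemma free_ext_tensor_null:
  assumes "bilin f" "x \<in> tensor_null" shows "free_ext (case_prod f) x = 0"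
  using assms(2)
  by induction (use assms(1) in \<open>simp_all add: bilin_def free_ext_diff free_ext_single
    scaleC_add_right scaleC_scaleC\<close>)

lemma tensor_lift_abs:
  assumes "bilin f" shows "tensor_lift f (abs_tensor x) = free_ext (case_prod f) x"
proof -
  have "rep_tensor (abs_tensor x) - x \<in> tensor_null"
    using rep_abs_rsp_left[OF Quotient3_tensor, of x x] by (simp add: tensor_null.zero)
  from free_ext_tensor_null[OF assms this] show ?thesis
    by (simp add: tensor_lift_def free_ext_diff)
qed

lemma tensor_lift_tens: "bilin f \<Longrightarrow> tensor_lift f (a \<otimes> b) = f a b"
  by (simp add: tens.abs_eq tensor_lift_abs free_ext_single scaleC_one)

lemma tensor_lift_add:
  assumes "bilin f" shows "tensor_lift f (x + y) = tensor_lift f x + tensor_lift f y"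
  by (cases x rule: tensor_abs_cases, cases y rule: tensor_abs_cases)
     (simp add: tensor_lift_abs[OF assms] plus_tensor.abs_eq free_ext_add)

lemma tensor_lift_scale:
  assumes "bilin f" shows "tensor_lift f (c *\<^sub>C x) = c *\<^sub>C tensor_lift f x"
  by (cases x rule: tensor_abs_cases) (simp add: tensor_lift_abs[OF assms] scaleC_tensor.abs_eq free_ext_scale)

lemma tens_add_left: "(a + a') \<otimes> b = a \<otimes> b + a' \<otimes> b"
  using tensor_null.add_left[of a a' b 1]
  by (simp add: tens.abs_eq plus_tensor.abs_eq tensor.abs_eq_iff diff_diff_add)

lemma tens_add_right: "a \<otimes> (b + b') = a \<otimes> b + a \<otimes> b'"
  using tensor_null.add_right[of a b b' 1]
  by (simp add: tens.abs_eq plus_tensor.abs_eq tensor.abs_eq_iff diff_diff_add)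

lemma tens_scale_left: "(c *\<^sub>C a) \<otimes> b = c *\<^sub>C (a \<otimes> b)"
  using tensor_null.scale_left[of c a b 1]
  by (simp add: tens.abs_eq scaleC_tensor.abs_eq tensor.abs_eq_iff free_scale_single)

lemma tens_scale_right: "a \<otimes> (c *\<^sub>C b) = c *\<^sub>C (a \<otimes> b)"
  using tensor_null.scale_right[of a c b 1]
  by (simp add: tens.abs_eq scaleC_tensor.abs_eq tensor.abs_eq_iff free_scale_single)

lemma tensor_induct [case_names zero add]:
  assumes "P 0" "\<And>a b x. P x \<Longrightarrow> P (a \<otimes> b + x)"
  shows "P t"
proof (cases t rule: tensor_abs_cases)
  case (1 y)
  have "P (abs_tensor y)"
  proof (induction y rule: free_induct)
    case 1
    then show ?case using assms(1) by (simp add: zero_tensor.abs_eq)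
  next
    case (2 k s x)
    obtain a b where k: "k = (a, b)" by force
    have "(s *\<^sub>C a) \<otimes> b = abs_tensor (Poly_Mapping.single k s)"
      by (subst tens_scale_left) (simp add: k tens.abs_eq scaleC_tensor.abs_eq free_scale_single)
    then show ?case
      using assms(2)[OF 2, of "s *\<^sub>C a" b] by (simp add: plus_tensor.abs_eq)
  qed
  then show ?thesis using 1 by simp
qed

lemma tensor_eqI:
  assumes "\<And>x y. F (x + y) = F x + F y" "\<And>x y. G (x + y) = G x + G y"
    and "\<And>a b. F (a \<otimes> b) = (G (a \<otimes> b) :: 'c::complex_vector)"
  shows "F t = G t"
proof (induction t rule: tensor_induct)
  case zero
  show ?case using assms(1)[of 0 0] assms(2)[of 0 0] by simp
qed (simp add: assms)

lemmas tens_simps = tens_add_left tens_add_right tens_scale_left tens_scale_right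

definition tensor_mul1 :: "'a::complex_algebra \<Rightarrow> 'b::complex_algebra \<Rightarrow>
    ('a, 'b) tensor \<Rightarrow> ('a, 'b) tensor" where
  "tensor_mul1 a b = tensor_lift (\<lambda>a' b'. (a * a') \<otimes> (b * b'))"

lemma bilin_times: "bilin (\<lambda>a' b'. (a * a') \<otimes> (b * b'))"
  for a :: "'a::complex_algebra" and b :: "'b::complex_algebra"
  by (simp add: bilin_def tens_simps distrib_left mult_scaleC_right)

lemmas tensor_mul1_simps =
  tensor_lift_tens[OF bilin_times, folded tensor_mul1_def]
  tensor_lift_add[OF bilin_times, folded tensor_mul1_def]
  tensor_lift_scale[OF bilin_times, folded tensor_mul1_def]

lemma bilin_tensor_mul1: "bilin (\<lambda>a b. tensor_mul1 a b y)"
  unfolding bilin_def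
proof (intro conjI allI)
  fix a a' :: 'a and b b' :: 'b and c
  note simps = tensor_mul1_simps tens_simps distrib_right mult_scaleC_left scaleC_add_right
  show "tensor_mul1 (a + a') b y = tensor_mul1 a b y + tensor_mul1 a' b y"
    by (rule tensor_eqI[where G = "\<lambda>y. tensor_mul1 a b y + tensor_mul1 a' b y"])
       (simp_all add: simps)
  show "tensor_mul1 a (b + b') y = tensor_mul1 a b y + tensor_mul1 a b' y"
    by (rule tensor_eqI[where G = "\<lambda>y. tensor_mul1 a b y + tensor_mul1 a b' y"])
       (simp_all add: simps)
  show "tensor_mul1 (c *\<^sub>C a) b y = c *\<^sub>C tensor_mul1 a b y"
    by (rule tensor_eqI[where G = "\<lambda>y. c *\<^sub>C tensor_mul1 a b y"]) (simp_all add: simps)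
  show "tensor_mul1 a (c *\<^sub>C b) y = c *\<^sub>C tensor_mul1 a b y"
    by (rule tensor_eqI[where G = "\<lambda>y. c *\<^sub>C tensor_mul1 a b y"]) (simp_all add: simps)
qed

instantiation tensor :: (complex_algebra, complex_algebra) complex_algebra
begin

definition times_tensor :: "('a, 'b) tensor \<Rightarrow> ('a, 'b) tensor \<Rightarrow> ('a, 'b) tensor" where
  "times_tensor x y = tensor_lift (\<lambda>a b. tensor_mul1 a b y) x"

lemma tens_times: "(a \<otimes> b) * y = tensor_mul1 a b y" for y :: "('a, 'b) tensor"
  by (simp add: times_tensor_def tensor_lift_tens[OF bilin_tensor_mul1])

lemma tensor_times_add_left: "(x + y) * z = x * z + y * z" for x y z :: "('a, 'b) tensor"
  by (simp add: times_tensor_def tensor_lift_add[OF bilin_tensor_mul1])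

lemma tensor_times_add_right: "x * (y + z) = x * y + x * z" for x y z :: "('a, 'b) tensor"
  by (rule tensor_eqI[where G = "\<lambda>x. x * y + x * z"])
     (simp_all add: tensor_times_add_left tens_times tensor_mul1_simps)

lemma tens_times_tens: "(a \<otimes> b) * (a' \<otimes> b') = (a * a') \<otimes> (b * b')" for a :: 'a and b :: 'b
  by (simp add: tens_times tensor_mul1_simps)

instance
proof
  fix x y z :: "('a, 'b) tensor" and c :: complex
  note add = tensor_times_add_left tensor_times_add_right scaleC_add_right
  show "(x + y) * z = x * z + y * z" "x * (y + z) = x * y + x * z"
    by (simp_all add: add)
  show "x * y * z = x * (y * z)"
  proof (rule tensor_eqI[where F = "\<lambda>x. x * y * z"])
    fix a b show "(a \<otimes> b) * y * z = (a \<otimes> b) * (y * z)"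
    proof (rule tensor_eqI[where F = "\<lambda>y. (a \<otimes> b) * y * z"])
      fix a' b' show "(a \<otimes> b) * (a' \<otimes> b') * z = (a \<otimes> b) * ((a' \<otimes> b') * z)"
        by (rule tensor_eqI[where F = "\<lambda>z. (a \<otimes> b) * (a' \<otimes> b') * z"])
           (simp_all add: add tens_times_tens mult.assoc)
    qed (simp_all add: add)
  qed (simp_all add: add)
  show "(c *\<^sub>C x) * y = c *\<^sub>C (x * y)"
    by (simp add: times_tensor_def tensor_lift_scale[OF bilin_tensor_mul1])
  show "x * (c *\<^sub>C y) = c *\<^sub>C (x * y)"
  proof (rule tensor_eqI[where F = "\<lambda>x. x * (c *\<^sub>C y)"])
    fix a b show "(a \<otimes> b) * (c *\<^sub>C y) = c *\<^sub>C ((a \<otimes> b) * y)"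
      by (simp add: tens_times tensor_mul1_simps)
  qed (simp_all add: add)
qed

end


section \<open>Tensor powers\<close>

text \<open>\<open>'u tpower\<close> is the direct sum of all tensor powers \<open>U\<^sup>\<otimes>\<^sup>N\<close>: the free vector space on lists over
  \<open>U\<close> modulo multilinearity, which preserves the length of lists. The summand \<open>U\<^sup>\<otimes>\<^sup>N\<close> is spanned by
  the \<open>ptens us\<close> with \<open>length us = N\<close>. The product is that of \<open>U\<^sup>\<otimes>\<^sup>N\<close> within each summand, and \<open>0\<close>
  between different ones.\<close>

inductive_set tpower_null :: "('u::complex_vector list \<Rightarrow>\<^sub>0 complex) set" where
  zero: "0 \<in> tpower_null"
| diff: "x \<in> tpower_null \<Longrightarrow> y \<in> tpower_null \<Longrightarrow> x - y \<in> tpower_null"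
| add: "Poly_Mapping.single (us @ (u + v) # ws) s - Poly_Mapping.single (us @ u # ws) s
    - Poly_Mapping.single (us @ v # ws) s \<in> tpower_null"
| scale: "Poly_Mapping.single (us @ (c *\<^sub>C u) # ws) s - Poly_Mapping.single (us @ u # ws) (s * c)
    \<in> tpower_null"

lemma tpower_null_uminus: "x \<in> tpower_null \<Longrightarrow> - x \<in> tpower_null"
  using tpower_null.diff[OF tpower_null.zero] by simp

lemma tpower_null_add: "x \<in> tpower_null \<Longrightarrow> y \<in> tpower_null \<Longrightarrow> x + y \<in> tpower_null"
  using tpower_null.diff[of x "- y"] tpower_null_uminus[of y] by simp

lemma tpower_null_scale: "x \<in> tpower_null \<Longrightarrow> free_scale c x \<in> tpower_null"
proof (induction rule: tpower_null.induct)
  case zero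
  then show ?case by (simp add: free_scale_zero tpower_null.zero)
next
  case (diff x y)
  then show ?case by (simp add: free_scale_diff tpower_null.diff)
qed (simp_all add: free_scale_diff free_scale_single mult.assoc[symmetric] tpower_null.intros)

quotient_type (overloaded) 'u tpower =
  "'u::complex_vector list \<Rightarrow>\<^sub>0 complex" / "\<lambda>x y. x - y \<in> tpower_null"
proof (rule equivpI)
  show "reflp (\<lambda>x y::'u list \<Rightarrow>\<^sub>0 complex. x - y \<in> tpower_null)"
    by (auto simp: reflp_def tpower_null.zero)
  show "symp (\<lambda>x y::'u list \<Rightarrow>\<^sub>0 complex. x - y \<in> tpower_null)"
    unfolding symp_def using tpower_null_uminus by fastforce
  show "transp (\<lambda>x y::'u list \<Rightarrow>\<^sub>0 complex. x - y \<in> tpower_null)"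
    unfolding transp_def using tpower_null_add by fastforce
qed

instantiation tpower :: (complex_vector) complex_vector
begin

lift_definition zero_tpower :: "'a tpower" is 0 .

lift_definition plus_tpower :: "'a tpower \<Rightarrow> 'a tpower \<Rightarrow> 'a tpower" is "(+)"
  by (simp only: add_diff_add tpower_null_add)

lift_definition minus_tpower :: "'a tpower \<Rightarrow> 'a tpower \<Rightarrow> 'a tpower" is "(-)"
  by (subst diff_swap) (rule tpower_null.diff)

lift_definition uminus_tpower :: "'a tpower \<Rightarrow> 'a tpower" is uminus
  by (drule tpower_null_uminus) (simp add: minus_diff_commute)

lift_definition scaleC_tpower :: "complex \<Rightarrow> 'a tpower \<Rightarrow> 'a tpower" is free_scale
  by (drule tpower_null_scale) (simp add: free_scale_diff)

instance
proof
  fix a b c :: "'a tpower" and s t :: complex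
  have *: "x = y \<Longrightarrow> x - y \<in> tpower_null" for x y :: "'a list \<Rightarrow>\<^sub>0 complex"
    by (simp add: tpower_null.zero)
  show "a + b + c = a + (b + c)" "a + b = b + a" "0 + a = a" "- a + a = 0" "a - b = a + - b"
    by (transfer, rule *, simp add: algebra_simps)+
  show "s *\<^sub>C (a + b) = s *\<^sub>C a + s *\<^sub>C b" "(s + t) *\<^sub>C a = s *\<^sub>C a + t *\<^sub>C a"
    "s *\<^sub>C t *\<^sub>C a = (s * t) *\<^sub>C a" "1 *\<^sub>C a = a"
    by (transfer, rule *, rule poly_mapping_eqI,
        simp add: lookup_free_scale lookup_add algebra_simps)+
qed

end

lift_definition ptens :: "'u::complex_vector list \<Rightarrow> 'u tpower"
  is "\<lambda>us. Poly_Mapping.single us 1" .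

definition multilin :: "('u::complex_vector list \<Rightarrow> 'c::complex_vector) \<Rightarrow> bool" where
  "multilin f \<longleftrightarrow> (\<forall>us u v ws. f (us @ (u + v) # ws) = f (us @ u # ws) + f (us @ v # ws))
     \<and> (\<forall>us c u ws. f (us @ (c *\<^sub>C u) # ws) = c *\<^sub>C f (us @ u # ws))"

definition tpower_lift :: "('u::complex_vector list \<Rightarrow> 'c::complex_vector) \<Rightarrow> 'u tpower \<Rightarrow> 'c" where
  "tpower_lift f t = free_ext f (rep_tpower t)"

lemma tpower_abs_cases:
  obtains y where "t = abs_tpower y"
  using Quotient3_abs_rep[OF Quotient3_tpower] by metis

lemma free_ext_tpower_null:
  assumes "multilin f" "x \<in> tpower_null" shows "free_ext f x = 0"
  using assms(2)
  by induction (use assms(1) in \<open>simp_all add: multilin_def free_ext_diff free_ext_single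
    scaleC_add_right scaleC_scaleC\<close>)

lemma tpower_lift_abs:
  assumes "multilin f" shows "tpower_lift f (abs_tpower x) = free_ext f x"
proof -
  have "rep_tpower (abs_tpower x) - x \<in> tpower_null"
    using rep_abs_rsp_left[OF Quotient3_tpower, of x x] by (simp add: tpower_null.zero)
  from free_ext_tpower_null[OF assms this] show ?thesis
    by (simp add: tpower_lift_def free_ext_diff)
qed

lemma tpower_lift_ptens: "multilin f \<Longrightarrow> tpower_lift f (ptens us) = f us"
  by (simp add: ptens.abs_eq tpower_lift_abs free_ext_single scaleC_one)

lemma tpower_lift_add:
  assumes "multilin f" shows "tpower_lift f (x + y) = tpower_lift f x + tpower_lift f y"
  by (cases x rule: tpower_abs_cases, cases y rule: tpower_abs_cases)
     (simp add: tpower_lift_abs[OF assms] plus_tpower.abs_eq free_ext_add)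

lemma tpower_lift_scale:
  assumes "multilin f" shows "tpower_lift f (c *\<^sub>C x) = c *\<^sub>C tpower_lift f x"
  by (cases x rule: tpower_abs_cases) (simp add: tpower_lift_abs[OF assms] scaleC_tpower.abs_eq free_ext_scale)

lemma ptens_add: "ptens (us @ (u + v) # ws) = ptens (us @ u # ws) + ptens (us @ v # ws)"
  using tpower_null.add[of us u v ws 1]
  by (simp add: ptens.abs_eq plus_tpower.abs_eq tpower.abs_eq_iff diff_diff_add)

lemma ptens_scale: "ptens (us @ (c *\<^sub>C u) # ws) = c *\<^sub>C ptens (us @ u # ws)"
  using tpower_null.scale[of us c u ws 1]
  by (simp add: ptens.abs_eq scaleC_tpower.abs_eq tpower.abs_eq_iff free_scale_single)

lemma tpower_induct [case_names zero add]:
  assumes "P 0" "\<And>s us x. P x \<Longrightarrow> P (s *\<^sub>C ptens us + x)"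
  shows "P t"
proof (cases t rule: tpower_abs_cases)
  case (1 y)
  have "P (abs_tpower y)"
  proof (induction y rule: free_induct)
    case 1
    then show ?case using assms(1) by (simp add: zero_tpower.abs_eq)
  next
    case (2 us s x)
    have "s *\<^sub>C ptens us = abs_tpower (Poly_Mapping.single us s)"
      by (simp add: ptens.abs_eq scaleC_tpower.abs_eq free_scale_single)
    then show ?case
      using assms(2)[OF 2, of s us] by (simp add: plus_tpower.abs_eq)
  qed
  then show ?thesis using 1 by simp
qed

lemma tpower_eqI:
  assumes "\<And>x y. F (x + y) = F x + F y" "\<And>x y. G (x + y) = G x + G y"
    and "\<And>c x. F (c *\<^sub>C x) = c *\<^sub>C F x" "\<And>c x. G (c *\<^sub>C x) = c *\<^sub>C G x"
    and "\<And>us. F (ptens us) = (G (ptens us) :: 'c::complex_vector)"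
  shows "F t = G t"
proof (induction t rule: tpower_induct)
  case zero
  show ?case using assms(1)[of 0 0] assms(2)[of 0 0] by simp
qed (simp add: assms)

definition list_times :: "'u::complex_algebra list \<Rightarrow> 'u list \<Rightarrow> 'u tpower" where
  "list_times us vs = (if length us = length vs then ptens (map2 (*) us vs) else 0)"

lemma multilin_list_times_right: "multilin (list_times us)"
  unfolding multilin_def
proof (intro conjI allI)
  fix vs ws :: "'a list" and v v' and c :: complex
  have split: "\<exists>us1 u us2. us = us1 @ u # us2 \<and> length us1 = length vs \<and> length us2 = length ws"
    if "length us = Suc (length vs + length ws)"
    using that id_take_nth_drop[of "length vs" us]
    by (intro exI[of _ "take (length vs) us"] exI[of _ "us ! length vs"]
        exI[of _ "drop (Suc (length vs)) us"]) auto
  show "list_times us (vs @ (v + v') # ws) = list_times us (vs @ v # ws) + list_times us (vs @ v' # ws)"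
    using split by (auto simp: list_times_def distrib_left ptens_add)
  show "list_times us (vs @ (c *\<^sub>C v) # ws) = c *\<^sub>C list_times us (vs @ v # ws)"
    using split by (auto simp: list_times_def mult_scaleC_right ptens_scale)
qed

lemma multilin_list_times_left: "multilin (\<lambda>us. list_times us vs)"
  unfolding multilin_def
proof (intro conjI allI)
  fix us ws :: "'a list" and u u' and c :: complex
  have split: "\<exists>vs1 v vs2. vs = vs1 @ v # vs2 \<and> length us = length vs1 \<and> length ws = length vs2"
    if "Suc (length us + length ws) = length vs"
    using that id_take_nth_drop[of "length us" vs]
    by (intro exI[of _ "take (length us) vs"] exI[of _ "vs ! length us"]
        exI[of _ "drop (Suc (length us)) vs"]) auto
  show "list_times (us @ (u + u') # ws) vs = list_times (us @ u # ws) vs + list_times (us @ u' # ws) vs"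
    using split by (auto simp: list_times_def distrib_right ptens_add)
  show "list_times (us @ (c *\<^sub>C u) # ws) vs = c *\<^sub>C list_times (us @ u # ws) vs"
    using split by (auto simp: list_times_def mult_scaleC_left ptens_scale)
qed

definition tpower_mul1 :: "'u::complex_algebra list \<Rightarrow> 'u tpower \<Rightarrow> 'u tpower" where
  "tpower_mul1 us = tpower_lift (list_times us)"

lemmas tpower_mul1_simps =
  tpower_lift_ptens[OF multilin_list_times_right, folded tpower_mul1_def]
  tpower_lift_add[OF multilin_list_times_right, folded tpower_mul1_def]
  tpower_lift_scale[OF multilin_list_times_right, folded tpower_mul1_def]

lemma multilin_tpower_mul1: "multilin (\<lambda>us. tpower_mul1 us y)"
  unfolding multilin_def
proof (intro conjI allI)
  fix us ws :: "'a list" and u v and c :: complex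
  note simps = tpower_mul1_simps multilin_list_times_left[unfolded multilin_def]
    scaleC_add_right scaleC_scaleC mult.commute
  show "tpower_mul1 (us @ (u + v) # ws) y = tpower_mul1 (us @ u # ws) y + tpower_mul1 (us @ v # ws) y"
    by (rule tpower_eqI[where G = "\<lambda>y. tpower_mul1 (us @ u # ws) y + tpower_mul1 (us @ v # ws) y"])
       (simp_all add: simps)
  show "tpower_mul1 (us @ (c *\<^sub>C u) # ws) y = c *\<^sub>C tpower_mul1 (us @ u # ws) y"
    by (rule tpower_eqI[where G = "\<lambda>y. c *\<^sub>C tpower_mul1 (us @ u # ws) y"])
       (simp_all add: simps)
qed

instantiation tpower :: (complex_algebra) complex_algebra
begin

definition times_tpower :: "'a tpower \<Rightarrow> 'a tpower \<Rightarrow> 'a tpower" where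
  "times_tpower x y = tpower_lift (\<lambda>us. tpower_mul1 us y) x"

lemma ptens_times: "ptens us * y = tpower_mul1 us y" for y :: "'a tpower"
  by (simp add: times_tpower_def tpower_lift_ptens[OF multilin_tpower_mul1])

lemma tpower_times_add_left: "(x + y) * z = x * z + y * z" for x y z :: "'a tpower"
  by (simp add: times_tpower_def tpower_lift_add[OF multilin_tpower_mul1])

lemma tpower_times_scale_left: "(c *\<^sub>C x) * y = c *\<^sub>C (x * y)" for x y :: "'a tpower"
  by (simp add: times_tpower_def tpower_lift_scale[OF multilin_tpower_mul1])

lemma tpower_times_add_right: "x * (y + z) = x * y + x * z" for x y z :: "'a tpower"
  by (rule tpower_eqI[where G = "\<lambda>x. x * y + x * z"])
     (simp_all add: tpower_times_add_left tpower_times_scale_left scaleC_add_right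
        ptens_times tpower_mul1_simps)

lemma tpower_times_scale_right: "x * (c *\<^sub>C y) = c *\<^sub>C (x * y)" for x y :: "'a tpower"
  by (rule tpower_eqI[where G = "\<lambda>x. c *\<^sub>C (x * y)"])
     (simp_all add: tpower_times_add_left tpower_times_scale_left scaleC_add_right scaleC_scaleC
        mult.commute ptens_times tpower_mul1_simps)

lemma ptens_times_ptens:
  "ptens us * ptens vs = (if length us = length vs then ptens (map2 (*) us vs) else 0)"
  for us :: "'a list"
  by (simp add: ptens_times tpower_mul1_simps list_times_def)

instance
proof
  fix x y z :: "'a tpower" and c :: complex
  note lin = tpower_times_add_left tpower_times_add_right tpower_times_scale_left
    tpower_times_scale_right scaleC_add_right
  show "(x + y) * z = x * z + y * z" "x * (y + z) = x * y + x * z"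
    "(c *\<^sub>C x) * y = c *\<^sub>C (x * y)" "x * (c *\<^sub>C y) = c *\<^sub>C (x * y)"
    by (simp_all only: lin)
  have zero: "0 * x = 0" "x * 0 = 0" for x :: "'a tpower"
    using tpower_times_add_left[of 0 0 x] tpower_times_add_right[of x 0 0] by simp_all
  have pure: "ptens us * ptens vs * ptens ws = ptens us * (ptens vs * ptens ws)"
    for us vs ws :: "'a list"
    by (auto simp: ptens_times_ptens zero mult.assoc intro!: arg_cong[where f = ptens] nth_equalityI)
  show "x * y * z = x * (y * z)"
  proof (rule tpower_eqI[where F = "\<lambda>x. x * y * z"])
    fix us show "ptens us * y * z = ptens us * (y * z)"
    proof (rule tpower_eqI[where F = "\<lambda>y. ptens us * y * z"])
      fix vs show "ptens us * ptens vs * z = ptens us * (ptens vs * z)"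
        by (rule tpower_eqI[where F = "\<lambda>z. ptens us * ptens vs * z"]) (simp_all only: lin pure)
    qed (simp_all only: lin)
  qed (simp_all only: lin)
qed

end


section \<open>Placement of tensor components\<close>

text \<open>\<open>slots N ps\<close>: the list of length \<open>N\<close> with entry \<open>u\<close> at each position \<open>i\<close> (counted from \<open>1\<close>) with
  \<open>(i, u)\<close> in \<open>ps\<close>, and \<open>1\<close> elsewhere.\<close>

definition slots :: "nat \<Rightarrow> (nat \<times> 'u::one) list \<Rightarrow> 'u list" where
  "slots N ps = map (\<lambda>p. case map_of ps p of Some u \<Rightarrow> u | None \<Rightarrow> 1) [1..<Suc N]"

definition at1 :: "nat \<Rightarrow> nat \<Rightarrow> 'u::complex_algebra_1 \<Rightarrow> 'u tpower" where
  "at1 N i u = ptens (slots N [(i, u)])"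

definition at2 :: "nat \<Rightarrow> nat \<Rightarrow> nat \<Rightarrow> ('u::complex_algebra_1, 'u) tensor \<Rightarrow> 'u tpower" where
  "at2 N i j = tensor_lift (\<lambda>u v. ptens (slots N [(i, u), (j, v)]))"

text \<open>Meromorphic functions with values in an algebra \<open>B\<close> are elements of \<open>\<M> \<otimes> B\<close>; \<open>'v\<close> stands for
  the domain.\<close>

type_synonym ('v, 'B) merof = "('v mero, 'B) tensor"

definition const_fun :: "'B::complex_vector \<Rightarrow> ('v::complex_normed_vector, 'B) merof" where
  "const_fun b = 1 \<otimes> b"

definition fun_deriv :: "'v::complex_normed_vector \<Rightarrow>
    ('v, 'B::complex_vector) merof \<Rightarrow> ('v, 'B) merof" where
  "fun_deriv v = tensor_map (mero_deriv v) id"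

definition fun_map :: "('B::complex_vector \<Rightarrow> 'C::complex_vector) \<Rightarrow>
    ('v::complex_normed_vector, 'B) merof \<Rightarrow> ('v, 'C) merof" where
  "fun_map g = tensor_map id g"

text \<open>\<open>A\<^sub>\<ell> \<otimes> U\<^sup>\<otimes>\<^sup>N \<otimes> A\<^sub>r\<close> is contained in the following algebra, whose middle factor comprises all
  tensor powers of \<open>U\<close>.\<close>

type_synonym ('a, 'u, 'b) tri = "('a, ('u tpower, 'b) tensor) tensor"

definition mid :: "'u::complex_vector tpower \<Rightarrow> ('a::complex_algebra_1, 'u, 'b::complex_algebra_1) tri"
  where "mid z = 1 \<otimes> z \<otimes> 1"

definition kappa_at :: "nat \<Rightarrow> nat \<Rightarrow>
    ('v::complex_normed_vector,
      ('a::complex_algebra_1, ('u::complex_algebra_1, 'b::complex_algebra_1) tensor) tensor) merof \<Rightarrow>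
    ('v, ('a, 'u, 'b) tri) merof" where
  "kappa_at N i = fun_map (tensor_map id (tensor_map (at1 N i) id))"

definition r_at :: "nat \<Rightarrow> nat \<Rightarrow> nat \<Rightarrow>
    ('v::complex_normed_vector, ('u::complex_algebra_1, 'u) tensor) merof \<Rightarrow>
    ('v, 'u tpower) merof" where
  "r_at N i j = fun_map (at2 N i j)"

definition r_tri_at :: "nat \<Rightarrow> nat \<Rightarrow> nat \<Rightarrow>
    ('v::complex_normed_vector, ('u::complex_algebra_1, 'u) tensor) merof \<Rightarrow>
    ('v, ('a::complex_algebra_1, 'u, 'b::complex_algebra_1) tri) merof" where
  "r_tri_at N i j r = fun_map mid (r_at N i j r)"


section \<open>The space \<open>\<aa>\<close> and its dual\<close>

definition dual_space :: "'u::complex_vector set \<Rightarrow> ('u \<Rightarrow> complex) set" where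
  "dual_space \<aa> = {\<phi>. (\<forall>x\<in>\<aa>. \<forall>y\<in>\<aa>. \<phi> (x + y) = \<phi> x + \<phi> y) \<and>
     (\<forall>c. \<forall>x\<in>\<aa>. \<phi> (c *\<^sub>C x) = c * \<phi> x) \<and> (\<forall>x. x \<notin> \<aa> \<longrightarrow> \<phi> x = 0)}"

text \<open>The dual of \<open>\<aa>\<close> is represented by a normed space \<open>'v\<close> together with a linear isomorphism \<open>ev\<close> of
  \<open>'v\<close> onto \<open>dual_space \<aa>\<close>. As \<open>\<aa>\<close> is finite-dimensional, the choice of norm is immaterial.\<close>

definition is_dual :: "'u::complex_vector set \<Rightarrow> ('v::complex_normed_vector \<Rightarrow> 'u \<Rightarrow> complex) \<Rightarrow> bool"
  where "is_dual \<aa> ev \<longleftrightarrow> bij_betw ev UNIV (dual_space \<aa>) \<and>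
    (\<forall>v w x. ev (v + w) x = ev v x + ev w x) \<and> (\<forall>c v x. ev (c *\<^sub>C v) x = c * ev v x)"

definition is_basis :: "'u::complex_vector set \<Rightarrow> nat \<Rightarrow> (nat \<Rightarrow> 'u) \<Rightarrow> bool" where
  "is_basis \<aa> d x \<longleftrightarrow> inj_on x {1..d} \<and> cvec.independent (x ` {1..d}) \<and> cvec.span (x ` {1..d}) = \<aa>"

definition is_dual_basis :: "('v \<Rightarrow> 'u \<Rightarrow> complex) \<Rightarrow> nat \<Rightarrow> (nat \<Rightarrow> 'u) \<Rightarrow> (nat \<Rightarrow> 'v) \<Rightarrow> bool" where
  "is_dual_basis ev d x \<mu> \<longleftrightarrow>
     (\<forall>k\<in>{1..d}. \<forall>l\<in>{1..d}. ev (\<mu> k) (x l) = (if k = l then 1 else 0))"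

text \<open>\<open>euler d x \<mu> p = \<Sum>\<^sub>k p (x\<^sub>k) \<partial>\<^bsub>\<mu>\<^sub>k\<^esub>\<close>, where \<open>p\<close> embeds \<open>U\<close> into the algebra of values;
  \<open>E\<^sub>i\<close> is the case where \<open>p\<close> is the embedding into the \<open>i\<close>-th \<open>U\<close>-position.\<close>

definition euler :: "nat \<Rightarrow> (nat \<Rightarrow> 'u) \<Rightarrow> (nat \<Rightarrow> 'v) \<Rightarrow> ('u \<Rightarrow> 'B) \<Rightarrow>
    ('v::complex_normed_vector, 'B::complex_algebra) merof \<Rightarrow> ('v, 'B) merof" where
  "euler d x \<mu> p f = (\<Sum>k=1..d. const_fun (p (x k)) * fun_deriv (\<mu> k) f)"


section \<open>Differential operators\<close>

text \<open>The meromorphic functions with values in \<open>A\<^sub>\<ell> \<otimes> U\<^sup>\<otimes>\<^sup>N \<otimes> A\<^sub>r\<close>.\<close>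

definition coeff_ring :: "nat \<Rightarrow> ('v::complex_normed_vector,
    ('a::complex_vector, 'u::complex_vector, 'b::complex_vector) tri) merof set" where
  "coeff_ring N = cvec.span {m \<otimes> a \<otimes> ptens us \<otimes> b | m a us b. length us = N}"

text \<open>The algebra \<open>\<bbbD>\<^sub>N\<close>, realised as operators on \<open>coeff_ring N\<close>: two of its elements are equal if they
  coincide on \<open>coeff_ring N\<close>. (Applying an operator to polynomials recovers all its coefficients.)\<close>

inductive_set diff_ops :: "nat \<Rightarrow> (('v::complex_normed_vector,
    ('a::complex_algebra_1, 'u::complex_algebra_1, 'b::complex_algebra_1) tri) merof \<Rightarrow>
    ('v, ('a, 'u, 'b) tri) merof) set" for N where
  mult: "a \<in> coeff_ring N \<Longrightarrow> (\<lambda>f. a * f) \<in> diff_ops N"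
| deriv: "fun_deriv v \<in> diff_ops N"
| scale: "P \<in> diff_ops N \<Longrightarrow> (\<lambda>f. c *\<^sub>C P f) \<in> diff_ops N"
| add: "P \<in> diff_ops N \<Longrightarrow> Q \<in> diff_ops N \<Longrightarrow> (\<lambda>f. P f + Q f) \<in> diff_ops N"
| comp: "P \<in> diff_ops N \<Longrightarrow> Q \<in> diff_ops N \<Longrightarrow> (\<lambda>f. P (Q f)) \<in> diff_ops N"

definition diff_op_eq :: "nat \<Rightarrow> (('v::complex_normed_vector,
    ('a::complex_algebra_1, 'u::complex_algebra_1, 'b::complex_algebra_1) tri) merof \<Rightarrow>
    ('v, ('a, 'u, 'b) tri) merof) \<Rightarrow>
    (('v, ('a, 'u, 'b) tri) merof \<Rightarrow> ('v, ('a, 'u, 'b) tri) merof) \<Rightarrow> bool" where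
  "diff_op_eq N P Q \<longleftrightarrow> (\<forall>f\<in>coeff_ring N. P f = Q f)"

definition op_comm :: "('f \<Rightarrow> 'f) \<Rightarrow> ('f \<Rightarrow> 'f) \<Rightarrow> 'f \<Rightarrow> 'f::ab_group_add" where
  "op_comm P Q = (\<lambda>f. P (Q f) - Q (P f))"

definition Dop :: "nat \<Rightarrow> (nat \<Rightarrow> 'u) \<Rightarrow> (nat \<Rightarrow> 'v) \<Rightarrow>
    ('v::complex_normed_vector, ('u::complex_algebra_1, 'u) tensor) merof \<Rightarrow>
    ('v, ('u, 'u) tensor) merof \<Rightarrow>
    ('v, ('a::complex_algebra_1, ('u, 'b::complex_algebra_1) tensor) tensor) merof \<Rightarrow>
    nat \<Rightarrow> nat \<Rightarrow> ('v, ('a, 'u, 'b) tri) merof \<Rightarrow> ('v, ('a, 'u, 'b) tri) merof" where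
  "Dop d x \<mu> rp rm \<kappa> N i = (\<lambda>f. euler d x \<mu> (\<lambda>u. mid (at1 N i u)) f
     - (\<Sum>s=1..<i. r_tri_at N s i rp * f)
     - kappa_at N i \<kappa> * f
     - (\<Sum>s=Suc i..N. r_tri_at N i s rm * f))"


lemma tensor_lift_in_span:
  assumes "\<And>a b. f a b \<in> cvec.span S" shows "tensor_lift f t \<in> cvec.span S"
  unfolding tensor_lift_def free_ext_def
  by (intro cvec.span_sum cvec.span_scale) (simp add: assms split: prod.split)

lemma tens_in_span_right:
  assumes "z \<in> cvec.span T" "\<And>t. t \<in> T \<Longrightarrow> m \<otimes> t \<in> cvec.span S"
  shows "m \<otimes> z \<in> cvec.span S"
  using assms(1)
proof (induction rule: cvec.span_induct)
  case base
  have "m \<otimes> (0 *\<^sub>C z) = 0 *\<^sub>C (m \<otimes> z)" by (rule tens_scale_right)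
  then have "m \<otimes> 0 \<in> cvec.span S" using cvec.span_zero by simp
  then show ?case
    by (auto simp: cvec.subspace_def tens_add_right tens_scale_right
        intro: cvec.span_zero cvec.span_add cvec.span_scale)
qed (rule assms(2))

lemma length_slots [simp]: "length (slots N ps) = N"
  by (simp add: slots_def)

lemma tensor_lift_span:
  assumes "bilin f" "z \<in> cvec.span S" "\<And>s. s \<in> S \<Longrightarrow> tensor_lift f s \<in> cvec.span T"
  shows "tensor_lift f z \<in> cvec.span T"
  using assms(2)
proof (induction rule: cvec.span_induct)
  case base
  have "tensor_lift f 0 = 0" using tensor_lift_scale[OF assms(1), of 0 0] by simp
  then show ?case
    by (auto simp: cvec.subspace_def tensor_lift_add[OF assms(1)] tensor_lift_scale[OF assms(1)]
        intro: cvec.span_zero cvec.span_add cvec.span_scale)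
qed (rule assms(3))

lemma r_tri_at_in_coeff_ring:
  fixes r :: "('v::complex_normed_vector, ('u::complex_algebra_1, 'u) tensor) merof"
  shows "(r_tri_at N i j r ::
    ('v, ('a::complex_algebra_1, 'u, 'b::complex_algebra_1) tri) merof) \<in> coeff_ring N"
proof -
  have z: "at2 N i j t \<in> cvec.span {ptens us | us. length us = N}" for t :: "('u, 'u) tensor"
    unfolding at2_def by (rule tensor_lift_in_span) (auto intro!: cvec.span_base exI[of _ "slots N _"])
  let ?S = "{m \<otimes> ptens us | m us. length us = N} :: ('v, 'u tpower) merof set"
  have r: "r_at N i j r \<in> cvec.span ?S"
    unfolding r_at_def fun_map_def tensor_map_def
    by (rule tensor_lift_in_span, rule tens_in_span_right, rule z) (auto intro!: cvec.span_base)
  have mid: "bilin (\<lambda>(m::'v mero) z. id m \<otimes> (mid z :: ('a, 'u, 'b) tri))"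
    by (simp add: bilin_def mid_def tens_simps)
  show ?thesis
    unfolding r_tri_at_def fun_map_def tensor_map_def coeff_ring_def
  proof (rule tensor_lift_span[OF mid r], elim CollectE exE conjE)
    fix s and m :: "'v mero" and us :: "'u list" assume s: "s = m \<otimes> ptens us" "length us = N"
    have "tensor_lift (\<lambda>a b. id a \<otimes> (mid b :: ('a, 'u, 'b) tri)) s = m \<otimes> 1 \<otimes> ptens us \<otimes> 1"
      unfolding s(1) by (subst tensor_lift_tens[OF mid]) (simp add: mid_def)
    then show "tensor_lift (\<lambda>a b. id a \<otimes> (mid b :: ('a, 'u, 'b) tri)) s
        \<in> cvec.span {m \<otimes> a \<otimes> ptens us \<otimes> b | m a us b. length us = N}"
      using s(2) by (auto intro!: cvec.span_base)
  qed
qed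

lemma kappa_at_in_coeff_ring: "kappa_at N i \<kappa> \<in> coeff_ring N"
  unfolding kappa_at_def fun_map_def tensor_map_def coeff_ring_def
proof (rule tensor_lift_in_span, rule tens_in_span_right)
  fix t
  show "tensor_lift (\<lambda>a b. id a \<otimes> tensor_lift (\<lambda>a b. at1 N i a \<otimes> id b) b) t
      \<in> cvec.span {a \<otimes> ptens us \<otimes> b | a us b. length us = N}"
  proof (rule tensor_lift_in_span, rule tens_in_span_right)
    fix t show "tensor_lift (\<lambda>a b. at1 N i a \<otimes> id b) t
        \<in> cvec.span {ptens us \<otimes> b | us b. length us = N}"
      by (rule tensor_lift_in_span)
         (auto simp: at1_def intro!: cvec.span_base exI[of _ "slots N _"])
  qed (auto intro!: cvec.span_base)
qed (auto intro!: cvec.span_base)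

lemma const_at_in_coeff_ring: "const_fun (mid (at1 N i u)) \<in> coeff_ring N"
  unfolding const_fun_def mid_def coeff_ring_def at1_def
  by (intro cvec.span_base CollectI exI conjI, rule refl) (rule length_slots)

lemma diff_ops_zero: "(\<lambda>_. 0) \<in> diff_ops N"
  using diff_ops.scale[OF diff_ops.deriv, of 0] by simp

lemma diff_ops_sum:
  "finite S \<Longrightarrow> (\<And>s. s \<in> S \<Longrightarrow> P s \<in> diff_ops N) \<Longrightarrow> (\<lambda>f. \<Sum>s\<in>S. P s f) \<in> diff_ops N"
  by (induction S rule: finite_induct) (auto intro: diff_ops_zero diff_ops.add)

lemma diff_ops_diff:
  "P \<in> diff_ops N \<Longrightarrow> Q \<in> diff_ops N \<Longrightarrow> (\<lambda>f. P f - Q f) \<in> diff_ops N"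
  using diff_ops.add[OF _ diff_ops.scale[of Q N "- 1"], of P] by simp

lemma Dop_in_diff_ops: "Dop d x \<mu> rp rm \<kappa> N i \<in> diff_ops N"
  unfolding Dop_def euler_def
  by (intro diff_ops_diff diff_ops_sum finite_atLeastAtMost finite_atLeastLessThan
      r_tri_at_in_coeff_ring kappa_at_in_coeff_ring diff_ops.mult
      diff_ops.comp[OF diff_ops.mult diff_ops.deriv] const_at_in_coeff_ring)

section \<open>The equations\<close>

definition a_compatible :: "'u::complex_algebra_1 set \<Rightarrow>
    ('v::complex_normed_vector, ('u, 'u) tensor) merof \<Rightarrow> ('v, ('u, 'u) tensor) merof \<Rightarrow> bool" where
  "a_compatible \<aa> rp rm \<longleftrightarrow>
     (\<forall>x\<in>\<aa>. lie_comm (const_fun (x \<otimes> 1)) rp = lie_comm (const_fun (1 \<otimes> x)) rm)"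

definition CYB1 :: "nat \<Rightarrow> (nat \<Rightarrow> 'u) \<Rightarrow> (nat \<Rightarrow> 'v) \<Rightarrow>
    ('v::complex_normed_vector, ('u::complex_algebra_1, 'u) tensor) merof \<Rightarrow>
    ('v, ('u, 'u) tensor) merof \<Rightarrow> ('v, 'u tpower) merof" where
  "CYB1 d x \<mu> rp rm =
     (let p = (\<lambda>i j. r_at 3 i j rp); m = (\<lambda>i j. r_at 3 i j rm); E = (\<lambda>i. euler d x \<mu> (at1 3 i)) in
      lie_comm (p 1 2) (p 1 3) + lie_comm (p 1 2) (p 2 3) - lie_comm (p 1 3) (m 2 3)
      + E 3 (p 1 2) - E 2 (p 1 3))"

definition CYB2 :: "nat \<Rightarrow> (nat \<Rightarrow> 'u) \<Rightarrow> (nat \<Rightarrow> 'v) \<Rightarrow>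
    ('v::complex_normed_vector, ('u::complex_algebra_1, 'u) tensor) merof \<Rightarrow>
    ('v, ('u, 'u) tensor) merof \<Rightarrow> ('v, 'u tpower) merof" where
  "CYB2 d x \<mu> rp rm =
     (let p = (\<lambda>i j. r_at 3 i j rp); m = (\<lambda>i j. r_at 3 i j rm); E = (\<lambda>i. euler d x \<mu> (at1 3 i)) in
      lie_comm (m 1 2) (p 1 3) + lie_comm (m 1 2) (p 2 3) + lie_comm (m 1 3) (p 2 3)
      + E 3 (m 1 2) - E 1 (p 2 3))"

definition CYB3 :: "nat \<Rightarrow> (nat \<Rightarrow> 'u) \<Rightarrow> (nat \<Rightarrow> 'v) \<Rightarrow>
    ('v::complex_normed_vector, ('u::complex_algebra_1, 'u) tensor) merof \<Rightarrow>
    ('v, ('u, 'u) tensor) merof \<Rightarrow> ('v, 'u tpower) merof" where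
  "CYB3 d x \<mu> rp rm =
     (let p = (\<lambda>i j. r_at 3 i j rp); m = (\<lambda>i j. r_at 3 i j rm); E = (\<lambda>i. euler d x \<mu> (at1 3 i)) in
      - lie_comm (p 1 2) (m 1 3) + lie_comm (m 1 2) (m 2 3) + lie_comm (m 1 3) (m 2 3)
      + E 2 (m 1 3) - E 1 (m 2 3))"

definition CR :: "nat \<Rightarrow> (nat \<Rightarrow> 'u) \<Rightarrow> (nat \<Rightarrow> 'v) \<Rightarrow>
    ('v::complex_normed_vector, ('u::complex_algebra_1, 'u) tensor) merof \<Rightarrow>
    ('v, ('u, 'u) tensor) merof \<Rightarrow>
    ('v, ('a::complex_algebra_1, ('u, 'b::complex_algebra_1) tensor) tensor) merof \<Rightarrow>
    ('v, ('a, 'u, 'b) tri) merof" where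
  "CR d x \<mu> rp rm \<kappa> =
     (let p = r_tri_at 2 1 2 rp; m = r_tri_at 2 1 2 rm; k = (\<lambda>i. kappa_at 2 i \<kappa>);
          E = (\<lambda>i. euler d x \<mu> (\<lambda>u. mid (at1 2 i u))) in
      lie_comm (k 1 + m) (k 2 + p) + E 2 (m + k 1) - E 1 (p + k 2))"

end

(*  Writing D_i = E_i - K_i with K_i a multiplication operator, one finds for i < j

      [D_i, D_j] = Z + sum_k C_k d_{mu_k},
      Z = [K_i, K_j] - E_i(K_j) + E_j(K_i),   C_k = [(x_k)_j, K_i] - [(x_k)_i, K_j],

    because directional derivatives are commuting derivations of the meromorphic functions and the
    E_i commute. Elements placed at disjoint positions commute, so C_k only involves r at (i,j) and
    expresses a-compatibility, while Z is CR at (i,j) plus one term for each s different from i, j,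
    namely CYB1 at (s,i,j), CYB2 at (i,s,j) or CYB3 at (i,j,s). The operator vanishes iff Z and all
    C_k do, as is seen on the unit and on linear coordinates. The cases N = 2 and N = 3 then recover
    all the equations, since z |-> 1 (x) z (x) 1 is injective.  *)

theory Submission
  imports Defs "HOL-Complex_Analysis.Cauchy_Integral_Formula"
begin

section \<open>Directional derivatives of holomorphic functions\<close>

text \<open>The space \<open>'v\<close> is a complex normed space known to be finite-dimensional
  only through \<open>ev\<close>, and holomorphic means Frechet differentiable with complex-linear
  derivative. That \<partial>_v preserves meromorphic functions and that such derivatives commute
  therefore has to be built up: restriction to lines t |-> q + t v reduces both to Cauchy's
  estimates in one variable. Linear coordinates are holomorphic in this sense only once they are
  bounded for the given norm, which compactness supplies.

  The equations live on two or three sites, the operators on N. Placement along a list of distinct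
  sites is multiplicative and compatible with \<partial>_v and the E_i, so it carries one identity
  to all tuples of sites. Injectivity of z |-> 1 \<otimes> z \<otimes> 1 rests on linear functionals
  on the outer algebras with value 1 at the unit.\<close>

definition dirderiv :: "'v::complex_normed_vector \<Rightarrow> ('v \<Rightarrow> complex) \<Rightarrow> 'v \<Rightarrow> complex" where
  "dirderiv v f q = deriv (\<lambda>t. f (q + t *\<^sub>C v)) 0"

lemma has_derivative_line:
  fixes v q :: "'v::complex_normed_vector"
  shows "((\<lambda>t. q + t *\<^sub>C v) has_derivative (\<lambda>t. t *\<^sub>C v)) F"
proof -
  have "bounded_linear (\<lambda>t. t *\<^sub>C v)"
    by (rule bounded_linear_intro[where K = "norm v"])
       (simp_all add: scaleC_add_left scaleR_scaleC scaleC_scaleC norm_scaleC scaleR_conv_of_real)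
  from has_derivative_add[OF has_derivative_const bounded_linear_imp_has_derivative[OF this]]
  show ?thesis by simp
qed

lemma continuous_on_line: "continuous_on S (\<lambda>t. q + t *\<^sub>C (v :: 'v::complex_normed_vector))"
  by (rule has_derivative_continuous_on[OF has_derivative_line])

lemma dirderiv_eq:
  assumes "(f has_derivative L) (at q)" "\<forall>c h. L (c *\<^sub>C h) = c * L h"
  shows "((\<lambda>t. f (q + t *\<^sub>C v)) has_field_derivative L v) (at 0)" and "dirderiv v f q = L v"
proof -
  have "((\<lambda>t. f (q + t *\<^sub>C v)) has_derivative (\<lambda>t. L (t *\<^sub>C v))) (at 0)"
    by (rule has_derivative_compose[OF has_derivative_line]) (use assms(1) in \<open>simp add: cvec.scale_zero_left\<close>)
  then show 1: "((\<lambda>t. f (q + t *\<^sub>C v)) has_field_derivative L v) (at 0)"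
    using assms(2) by (simp add: has_field_derivative_def mult_commute_abs)
  show "dirderiv v f q = L v"
    unfolding dirderiv_def by (rule DERIV_imp_deriv[OF 1])
qed

text \<open>The derivative is determined by its values, so h |-> \<open>dirderiv h f q\<close> names
  it without a choice, and the homogeneity demanded by \<open>holo_on\<close> becomes homogeneity in
  the direction.\<close>

lemma holo_onE:
  assumes "holo_on V f" "q \<in> V"
  shows "(f has_derivative (\<lambda>h. dirderiv h f q)) (at q)"
    and "dirderiv (c *\<^sub>C h) f q = c * dirderiv h f q"
proof -
  obtain L where L: "(f has_derivative L) (at q)" "\<forall>c h. L (c *\<^sub>C h) = c * L h"
    using assms unfolding holo_on_def by blast
  have "L = (\<lambda>h. dirderiv h f q)" using dirderiv_eq(2)[OF L] by auto
  with L show "(f has_derivative (\<lambda>h. dirderiv h f q)) (at q)"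
    "dirderiv (c *\<^sub>C h) f q = c * dirderiv h f q" by auto
qed

text \<open>\<open>dirderiv\<close> differentiates at parameter 0 only; moving the base point along
  the line gives the derivative at parameter s.\<close>

lemma holo_on_line:
  assumes "holo_on V f" "q + s *\<^sub>C v \<in> V"
  shows "((\<lambda>t. f (q + t *\<^sub>C v)) has_field_derivative dirderiv v f (q + s *\<^sub>C v)) (at s)"
proof -
  have "((\<lambda>t. f ((q + s *\<^sub>C v) + t *\<^sub>C v)) has_field_derivative dirderiv v f (q + s *\<^sub>C v)) (at (s - s))"
    using dirderiv_eq(1)[OF holo_onE(1)[OF assms]] holo_onE(2)[OF assms] by simp
  then have "((\<lambda>t. f ((q + s *\<^sub>C v) + (t - s) *\<^sub>C v)) has_field_derivative dirderiv v f (q + s *\<^sub>C v)) (at s)"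
    using DERIV_shift[of "\<lambda>t. f ((q + s *\<^sub>C v) + t *\<^sub>C v)" _ s "-s"] by simp
  then show ?thesis by (simp add: cvec.scale_left_diff_distrib algebra_simps)
qed

lemma holo_on_line_holomorphic:
  assumes "holo_on V f" "\<And>t. t \<in> S \<Longrightarrow> q + t *\<^sub>C v \<in> V"
  shows "(\<lambda>t. f (q + t *\<^sub>C v)) holomorphic_on S"
  unfolding holomorphic_on_def field_differentiable_def
  using holo_on_line[OF assms(1) assms(2)] has_field_derivative_at_within by blast

lemma dirderiv_zero: "dirderiv 0 f q = 0"
  by (simp add: dirderiv_def)

lemma dirderiv_cong:
  assumes "open W" "q \<in> W" "\<And>y. y \<in> W \<Longrightarrow> f y = g y"
  shows "dirderiv v f q = dirderiv v g q"
  unfolding dirderiv_def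
proof (rule deriv_cong_ev)
  have "open ((\<lambda>t. q + t *\<^sub>C v) -` W)"
    by (rule open_vimage[OF assms(1) continuous_on_line])
  then have "\<forall>\<^sub>F t in nhds 0. t \<in> (\<lambda>t. q + t *\<^sub>C v) -` W"
    using assms(2) by (intro eventually_nhds_in_open) auto
  then show "\<forall>\<^sub>F t in nhds 0. f (q + t *\<^sub>C v) = g (q + t *\<^sub>C v)"
    by eventually_elim (use assms(3) in auto)
qed simp

text \<open>Taylor's formula of first order. For |t| \<le> \<rho>/2 the disc of radius \<rho>/4
  around t stays inside, and Cauchy's inequality there bounds the second derivative by 2! M /
  (\<rho>/4)^2, whence the 32.\<close>

lemma holomorphic_second_order_bound:
  assumes \<phi>: "\<phi> holomorphic_on ball 0 \<rho>" and M: "\<And>t. t \<in> ball 0 \<rho> \<Longrightarrow> cmod (\<phi> t) \<le> M"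
    and c: "cmod c \<le> \<rho> / 2" and "\<rho> > 0"
  shows "cmod (\<phi> c - \<phi> 0 - c * deriv \<phi> 0) \<le> 32 * M * (cmod c)\<^sup>2 / \<rho>\<^sup>2"
proof -
  let ?S = "cball 0 (\<rho> / 2) :: complex set"
  have sub: "cball t (\<rho> / 4) \<subseteq> ball 0 \<rho>" if "t \<in> ?S" for t
  proof
    fix s assume "s \<in> cball t (\<rho> / 4)"
    then have "cmod s \<le> cmod t + cmod (s - t)" "cmod (s - t) \<le> \<rho> / 4"
      using norm_triangle_sub[of s t] by (auto simp: dist_norm norm_minus_commute)
    then show "s \<in> ball 0 \<rho>" using that \<open>\<rho> > 0\<close> by auto
  qed
  have B: "cmod ((deriv ^^ 2) \<phi> t) \<le> 32 * M / \<rho>\<^sup>2" if t: "t \<in> ?S" for t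
  proof -
    have "cmod ((deriv ^^ 2) \<phi> t) \<le> fact 2 * M / (\<rho> / 4) ^ 2"
    proof (rule Cauchy_inequality)
      show "\<phi> holomorphic_on ball t (\<rho> / 4)" "continuous_on (cball t (\<rho> / 4)) \<phi>"
        using sub[OF t] \<phi> ball_subset_cball holomorphic_on_subset holomorphic_on_imp_continuous_on
        by (metis dual_order.trans)+
      show "cmod (\<phi> s) \<le> M" if "cmod (t - s) = \<rho> / 4" for s
        using sub[OF t] that by (intro M) (auto simp: dist_norm)
    qed (use \<open>\<rho> > 0\<close> in auto)
    then show ?thesis by (simp add: field_simps power2_eq_square)
  qed
  have "cmod ((deriv ^^ 0) \<phi> c - (\<Sum>i\<le>1. (deriv ^^ i) \<phi> 0 * (c - 0) ^ i / fact i))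
      \<le> 32 * M / \<rho>\<^sup>2 * cmod (c - 0) ^ Suc 1 / fact 1"
  proof (rule complex_Taylor[where S = ?S and f = "\<lambda>i. (deriv ^^ i) \<phi>"])
    fix i t assume "t \<in> ?S"
    then have "t \<in> ball 0 \<rho>" using \<open>\<rho> > 0\<close> by auto
    then have "((deriv ^^ i) \<phi> has_field_derivative (deriv ^^ Suc i) \<phi> t) (at t)"
      using holomorphic_derivI[OF holomorphic_higher_deriv[OF \<phi> open_ball] open_ball] by simp
    then show "((deriv ^^ i) \<phi> has_field_derivative (deriv ^^ Suc i) \<phi> t) (at t within ?S)"
      by (rule has_field_derivative_at_within)
  qed (use B c \<open>\<rho> > 0\<close> in \<open>auto simp: numeral_2_eq_2\<close>)
  then show ?thesis by (simp add: algebra_simps power2_eq_square numeral_2_eq_2)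
qed

section \<open>Estimates and limits on a ball where the function is bounded\<close>

context
  fixes p :: "'v::complex_normed_vector" and R M :: real and g :: "'v \<Rightarrow> complex"
  assumes g: "holo_on (ball p R) g" and M: "\<And>y. y \<in> ball p R \<Longrightarrow> cmod (g y) \<le> M" and R: "R > 0"
begin

lemma in_ball_shift: "z \<in> ball p r1 \<Longrightarrow> norm h \<le> r2 \<Longrightarrow> r1 + r2 \<le> r \<Longrightarrow> z + h \<in> ball p r"
  using norm_triangle_sub[of "z + h - p" "z - p"]
  by (auto simp: dist_norm norm_minus_commute)

text \<open>The second order bound for t |-> g (z + t h) on the disc of radius R / (2 |h|), which
  keeps the points within R/2 of z; 128 = 32 * 4. The estimate does not depend on z, as the uniform
  limits below require.\<close>

lemma holo_quotient_bound:
  assumes z: "z \<in> ball p (R / 2)" and c: "c \<noteq> 0" "cmod c * norm h \<le> R / 4"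
  shows "cmod ((g (z + c *\<^sub>C h) - g z) / c - dirderiv h g z) \<le> 128 * M * cmod c * (norm h)\<^sup>2 / R\<^sup>2"
proof (cases "h = 0")
  case True
  then show ?thesis by (simp add: dirderiv_zero cvec.scale_zero_right)
next
  case False
  define \<rho> where "\<rho> = R / (2 * norm h)"
  have \<rho>: "\<rho> > 0" using False R by (simp add: \<rho>_def)
  have in_ball: "z + t *\<^sub>C h \<in> ball p R" if "t \<in> ball 0 \<rho>" for t
    using that False by (intro in_ball_shift[OF z, of _ "R / 2"]) (auto simp: norm_scaleC \<rho>_def field_simps)
  have "cmod (g (z + c *\<^sub>C h) - g (z + 0 *\<^sub>C h) - c * deriv (\<lambda>t. g (z + t *\<^sub>C h)) 0)
      \<le> 32 * M * (cmod c)\<^sup>2 / \<rho>\<^sup>2"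
    using \<rho> c False in_ball
    by (intro holomorphic_second_order_bound holo_on_line_holomorphic[OF g] M)
       (auto simp: \<rho>_def field_simps)
  then have "cmod (g (z + c *\<^sub>C h) - g z - c * dirderiv h g z) / cmod c \<le> 32 * M * (cmod c)\<^sup>2 / \<rho>\<^sup>2 / cmod c"
    by (intro divide_right_mono) (simp_all add: dirderiv_def cvec.scale_zero_left)
  also have "cmod (g (z + c *\<^sub>C h) - g z - c * dirderiv h g z) / cmod c
      = cmod ((g (z + c *\<^sub>C h) - g z) / c - dirderiv h g z)"
    using c by (simp add: norm_divide[symmetric] field_simps)
  also have "32 * M * (cmod c)\<^sup>2 / \<rho>\<^sup>2 / cmod c = 128 * M * cmod c * (norm h)\<^sup>2 / R\<^sup>2"
    using c False R by (simp add: \<rho>_def field_simps power2_eq_square)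
  finally show ?thesis .
qed

text \<open>Cauchy's inequality on the circle of radius R / (4 |h|) in the parameter, whose image
  stays within R/4 of z.\<close>

lemma dirderiv_bound:
  assumes z: "z \<in> ball p (R / 2)"
  shows "cmod (dirderiv h g z) \<le> 4 * M * norm h / R"
proof (cases "h = 0")
  case True
  then show ?thesis by (simp add: dirderiv_zero)
next
  case False
  define r where "r = R / (4 * norm h)"
  have r: "r > 0" using False R by (simp add: r_def)
  have in_ball: "z + t *\<^sub>C h \<in> ball p R" if "t \<in> cball 0 r" for t
    using that False R by (intro in_ball_shift[OF z, of _ "R / 4"]) (auto simp: norm_scaleC r_def field_simps)
  have hol: "(\<lambda>t. g (z + t *\<^sub>C h)) holomorphic_on cball 0 r"
    using in_ball by (intro holo_on_line_holomorphic[OF g])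
  have "cmod ((deriv ^^ 1) (\<lambda>t. g (z + t *\<^sub>C h)) 0) \<le> fact 1 * M / r ^ 1"
    using hol r in_ball
    by (intro Cauchy_inequality M) (auto intro: holomorphic_on_imp_continuous_on holomorphic_on_subset)
  then show ?thesis by (simp add: dirderiv_def r_def field_simps)
qed

text \<open>Difference quotients of g in direction h, taken at z + t v, are holomorphic in t and
  converge uniformly by \<open>holo_quotient_bound\<close>. By Weierstrass' theorem the limit is
  holomorphic and may be differentiated in t under the limit; the second claim is thus the symmetry
  of mixed derivatives, stated as a limit.\<close>

lemma dirderiv_line_holomorphic:
  assumes z: "z \<in> ball p (R / 4)" and v: "norm v < R / 4"
  shows "(\<lambda>t. dirderiv h g (z + t *\<^sub>C v)) holomorphic_on ball 0 1"
    and "((\<lambda>c. (dirderiv v g (z + c *\<^sub>C h) - dirderiv v g z) / c)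
            \<longlongrightarrow> deriv (\<lambda>t. dirderiv h g (z + t *\<^sub>C v)) 0) (at 0)"
proof -
  let ?q = "\<lambda>c t. (g (z + t *\<^sub>C v + c *\<^sub>C h) - g (z + t *\<^sub>C v)) / c"
  let ?\<psi> = "\<lambda>t. dirderiv h g (z + t *\<^sub>C v)"
  have mem: "z + t *\<^sub>C v \<in> ball p (R / 2)" if "t \<in> cball 0 1" for t
    using that v mult_left_le_one_le[of "norm v" "cmod t"]
    by (intro in_ball_shift[OF z, of _ "R / 4"]) (auto simp: norm_scaleC)
  have ev: "\<forall>\<^sub>F c in at (0::complex). c \<noteq> 0 \<and> cmod c * norm h < \<epsilon>" if "\<epsilon> > 0" for \<epsilon>
  proof (rule eventually_conj)
    have "((\<lambda>c::complex. cmod c * norm h) \<longlongrightarrow> cmod 0 * norm h) (at 0)" by (intro tendsto_intros)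
    then show "\<forall>\<^sub>F c in at (0::complex). cmod c * norm h < \<epsilon>"
      using that by (intro order_tendstoD(2)) auto
  qed (simp add: eventually_at_filter)
  have R4: "R / 4 > 0" using R by simp
  have unif: "uniform_limit (cball 0 1) ?q ?\<psi> (at 0)"
    unfolding uniform_limit_iff
  proof (intro allI impI)
    fix e :: real assume e: "e > 0"
    have "M \<ge> 0" using M[of p] R by (smt (verit) centre_in_ball norm_ge_zero)
    have "((\<lambda>c::complex. 128 * M * cmod c * (norm h)\<^sup>2 / R\<^sup>2) \<longlongrightarrow> 128 * M * cmod 0 * (norm h)\<^sup>2 / R\<^sup>2) (at 0)"
      using R by (intro tendsto_intros) auto
    then have "\<forall>\<^sub>F c in at (0::complex). 128 * M * cmod c * (norm h)\<^sup>2 / R\<^sup>2 < e"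
      using e by (intro order_tendstoD(2)) auto
    then show "\<forall>\<^sub>F c in at 0. \<forall>t\<in>cball 0 1. dist (?q c t) (?\<psi> t) < e"
      using ev[OF R4]
    proof eventually_elim
      case (elim c)
      then show ?case
        using holo_quotient_bound[OF mem, of _ c h] by (force simp: dist_norm)
    qed
  qed
  have hol: "\<forall>\<^sub>F c in at 0. ?q c holomorphic_on cball 0 1"
    using ev[OF R4]
  proof eventually_elim
    case (elim c)
    have "(z + c *\<^sub>C h) + t *\<^sub>C v \<in> ball p R" if "t \<in> cball 0 1" for t
      using in_ball_shift[OF mem[OF that], of "c *\<^sub>C h" "R / 2" R] elim R
      by (simp add: norm_scaleC algebra_simps)
    then have "(\<lambda>t. g ((z + c *\<^sub>C h) + t *\<^sub>C v)) holomorphic_on cball 0 1"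
      by (intro holo_on_line_holomorphic[OF g])
    moreover have "(\<lambda>t. g (z + t *\<^sub>C v)) holomorphic_on cball 0 1"
      using in_ball_shift[OF mem, of _ 0 "R / 2" R] R by (intro holo_on_line_holomorphic[OF g]) auto
    ultimately show ?case using elim by (intro holomorphic_intros) (auto simp: algebra_simps)
  qed
  show "?\<psi> holomorphic_on ball 0 1"
  proof (rule holomorphic_uniform_limit[OF _ unif])
    show "\<forall>\<^sub>F c in at 0. continuous_on (cball 0 1) (?q c) \<and> ?q c holomorphic_on ball 0 1"
      using hol by eventually_elim
        (auto intro: holomorphic_on_imp_continuous_on holomorphic_on_subset)
  qed auto
  have "((\<lambda>c. deriv (?q c) 0) \<longlongrightarrow> deriv ?\<psi> 0) (at 0)"
  proof (rule deriv_complex_uniform_limit)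
    show "uniform_limit (ball 0 1) ?q ?\<psi> (at 0)"
      using unif by (rule uniform_limit_on_subset) auto
    show "\<forall>\<^sub>F c in at 0. ?q c holomorphic_on ball 0 1"
      using hol by eventually_elim (auto intro: holomorphic_on_subset)
  qed auto
  moreover have "\<forall>\<^sub>F c in at 0. deriv (?q c) 0 = (dirderiv v g (z + c *\<^sub>C h) - dirderiv v g z) / c"
    using ev[OF R4]
  proof eventually_elim
    case (elim c)
    have z0: "z \<in> ball p (R / 2)" using z R by auto
    have "z + c *\<^sub>C h + 0 *\<^sub>C v \<in> ball p R" "z + 0 *\<^sub>C v \<in> ball p R"
      using in_ball_shift[OF z0, of "c *\<^sub>C h" "R / 2" R] z0 R elim
      by (auto simp: norm_scaleC cvec.scale_zero_left)
    from holo_on_line[OF g this(1)] holo_on_line[OF g this(2)]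
    have "((\<lambda>t. (g (z + c *\<^sub>C h + t *\<^sub>C v) - g (z + t *\<^sub>C v)) / c) has_field_derivative
       (dirderiv v g (z + c *\<^sub>C h) - dirderiv v g z) / c) (at 0)"
      by (intro DERIV_cdivide DERIV_diff) (auto simp: cvec.scale_zero_left)
    then show ?case by (intro DERIV_imp_deriv) (simp add: algebra_simps)
  qed
  ultimately show "((\<lambda>c. (dirderiv v g (z + c *\<^sub>C h) - dirderiv v g z) / c) \<longlongrightarrow> deriv ?\<psi> 0) (at 0)"
    by (rule Lim_transform_eventually)
qed

text \<open>The difference quotients of \<open>g\<close> in direction \<open>v\<close> converge to \<open>dirderiv v g\<close>, and by the second
  order bound their Frechet derivatives converge uniformly; so no finite-dimensionality is needed.\<close>

lemma dirderiv_differentiable: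
  assumes v: "norm v < R / 8"
  shows "\<exists>L. (dirderiv v g has_derivative L) (at p) \<and> (\<forall>c h. L (c *\<^sub>C h) = c * L h)"
proof -
  let ?S = "ball p (R / 8)"
  \<comment> \<open>Starting at 1/2 keeps every c n in the half disc that
    \<open>holomorphic_second_order_bound\<close> with \<rho> = 1 requires.\<close>
  define c :: "nat \<Rightarrow> complex" where "c n = 1 / of_nat (n + 2)" for n
  have c: "c n \<noteq> 0" "cmod (c n) \<le> 1 / 2" for n
    by (auto simp: c_def norm_divide field_simps simp del: of_nat_add of_nat_Suc)
  have c0: "c \<longlonglongrightarrow> 0"
    unfolding c_def using LIMSEQ_ignore_initial_segment[OF lim_inverse_n, of 2]
    by (simp add: inverse_eq_divide)
  let ?f = "\<lambda>n y. (g (y + c n *\<^sub>C v) - g y) / c n"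
  let ?f' = "\<lambda>n y h. (dirderiv h g (y + c n *\<^sub>C v) - dirderiv h g y) / c n"
  let ?g' = "\<lambda>y h. deriv (\<lambda>t. dirderiv h g (y + t *\<^sub>C v)) 0"
  have M0: "M \<ge> 0" using M[of p] R by (smt (verit) centre_in_ball norm_ge_zero)
  have small: "cmod t * norm v \<le> R / 8" if "cmod t \<le> 1" for t
    using that v mult_left_le_one_le[of "norm v" "cmod t"] by auto
  have mem: "y + t *\<^sub>C v \<in> ball p (R / 4)" if "y \<in> ?S" "cmod t \<le> 1" for y t
    using small[OF that(2)] by (intro in_ball_shift[OF that(1), of _ "R / 8"]) (auto simp: norm_scaleC)
  have c1: "cmod (c n) \<le> 1" for n using c(2)[of n] by auto
  have lim: "(\<lambda>n. ?f n y) \<longlonglongrightarrow> dirderiv v g y" if y: "y \<in> ?S" for y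
  proof -
    have "y + 0 *\<^sub>C v \<in> ball p R" using y R by (auto simp: cvec.scale_zero_left)
    from holo_on_line[OF g this] have "((\<lambda>t. (g (y + t *\<^sub>C v) - g y) / t) \<longlongrightarrow> dirderiv v g y) (at 0)"
      by (simp add: DERIV_def cvec.scale_zero_left)
    moreover have "filterlim c (at 0) sequentially"
      using c0 c(1) by (auto simp: filterlim_at)
    ultimately show ?thesis by (rule filterlim_compose)
  qed
  have "\<exists>G. \<forall>y\<in>?S. (\<lambda>n. ?f n y) \<longlonglongrightarrow> G y \<and> (G has_derivative ?g' y) (at y within ?S)"
  proof (rule has_derivative_sequence)
    show "(?f n has_derivative ?f' n y) (at y within ?S)" if y: "y \<in> ?S" for n y
    proof (rule has_derivative_at_withinI)
      have "y \<in> ball p R" "y + c n *\<^sub>C v \<in> ball p R"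
        using mem[OF y c1[of n]] y R by auto
      note d = holo_onE(1)[OF g this(1)] holo_onE(1)[OF g this(2)]
      have "((\<lambda>y. y + c n *\<^sub>C v) has_derivative (\<lambda>h. h)) (at y)"
        by (auto intro!: derivative_eq_intros)
      from has_derivative_compose[OF this d(2)]
      show "(?f n has_derivative ?f' n y) (at y)"
        using bounded_linear.has_derivative[OF bounded_linear_divide[of "c n"] has_derivative_diff[OF _ d(1)]]
        by simp
    qed
    show "\<forall>\<^sub>F n in sequentially. \<forall>y\<in>?S. \<forall>h. cmod (?f' n y h - ?g' y h) \<le> e * norm h" if "e > 0" for e
    proof -
      have "(\<lambda>n. 128 * M / R * cmod (c n)) \<longlonglongrightarrow> 128 * M / R * cmod 0"
        by (intro tendsto_intros c0)
      then have "\<forall>\<^sub>F n in sequentially. 128 * M / R * cmod (c n) < e"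
        using that by (intro order_tendstoD(2)) auto
      then show ?thesis
      proof eventually_elim
        case (elim n)
        show ?case
        proof (intro ballI allI)
          fix y h assume y: "y \<in> ?S"
          let ?\<psi> = "\<lambda>t. dirderiv h g (y + t *\<^sub>C v)"
          \<comment> \<open>The bound from \<open>dirderiv_bound\<close> is proportional to |h|,
            hence so is the error, as uniform convergence of the linear maps demands; again 128 = 32
            * 4.\<close>
          have "cmod (?\<psi> (c n) - ?\<psi> 0 - c n * deriv ?\<psi> 0) \<le> 32 * (4 * M * norm h / R) * (cmod (c n))\<^sup>2 / 1\<^sup>2"
          proof (rule holomorphic_second_order_bound)
            show "?\<psi> holomorphic_on ball 0 1"
              using y v R by (intro dirderiv_line_holomorphic) auto
            show "cmod (?\<psi> t) \<le> 4 * M * norm h / R" if "t \<in> ball 0 1" for t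
              using mem[OF y, of t] that R by (intro dirderiv_bound) auto
          qed (use c(2)[of n] in auto)
          then have "cmod (?\<psi> (c n) - ?\<psi> 0 - c n * deriv ?\<psi> 0) / cmod (c n)
              \<le> 32 * (4 * M * norm h / R) * (cmod (c n))\<^sup>2 / cmod (c n)"
            by (intro divide_right_mono) auto
          also have "cmod (?\<psi> (c n) - ?\<psi> 0 - c n * deriv ?\<psi> 0) / cmod (c n) = cmod (?f' n y h - ?g' y h)"
            using c(1)[of n] by (simp add: norm_divide[symmetric] field_simps cvec.scale_zero_left)
          also have "32 * (4 * M * norm h / R) * (cmod (c n))\<^sup>2 / cmod (c n) = (128 * M / R * cmod (c n)) * norm h"
            using c(1)[of n] by (simp add: power2_eq_square)
          also have "\<dots> \<le> e * norm h" using elim by (intro mult_right_mono) auto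
          finally show "cmod (?f' n y h - ?g' y h) \<le> e * norm h" .
        qed
      qed
    qed
    show "p \<in> ?S" using R by auto
    show "(\<lambda>n. ?f n p) \<longlonglongrightarrow> dirderiv v g p" using R by (intro lim) auto
  qed auto
  then obtain G where G: "\<And>y. y \<in> ?S \<Longrightarrow> (\<lambda>n. ?f n y) \<longlonglongrightarrow> G y"
    "\<And>y. y \<in> ?S \<Longrightarrow> (G has_derivative ?g' y) (at y within ?S)" by blast
  have eq: "dirderiv v g y = G y" if "y \<in> ?S" for y
    using LIMSEQ_unique[OF lim[OF that] G(1)[OF that]] .
  have pS: "p \<in> ?S" using R by auto
  have "(dirderiv v g has_derivative ?g' p) (at p within ?S)"
    by (rule has_derivative_transform[OF pS eq G(2)[OF pS]])
  then have "(dirderiv v g has_derivative ?g' p) (at p)"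
    using at_within_open[OF pS open_ball] by simp
  moreover have "?g' p (a *\<^sub>C h) = a * ?g' p h" for a h
  proof -
    have "?g' p (a *\<^sub>C h) = deriv (\<lambda>t. a * dirderiv h g (p + t *\<^sub>C v)) 0"
    proof (rule deriv_cong_ev)
      have "\<forall>\<^sub>F t in nhds (0::complex). t \<in> ball 0 1" by (intro eventually_nhds_in_open) auto
      then show "\<forall>\<^sub>F t in nhds 0. dirderiv (a *\<^sub>C h) g (p + t *\<^sub>C v) = a * dirderiv h g (p + t *\<^sub>C v)"
      proof eventually_elim
        case (elim t)
        then show ?case using mem[OF pS, of t] R by (intro holo_onE(2)[OF g]) auto
      qed
    qed simp
    also have "\<dots> = a * ?g' p h"
    proof (rule deriv_cmult)
      have "(\<lambda>t. dirderiv h g (p + t *\<^sub>C v)) holomorphic_on ball 0 1"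
        using v R by (intro dirderiv_line_holomorphic) auto
      then show "(\<lambda>t. dirderiv h g (p + t *\<^sub>C v)) field_differentiable at 0"
        by (rule holomorphic_on_imp_differentiable_at) auto
    qed
    finally show ?thesis .
  qed
  ultimately show ?thesis by blast
qed

end

section \<open>Directional derivatives on open sets: holomorphy and symmetry\<close>

lemma holo_on_bounded_ball:
  assumes "open V" "holo_on V g" "p \<in> V"
  obtains R M where "R > 0" "ball p R \<subseteq> V" "holo_on (ball p R) g" "\<And>y. y \<in> ball p R \<Longrightarrow> cmod (g y) \<le> M"
proof -
  have "continuous (at p) g"
    using assms(2,3) unfolding holo_on_def by (meson has_derivative_continuous)
  then obtain \<delta> where \<delta>: "\<delta> > 0" "\<And>y. dist y p < \<delta> \<Longrightarrow> dist (g y) (g p) < 1"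
    unfolding continuous_at_eps_delta by (metis zero_less_one)
  obtain r where r: "r > 0" "ball p r \<subseteq> V" using assms(1,3) open_contains_ball by blast
  show ?thesis
  proof (rule that[of "min r \<delta>" "cmod (g p) + 1"])
    show "cmod (g y) \<le> cmod (g p) + 1" if "y \<in> ball p (min r \<delta>)" for y
      using \<delta>(2)[of y] that norm_triangle_sub[of "g y" "g p"] by (auto simp: dist_norm norm_minus_commute)
    show "holo_on (ball p (min r \<delta>)) g" using r(2) by (intro holo_on_subset[OF assms(2)]) auto
  qed (use r \<delta> in auto)
qed

text \<open>The results on balls need a short direction; by homogeneity a nonzero multiple of the
  given one serves as well.\<close>

lemma small_multiple:
  fixes v :: "'v::complex_normed_vector"
  assumes "\<epsilon> > 0" obtains s :: complex where "s \<noteq> 0" "norm (s *\<^sub>C v) < \<epsilon>"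
proof -
  have "norm v + 1 > 0" by (simp add: add_nonneg_pos)
  then have "cmod (of_real (\<epsilon> / (norm v + 1))) * norm v < \<epsilon>"
    using assms unfolding norm_of_real by (simp add: field_simps)
  then show ?thesis
    using assms \<open>norm v + 1 > 0\<close>
    by (intro that[of "of_real (\<epsilon> / (norm v + 1))"]) (simp_all only: norm_scaleC of_real_eq_0_iff divide_eq_0_iff, auto)
qed

lemma holo_on_dirderiv:
  assumes V: "open V" "holo_on V g" shows "holo_on V (dirderiv v g)"
proof -
  have "\<exists>L. (dirderiv v g has_derivative L) (at p) \<and> (\<forall>c h. L (c *\<^sub>C h) = c * L h)" if p: "p \<in> V" for p
  proof -
    from holo_on_bounded_ball[OF V p] obtain R M where R: "R > 0" "ball p R \<subseteq> V" "holo_on (ball p R) g"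
      "\<And>y. y \<in> ball p R \<Longrightarrow> cmod (g y) \<le> M" by blast
    obtain s where s: "s \<noteq> 0" "norm (s *\<^sub>C v) < R / 8"
      using small_multiple[of "R / 8"] R(1) by auto
    obtain L where L: "(dirderiv (s *\<^sub>C v) g has_derivative L) (at p)" "\<forall>c h. L (c *\<^sub>C h) = c * L h"
      using dirderiv_differentiable[OF R(3,4,1) s(2)] by blast
    have "((\<lambda>y. dirderiv (s *\<^sub>C v) g y * inverse s) has_derivative (\<lambda>h. L h * inverse s)) (at p)"
      by (rule has_derivative_mult_left[OF L(1)])
    then have "(dirderiv v g has_derivative (\<lambda>h. L h * inverse s)) (at p)"
      by (rule has_derivative_transform_within_open[OF _ open_ball[of p R]])
         (use R s in \<open>auto simp: holo_onE(2)[OF R(3)]\<close>)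
    then show ?thesis using L(2) by (intro exI[of _ "\<lambda>h. L h * inverse s"]) auto
  qed
  then show ?thesis by (simp add: holo_on_def)
qed

text \<open>Both iterated derivatives are limits of the same difference quotient of the v-derivative
  in direction h, one by the exchange of limits and the other by definition. The direction v is
  shortened first, and the factor s is cancelled at the end.\<close>

lemma dirderiv_commute:
  assumes V: "open V" "holo_on V g" "p \<in> V"
  shows "dirderiv v (dirderiv h g) p = dirderiv h (dirderiv v g) p"
proof -
  from holo_on_bounded_ball[OF V] obtain R M where R: "R > 0" "ball p R \<subseteq> V" "holo_on (ball p R) g"
    "\<And>y. y \<in> ball p R \<Longrightarrow> cmod (g y) \<le> M" by blast
  obtain s where s: "s \<noteq> 0" "norm (s *\<^sub>C v) < R / 4"
    using small_multiple[of "R / 4"] R(1) by auto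
  let ?v = "s *\<^sub>C v"
  have "((\<lambda>c. (dirderiv ?v g (p + c *\<^sub>C h) - dirderiv ?v g p) / c) \<longlongrightarrow> dirderiv ?v (dirderiv h g) p) (at 0)"
    unfolding dirderiv_def[of ?v "dirderiv h g"]
    using dirderiv_line_holomorphic(2)[OF R(3,4,1) _ s(2), of p h] R(1) by simp
  moreover have "((\<lambda>c. (dirderiv ?v g (p + c *\<^sub>C h) - dirderiv ?v g p) / c) \<longlongrightarrow> dirderiv h (dirderiv ?v g) p) (at 0)"
    using holo_on_line[OF holo_on_dirderiv[OF V(1,2), of ?v], of p 0 h] V(3)
    by (simp add: DERIV_def cvec.scale_zero_left)
  ultimately have eq: "dirderiv ?v (dirderiv h g) p = dirderiv h (dirderiv ?v g) p"
    by (intro tendsto_unique[of "at (0::complex)"]) auto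
  have "dirderiv h (dirderiv ?v g) p = dirderiv h (\<lambda>y. s * dirderiv v g y) p"
    by (rule dirderiv_cong[OF V(1,3)]) (simp add: holo_onE(2)[OF V(2)])
  also have "\<dots> = s * dirderiv h (dirderiv v g) p"
  proof -
    have "((\<lambda>t. dirderiv v g (p + t *\<^sub>C h)) has_field_derivative dirderiv h (dirderiv v g) (p + 0 *\<^sub>C h)) (at 0)"
      using V by (intro holo_on_line holo_on_dirderiv) (auto simp: cvec.scale_zero_left)
    from DERIV_cmult[OF this, of s] show ?thesis
      unfolding dirderiv_def[of h "\<lambda>y. s * dirderiv v g y"]
      by (simp add: DERIV_imp_deriv cvec.scale_zero_left)
  qed
  finally show ?thesis
    using eq s(1) holo_onE(2)[OF holo_on_dirderiv[OF V(1,2)] V(3), of s v h] by simp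
qed


section \<open>The derivations \<open>\<partial>\<^sub>v\<close> of the meromorphic functions\<close>

lemma dirderiv_mult:
  assumes "holo_on V f" "holo_on V g" "q \<in> V"
  shows "dirderiv v (\<lambda>q. f q * g q) q = dirderiv v f q * g q + f q * dirderiv v g q"
proof -
  have "q + 0 *\<^sub>C v \<in> V" using assms(3) by (simp add: cvec.scale_zero_left)
  from DERIV_mult[OF holo_on_line[OF assms(1) this] holo_on_line[OF assms(2) this]]
  show ?thesis unfolding dirderiv_def[of v "\<lambda>q. f q * g q"]
    by (intro DERIV_imp_deriv) (simp add: cvec.scale_zero_left algebra_simps)
qed

lemma dirderiv_add:
  assumes "holo_on V f" "holo_on V g" "q \<in> V"
  shows "dirderiv v (\<lambda>q. f q + g q) q = dirderiv v f q + dirderiv v g q"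
proof -
  have "q + 0 *\<^sub>C v \<in> V" using assms(3) by (simp add: cvec.scale_zero_left)
  from DERIV_add[OF holo_on_line[OF assms(1) this] holo_on_line[OF assms(2) this]]
  show ?thesis unfolding dirderiv_def[of v "\<lambda>q. f q + g q"]
    by (intro DERIV_imp_deriv) (simp add: cvec.scale_zero_left)
qed

lemma dirderiv_const: "dirderiv v (\<lambda>_. c) q = 0"
  by (simp add: dirderiv_def)

lemma dirderiv_divide:
  assumes "holo_on V f" "holo_on V h" "q \<in> V" "h q \<noteq> 0"
  shows "dirderiv v (\<lambda>q. f q / h q) q = (dirderiv v f q * h q - f q * dirderiv v h q) / (h q * h q)"
proof -
  have "q + 0 *\<^sub>C v \<in> V" using assms(3) by (simp add: cvec.scale_zero_left)
  from DERIV_divide[OF holo_on_line[OF assms(1) this] holo_on_line[OF assms(2) this]] assms(4)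
  show ?thesis unfolding dirderiv_def[of v "\<lambda>q. f q / h q"]
    by (intro DERIV_imp_deriv) (simp add: cvec.scale_zero_left)
qed

lemma holo_on_divide:
  assumes "holo_on V f" "holo_on V h" "\<And>q. q \<in> V \<Longrightarrow> h q \<noteq> 0"
  shows "holo_on V (\<lambda>q. f q / h q)"
  unfolding holo_on_def
proof
  fix q assume q: "q \<in> V"
  from has_derivative_divide[OF holo_onE(1)[OF assms(1) q] holo_onE(1)[OF assms(2) q] assms(3)[OF q]]
  show "\<exists>L. ((\<lambda>q. f q / h q) has_derivative L) (at q) \<and> (\<forall>c h. L (c *\<^sub>C h) = c * L h)"
    by (intro exI conjI, assumption)
       (simp add: holo_onE(2)[OF assms(1) q] holo_onE(2)[OF assms(2) q] algebra_simps)
qed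

lemma holo_on_cong:
  assumes "open V" "holo_on V f" "\<And>q. q \<in> V \<Longrightarrow> f q = g q"
  shows "holo_on V g"
  unfolding holo_on_def
proof
  fix q assume q: "q \<in> V"
  have "(g has_derivative (\<lambda>h. dirderiv h f q)) (at q)"
    by (rule has_derivative_transform_within_open[OF holo_onE(1)[OF assms(2) q] assms(1) q assms(3)])
  then show "\<exists>L. (g has_derivative L) (at q) \<and> (\<forall>c h. L (c *\<^sub>C h) = c * L h)"
    using holo_onE(2)[OF assms(2) q] by blast
qed

section \<open>Regular points of meromorphic representatives\<close>

lemma nonzero_nhd:
  assumes "open V" "holo_on V h" "q \<in> V" "h q \<noteq> 0"
  obtains W where "open W" "q \<in> W" "W \<subseteq> V" "\<And>y. y \<in> W \<Longrightarrow> h y \<noteq> 0"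
proof (rule that)
  show "open (V \<inter> h -` (- {0}))"
    by (rule continuous_open_preimage[OF holo_on_continuous[OF assms(2)] assms(1)]) auto
qed (use assms in auto)

text \<open>Off the zeros of a local denominator, f is a quotient of holomorphic functions. A
  nonempty open set missed by all open sets of holomorphy would contain a point where the local
  denominator is nonzero, a contradiction.\<close>

lemma mero_fun_regular:
  assumes "mero_fun f"
  obtains W where "open W" "closure W = UNIV" "holo_on W f"
proof -
  let ?W = "\<Union>{V. open V \<and> holo_on V f}"
  have "holo_on ?W f" unfolding holo_on_def by blast
  moreover have "closure ?W = UNIV"
  proof (rule ccontr)
    assume "closure ?W \<noteq> UNIV"
    then obtain p where p: "p \<in> - closure ?W" by auto
    obtain V g h where V: "open V" "p \<in> V" "holo_on V g" "holo_on V h"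
      "\<forall>W. open W \<and> W \<subseteq> V \<and> W \<noteq> {} \<longrightarrow> (\<exists>q\<in>W. h q \<noteq> 0)" "\<forall>q\<in>V. h q \<noteq> 0 \<longrightarrow> f q = g q / h q"
      using assms[unfolded mero_fun_def, THEN spec, of p] by (elim exE conjE) (rule that, assumption+)
    obtain q where q: "q \<in> V" "q \<in> - closure ?W" "h q \<noteq> 0"
      using V(5)[rule_format, of "V \<inter> - closure ?W"] V(1,2) p by auto
    obtain X where X: "open X" "q \<in> X" "X \<subseteq> V" "\<And>y. y \<in> X \<Longrightarrow> h y \<noteq> 0"
      using nonzero_nhd[OF V(1,4) q(1,3)] by blast
    have "holo_on X (\<lambda>q. g q / h q)"
      by (intro holo_on_divide X(4) holo_on_subset[OF V(3) X(3)] holo_on_subset[OF V(4) X(3)])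
    then have "holo_on X f"
      by (rule holo_on_cong[OF X(1)]) (use X(3,4) V(6) in auto)
    then have "X \<subseteq> ?W" using X(1) by blast
    then show False using q(2) X(2) closure_subset by blast
  qed
  ultimately show ?thesis by (intro that[of ?W]) auto
qed

text \<open>The quotient rule with denominator h^2. Where h \<noteq> 0 the formula f = g/h holds on
  a whole neighbourhood and may be differentiated; the arbitrary values of f at zeros of h do no
  harm.\<close>

lemma mero_fun_dirderiv:
  assumes "mero_fun f" shows "mero_fun (dirderiv v f)"
  unfolding mero_fun_def
proof
  fix p
  obtain V g h where V: "open V" "p \<in> V" "holo_on V g" "holo_on V h"
    "\<forall>W. open W \<and> W \<subseteq> V \<and> W \<noteq> {} \<longrightarrow> (\<exists>q\<in>W. h q \<noteq> 0)" "\<forall>q\<in>V. h q \<noteq> 0 \<longrightarrow> f q = g q / h q"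
    using assms[unfolded mero_fun_def, THEN spec, of p] by (elim exE conjE) (rule that, assumption+)
  let ?g = "\<lambda>q. dirderiv v g q * h q + (- 1) * (g q * dirderiv v h q)" and ?h = "\<lambda>q. h q * h q"
  have "dirderiv v f q = ?g q / ?h q" if q: "q \<in> V" "h q \<noteq> 0" for q
  proof -
    obtain X where X: "open X" "q \<in> X" "X \<subseteq> V" "\<And>y. y \<in> X \<Longrightarrow> h y \<noteq> 0"
      using nonzero_nhd[OF V(1,4) q] by blast
    have "dirderiv v f q = dirderiv v (\<lambda>q. g q / h q) q"
      by (rule dirderiv_cong[OF X(1,2)]) (use X(3,4) V(6) in auto)
    then show ?thesis using dirderiv_divide[OF V(3,4) q] by simp
  qed
  moreover have "holo_on V ?g" "holo_on V ?h"
    by (intro holo_on_add holo_on_mult holo_on_const holo_on_dirderiv V)+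
  moreover have "\<forall>W. open W \<and> W \<subseteq> V \<and> W \<noteq> {} \<longrightarrow> (\<exists>q\<in>W. ?h q \<noteq> 0)"
    using V(5) by auto
  ultimately show "\<exists>V g h. open V \<and> p \<in> V \<and> holo_on V g \<and> holo_on V h \<and>
        (\<forall>W. open W \<and> W \<subseteq> V \<and> W \<noteq> {} \<longrightarrow> (\<exists>q\<in>W. h q \<noteq> 0)) \<and>
        (\<forall>q\<in>V. h q \<noteq> 0 \<longrightarrow> dirderiv v f q = g q / h q)"
    using V(1,2) by (intro exI[of _ V] exI[of _ ?g] exI[of _ ?h]) auto
qed

text \<open>Identities between classes need checking only where both representatives are
  holomorphic: the two dense open sets of such points meet in a dense open set.\<close>

lemma agree_denseI_holo:
  assumes "mero_fun f" "mero_fun g"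
    and "\<And>W q. open W \<Longrightarrow> holo_on W f \<Longrightarrow> holo_on W g \<Longrightarrow> q \<in> W \<Longrightarrow> F q = G q"
  shows "agree_dense F G"
proof -
  obtain A where A: "open A" "closure A = UNIV" "holo_on A f" using mero_fun_regular[OF assms(1)] .
  obtain B where B: "open B" "closure B = UNIV" "holo_on B g" using mero_fun_regular[OF assms(2)] .
  have "closure (A \<inter> B) = UNIV"
    using open_Int_closure_subset[OF A(1), of B] A(2) B(2) closure_minimal[of A "closure (A \<inter> B)"]
    by auto
  moreover have "F q = G q" if "q \<in> A \<inter> B" for q
    by (rule assms(3)[OF _ _ _ that])
       (use A B in \<open>auto intro: holo_on_subset\<close>)
  ultimately show ?thesis
    unfolding agree_dense_def using A(1) B(1) by (intro exI[of _ "A \<inter> B"]) auto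
qed

lemma agree_dense_dirderiv:
  assumes "agree_dense f g" shows "agree_dense (dirderiv v f) (dirderiv v g)"
proof -
  obtain W where W: "open W" "closure W = UNIV" "\<forall>q\<in>W. f q = g q"
    using assms unfolding agree_dense_def by blast
  have "\<forall>q\<in>W. dirderiv v f q = dirderiv v g q"
    by (intro ballI dirderiv_cong[OF W(1)]) (simp_all add: W(3))
  with W(1,2) show ?thesis unfolding agree_dense_def by blast
qed

section \<open>Passage to classes of meromorphic functions\<close>

lemma mero_cases:
  obtains f where "mero_fun f" "a = abs_mero f"
  using Quotient3_abs_rep[OF Quotient3_mero, of a] Quotient3_rep_reflp[OF Quotient3_mero, of a]
  unfolding mero_eq_def by metis

lemma abs_mero_eqI: "mero_fun f \<Longrightarrow> mero_fun g \<Longrightarrow> agree_dense f g \<Longrightarrow> abs_mero f = abs_mero g"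
  by (rule Quotient3_rel_abs[OF Quotient3_mero]) (simp add: mero_eq_def)

lemma abs_mero_ops:
  assumes "mero_fun f" "mero_fun g"
  shows "abs_mero f + abs_mero g = abs_mero (\<lambda>q. f q + g q)"
    and "abs_mero f * abs_mero g = abs_mero (\<lambda>q. f q * g q)"
    and "c *\<^sub>C abs_mero f = abs_mero (\<lambda>q. c * f q)"
  using assms by (simp_all add: plus_mero.abs_eq times_mero.abs_eq scaleC_mero.abs_eq mero_eq_def agree_dense_refl)

text \<open>\<open>mero_deriv\<close> differentiates the representative chosen by
  \<open>rep_mero\<close>. That one agrees with f on a dense open set, and agreement on an open set
  passes to derivatives.\<close>

lemma mero_deriv_abs:
  assumes "mero_fun f" shows "mero_deriv v (abs_mero f) = abs_mero (dirderiv v f)"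
proof -
  have "mero_eq (rep_mero (abs_mero f)) f"
    by (rule rep_abs_rsp_left[OF Quotient3_mero]) (simp add: mero_eq_def assms agree_dense_refl)
  then show ?thesis
    unfolding mero_deriv_def mero_eq_def dirderiv_def[symmetric]
    by (intro abs_mero_eqI mero_fun_dirderiv agree_dense_dirderiv) auto
qed

lemma mero_deriv_add: "mero_deriv v (a + b) = mero_deriv v a + mero_deriv v b"
proof (cases a rule: mero_cases, cases b rule: mero_cases)
  fix f g assume m: "mero_fun f" "mero_fun g" and ab: "a = abs_mero f" "b = abs_mero g"
  note closure = m mero_fun_add mero_fun_mult mero_fun_dirderiv
  have "agree_dense (dirderiv v (\<lambda>q. f q + g q)) (\<lambda>q. dirderiv v f q + dirderiv v g q)"
    by (rule agree_denseI_holo[OF m]) (rule dirderiv_add)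
  then have "abs_mero (dirderiv v (\<lambda>q. f q + g q)) = abs_mero (\<lambda>q. dirderiv v f q + dirderiv v g q)"
    by (rule abs_mero_eqI[rotated 2]) (simp_all add: closure)
  then show ?thesis by (simp add: ab abs_mero_ops mero_deriv_abs closure)
qed

lemma mero_deriv_mult: "mero_deriv v (a * b) = mero_deriv v a * b + a * mero_deriv v b"
proof (cases a rule: mero_cases, cases b rule: mero_cases)
  fix f g assume m: "mero_fun f" "mero_fun g" and ab: "a = abs_mero f" "b = abs_mero g"
  note closure = m mero_fun_add mero_fun_mult mero_fun_dirderiv
  have "agree_dense (dirderiv v (\<lambda>q. f q * g q)) (\<lambda>q. dirderiv v f q * g q + f q * dirderiv v g q)"
    by (rule agree_denseI_holo[OF m]) (rule dirderiv_mult)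
  then have "abs_mero (dirderiv v (\<lambda>q. f q * g q)) = abs_mero (\<lambda>q. dirderiv v f q * g q + f q * dirderiv v g q)"
    by (rule abs_mero_eqI[rotated 2]) (simp_all add: closure)
  then show ?thesis by (simp add: ab abs_mero_ops mero_deriv_abs closure)
qed

lemma mero_deriv_scale: "mero_deriv v (c *\<^sub>C a) = c *\<^sub>C mero_deriv v a"
proof (cases a rule: mero_cases)
  fix f assume m: "mero_fun f" "a = abs_mero f"
  have "agree_dense (dirderiv v (\<lambda>q. c * f q)) (\<lambda>q. c * dirderiv v f q)"
    by (rule agree_denseI_holo[OF mero_fun_const[of c] m(1)]) (simp add: dirderiv_mult dirderiv_const)
  with m show ?thesis
    by (simp add: abs_mero_ops(3)[OF _ mero_fun_const] mero_deriv_abs mero_fun_cmult mero_fun_dirderiv)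
       (intro abs_mero_eqI mero_fun_dirderiv mero_fun_cmult)
qed

lemma mero_deriv_commute: "mero_deriv v (mero_deriv w a) = mero_deriv w (mero_deriv v a)"
proof (cases a rule: mero_cases)
  fix f assume m: "mero_fun f" "a = abs_mero f"
  then show ?thesis
    by (simp add: mero_deriv_abs mero_fun_dirderiv)
       (intro abs_mero_eqI agree_denseI_holo[OF m(1) m(1)] mero_fun_dirderiv dirderiv_commute)
qed

lemma mero_deriv_one: "mero_deriv v 1 = 0"
  using mero_deriv_mult[of v 1 1] by simp

section \<open>Coordinates on the dual space\<close>

text \<open>Tychonoff's theorem, for the product topology on coefficient families.\<close>

lemma compact_PiE_UNIV:
  fixes S :: "nat \<Rightarrow> complex set"
  assumes "\<And>i. compact (S i)"
  shows "compact (PiE UNIV S)"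
  using compactin_PiE[of "\<lambda>_. euclidean" UNIV S] assms
  by (simp add: euclidean_product_topology)

text \<open>Compactness argument: among the coefficient families with k-th entry 1 and all entries
  in the closed unit disc, the norm of the combination attains its minimum, which is positive
  because the k-th coordinate of the combination is 1. Families are indexed by all natural numbers
  so that the product topology applies; entries outside 1..d do not enter the combination.\<close>

lemma coordinates_bounded:
  fixes \<mu> :: "nat \<Rightarrow> 'v::complex_normed_vector" and a :: "nat \<Rightarrow> 'v \<Rightarrow> complex"
  assumes rep: "\<And>v. v = (\<Sum>k=1..d. a k v *\<^sub>C \<mu> k)"
    and lin: "\<And>k v w. a k (v + w) = a k v + a k w" "\<And>k c v. a k (c *\<^sub>C v) = c * a k v"
    and dual: "\<And>k l. k \<in> {1..d} \<Longrightarrow> l \<in> {1..d} \<Longrightarrow> a k (\<mu> l) = (if k = l then 1 else 0)"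
  obtains C where "\<And>k v. k \<in> {1..d} \<Longrightarrow> cmod (a k v) \<le> norm v * C"
proof -
  have zero: "a k 0 = 0" for k using lin(2)[of k 0 0] by simp
  have a_sum: "a k (\<Sum>l\<in>S. b l *\<^sub>C \<mu> l) = (\<Sum>l\<in>S. b l * a k (\<mu> l))" if "finite S" for k b S
    using that by (induction S) (simp_all add: lin zero)
  let ?N = "\<lambda>b. norm (\<Sum>l=1..d. b l *\<^sub>C \<mu> l)"
  let ?T = "\<lambda>k. PiE UNIV (\<lambda>i. if i = k then {1} else cball 0 1) :: (nat \<Rightarrow> complex) set"
  have "\<exists>\<epsilon>>0. \<forall>b\<in>?T k. \<epsilon> \<le> ?N b" if k: "k \<in> {1..d}" for k
  proof -
    have "compact (?T k)" by (rule compact_PiE_UNIV) auto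
    moreover have "(\<lambda>_. 1) \<in> ?T k" by auto
    moreover have "continuous_on (?T k) (\<lambda>b. b l *\<^sub>C \<mu> l)" for l
    proof -
      have "continuous_on UNIV (\<lambda>b::nat \<Rightarrow> complex. 0 + b l *\<^sub>C \<mu> l)"
        by (rule continuous_on_compose2[OF continuous_on_line[of UNIV] continuous_on_product_coordinates]) auto
      then show ?thesis by (auto intro: continuous_on_subset)
    qed
    then have "continuous_on (?T k) ?N" by (intro continuous_intros)
    ultimately obtain b where b: "b \<in> ?T k" "\<forall>b'\<in>?T k. ?N b \<le> ?N b'"
      using continuous_attains_inf[of "?T k" ?N] by blast
    have "a k (\<Sum>l=1..d. b l *\<^sub>C \<mu> l) = 1"
    proof -
      have "b k = 1" using b(1) by (simp add: PiE_iff) (metis singletonD)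
      moreover have "(\<Sum>l=1..d. b l * a k (\<mu> l)) = (\<Sum>l=1..d. if l = k then b l else 0)"
        using dual k by (intro sum.cong) auto
      ultimately show ?thesis using k by (simp add: a_sum)
    qed
    then have "?N b > 0" using zero by auto
    then show ?thesis using b(2) by blast
  qed
  then obtain \<epsilon> where \<epsilon>: "\<And>k. k \<in> {1..d} \<Longrightarrow> \<epsilon> k > 0"
    "\<And>k b. k \<in> {1..d} \<Longrightarrow> b \<in> ?T k \<Longrightarrow> \<epsilon> k \<le> ?N b" by metis
  define C where "C = (\<Sum>k=1..d. 1 / \<epsilon> k)"
  have C: "1 / \<epsilon> k \<le> C" if "k \<in> {1..d}" for k
    unfolding C_def using that \<epsilon>(1) by (intro member_le_sum) (auto intro: less_imp_le)
  show ?thesis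
  proof (rule that[of C])
    fix k v assume k: "k \<in> {1..d}"
    define m where "m = Max ((\<lambda>k. cmod (a k v)) ` {1..d})"
    have "m \<in> (\<lambda>k. cmod (a k v)) ` {1..d}" unfolding m_def using k by (intro Max_in) auto
    then obtain j where j: "j \<in> {1..d}" "cmod (a j v) = m" by auto
    have le: "cmod (a i v) \<le> m" if "i \<in> {1..d}" for i unfolding m_def using that by (intro Max_ge) auto
    have "m \<le> norm v * C"
    proof (cases "m = 0")
      case True
      have "C \<ge> 0" using order_trans[OF _ C[OF k]] \<epsilon>(1)[OF k] by simp
      then show ?thesis using True by simp
    next
      case False
      then have nz: "a j v \<noteq> 0" "m > 0" using j(2) by auto
      \<comment> \<open>Dividing by the largest coordinate gives a family in \<open>?T j\<close>, to
        which the lower bound \<epsilon> j applies; entries outside 1..d are set to 0 to stay in the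
        disc.\<close>
      let ?b = "\<lambda>i. if i \<in> {1..d} then a i v / a j v else 0"
      have "?b \<in> ?T j" using nz j le by (auto simp: norm_divide)
      then have "\<epsilon> j \<le> ?N ?b" using \<epsilon>(2)[OF j(1)] by blast
      also have "(\<Sum>l=1..d. ?b l *\<^sub>C \<mu> l) = (1 / a j v) *\<^sub>C (\<Sum>l=1..d. a l v *\<^sub>C \<mu> l)"
        by (simp add: cvec.scale_sum_right scaleC_scaleC)
      also have "\<dots> = (1 / a j v) *\<^sub>C v" using rep[of v] by simp
      also have "norm \<dots> = norm v / m" using j(2) by (simp add: norm_scaleC norm_divide)
      finally have "m \<le> norm v * (1 / \<epsilon> j)"
        using nz \<epsilon>(1)[OF j(1)] by (simp add: field_simps)
      also have "\<dots> \<le> norm v * C" using C[OF j(1)] by (intro mult_left_mono) auto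
      finally show ?thesis .
    qed
    with le[OF k] show "cmod (a k v) \<le> norm v * C" by simp
  qed
qed

lemma dual_space_eqI:
  assumes "cvec.span B = \<aa>" "\<phi> \<in> dual_space \<aa>" "\<psi> \<in> dual_space \<aa>"
    and "\<And>b. b \<in> B \<Longrightarrow> \<phi> b = \<psi> b"
  shows "\<phi> = \<psi>"
proof
  fix y
  show "\<phi> y = \<psi> y"
  proof (cases "y \<in> \<aa>")
    case True
    have zero: "\<theta> 0 = 0" if "\<theta> \<in> dual_space \<aa>" for \<theta>
    proof -
      have "0 \<in> \<aa>" using cvec.span_zero assms(1) by blast
      then have "\<theta> (0 *\<^sub>C 0) = 0 * \<theta> 0" using that unfolding dual_space_def by blast
      then show ?thesis by simp
    qed
    have "y \<in> cvec.span B" using True assms(1) by simp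
    \<comment> \<open>Membership in \<open>\<aa>\<close> is carried along because
      \<open>dual_space\<close> grants additivity only on \<open>\<aa>\<close>.\<close>
    then have "y \<in> \<aa> \<and> \<phi> y = \<psi> y"
    proof (induction rule: cvec.span_induct_alt)
      case base
      show ?case using zero[OF assms(2)] zero[OF assms(3)] cvec.span_zero[of B] assms(1) by simp
    next
      case (step c b z)
      have "b \<in> \<aa>" using step(1) cvec.span_base assms(1) by blast
      moreover from this have "c *\<^sub>C b \<in> \<aa>" using assms(1) cvec.span_scale by blast
      moreover from this step have "c *\<^sub>C b + z \<in> \<aa>" using assms(1) cvec.span_add by blast
      ultimately show ?case using step assms(2-4) by (simp add: dual_space_def)
    qed
    then show ?thesis ..
  next
    case False
    then show ?thesis using assms(2,3) by (simp add: dual_space_def)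
  qed
qed

text \<open>The functions v |-> \<open>ev v (x k)\<close> work. A Frechet derivative requires
  bounded coordinates, and \<open>coordinates_bounded\<close> supplies the bound once v is expanded
  in the \<mu> k.\<close>

lemma coordinate_mero:
  fixes ev :: "'v::complex_normed_vector \<Rightarrow> 'u::complex_vector \<Rightarrow> complex"
  assumes "is_dual \<aa> ev" "is_basis \<aa> d x" "is_dual_basis ev d x \<mu>"
  obtains l :: "nat \<Rightarrow> 'v mero"
  where "\<And>j k. j \<in> {1..d} \<Longrightarrow> k \<in> {1..d} \<Longrightarrow> mero_deriv (\<mu> j) (l k) = (if j = k then 1 else 0)"
proof -
  have lin: "ev (v + w) y = ev v y + ev w y" "ev (c *\<^sub>C v) y = c * ev v y" for v w y c
    using assms(1) by (simp_all add: is_dual_def)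
  have bij: "bij_betw ev UNIV (dual_space \<aa>)" using assms(1) by (simp add: is_dual_def)
  have dual: "ev (\<mu> k) (x m) = (if k = m then 1 else 0)" if "k \<in> {1..d}" "m \<in> {1..d}" for k m
    using assms(3) that by (simp add: is_dual_basis_def)
  have zero: "ev 0 y = 0" for y using lin(2)[of 0 0 y] by simp
  have ev_sum: "ev (\<Sum>k\<in>S. b k *\<^sub>C \<mu> k) y = (\<Sum>k\<in>S. b k * ev (\<mu> k) y)" if "finite S" for S b y
    using that by (induction S) (simp_all add: lin zero)
  \<comment> \<open>As \<open>ev\<close> is injective, the expansion may be checked on the basis of
    \<open>\<aa>\<close>.\<close>
  have rep: "v = (\<Sum>k=1..d. ev v (x k) *\<^sub>C \<mu> k)" for v
  proof (rule injD[of ev])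
    show "inj ev" using bij by (simp add: bij_betw_def)
    show "ev v = ev (\<Sum>k=1..d. ev v (x k) *\<^sub>C \<mu> k)"
    proof (rule dual_space_eqI)
      show "cvec.span (x ` {1..d}) = \<aa>" using assms(2) by (simp add: is_basis_def)
      show "ev v b = ev (\<Sum>k=1..d. ev v (x k) *\<^sub>C \<mu> k) b" if "b \<in> x ` {1..d}" for b
      proof -
        obtain m where m: "m \<in> {1..d}" "b = x m" using \<open>b \<in> x ` {1..d}\<close> by blast
        have "(\<Sum>k=1..d. ev v (x k) * ev (\<mu> k) (x m)) = (\<Sum>k=1..d. if k = m then ev v (x k) else 0)"
          using dual m(1) by (intro sum.cong) auto
        then show ?thesis using m by (simp add: ev_sum)
      qed
    qed (use bij in \<open>auto simp: bij_betw_def\<close>)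
  qed
  obtain C where C: "\<And>k v. k \<in> {1..d} \<Longrightarrow> cmod (ev v (x k)) \<le> norm v * C"
    by (rule coordinates_bounded[of "\<lambda>k v. ev v (x k)" \<mu> d]) (use rep lin dual in auto)
  show ?thesis
  proof (rule that[of "\<lambda>k. abs_mero (\<lambda>v. ev v (x k))"])
    fix j k assume jk: "j \<in> {1..d}" "k \<in> {1..d}"
    have bl: "bounded_linear (\<lambda>v. ev v (x k))"
      by (rule bounded_linear_intro[where K = C])
         (simp_all add: lin scaleR_scaleC C[OF jk(2)] scaleR_conv_of_real)
    have h: "holo_on UNIV (\<lambda>v. ev v (x k))"
      unfolding holo_on_def using bounded_linear_imp_has_derivative[OF bl] lin(2) by blast
    have m: "mero_fun (\<lambda>v. ev v (x k))"
      unfolding mero_fun_def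
      by (intro allI exI[of _ UNIV] exI[of _ "\<lambda>v. ev v (x k)"] exI[of _ "\<lambda>_. 1"])
         (auto intro: holo_on_const h)
    have "dirderiv (\<mu> j) (\<lambda>v. ev v (x k)) = (\<lambda>_. if j = k then 1 else 0)"
    proof
      fix q
      show "dirderiv (\<mu> j) (\<lambda>v. ev v (x k)) q = (if j = k then 1 else 0)"
        using dirderiv_eq(2)[OF bounded_linear_imp_has_derivative[OF bl], where q = q and v = "\<mu> j"] dual[OF jk] lin(2) by simp
    qed
    then show "mero_deriv (\<mu> j) (abs_mero (\<lambda>v. ev v (x k))) = (if j = k then 1 else 0)"
      by (simp add: mero_deriv_abs[OF m] one_mero_def zero_mero_def)
  qed
qed

section \<open>Linear maps of tensor products\<close>

definition clin :: "('a::complex_vector \<Rightarrow> 'b::complex_vector) \<Rightarrow> bool" where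
  "clin f \<longleftrightarrow> (\<forall>x y. f (x + y) = f x + f y) \<and> (\<forall>c x. f (c *\<^sub>C x) = c *\<^sub>C f x)"

lemma clinD:
  assumes "clin f"
  shows "f (x + y) = f x + f y" "f (c *\<^sub>C x) = c *\<^sub>C f x" "f 0 = 0" "f (- x) = - f x"
    "f (x - y) = f x - f y" "f (\<Sum>s\<in>S. g s) = (\<Sum>s\<in>S. f (g s))"
proof -
  have add: "f (x + y) = f x + f y" for x y using assms by (simp add: clin_def)
  then show "f (x + y) = f x + f y" .
  show zero: "f 0 = 0" using add[of 0 0] by simp
  show neg: "f (- x) = - f x" for x using add[of "- x" x] zero by (simp add: eq_neg_iff_add_eq_0)
  show "f (x - y) = f x - f y" using add[of x "- y"] neg by simp
  show "f (\<Sum>s\<in>S. g s) = (\<Sum>s\<in>S. f (g s))"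
    by (induction S rule: infinite_finite_induct) (simp_all add: zero add)
qed (use assms in \<open>simp add: clin_def\<close>)

lemma clin_id: "clin id" "clin (\<lambda>x. x)"
  by (simp_all add: clin_def)

lemma clin_compose: "clin f \<Longrightarrow> clin g \<Longrightarrow> clin (\<lambda>x. f (g x))"
  by (simp add: clin_def)

lemma clin_tensor_lift: "bilin f \<Longrightarrow> clin (tensor_lift f)"
  by (simp add: clin_def tensor_lift_add tensor_lift_scale)

lemma clin_tpower_lift: "multilin f \<Longrightarrow> clin (tpower_lift f)"
  by (simp add: clin_def tpower_lift_add tpower_lift_scale)

lemma clin_tensor_eq:
  assumes "clin F" "clin G" "\<And>a b. F (a \<otimes> b) = G (a \<otimes> b)"
  shows "F t = G t"
  by (rule tensor_eqI) (simp_all add: clinD(1)[OF assms(1)] clinD(1)[OF assms(2)] assms(3))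

lemma clin_tpower_eq:
  assumes "clin F" "clin G" "\<And>us. F (ptens us) = G (ptens us)"
  shows "F t = G t"
  by (rule tpower_eqI) (simp_all add: clinD(1,2)[OF assms(1)] clinD(1,2)[OF assms(2)] assms(3))

lemma clin_times:
  fixes a :: "'a::complex_algebra"
  assumes "clin f"
  shows "clin (\<lambda>x. a * f x)" "clin (\<lambda>x. f x * a)"
  using assms by (simp_all add: clin_def distrib_left distrib_right mult_scaleC_left mult_scaleC_right)

lemma clin_add_diff:
  assumes "clin f" "clin g"
  shows "clin (\<lambda>x. f x + g x)" "clin (\<lambda>x. f x - g x)"
  using assms by (simp_all add: clin_def scaleC_add_right cvec.scale_right_diff_distrib)

lemma tensor_map_bilin: "clin f \<Longrightarrow> clin g \<Longrightarrow> bilin (\<lambda>a b. f a \<otimes> g b)"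
  by (simp add: bilin_def clin_def tens_simps)

lemma clin_tensor_map: "clin f \<Longrightarrow> clin g \<Longrightarrow> clin (tensor_map f g)"
  unfolding tensor_map_def by (intro clin_tensor_lift tensor_map_bilin)

lemma tensor_map_tens: "clin f \<Longrightarrow> clin g \<Longrightarrow> tensor_map f g (a \<otimes> b) = f a \<otimes> g b"
  unfolding tensor_map_def by (intro tensor_lift_tens tensor_map_bilin)

lemma tens_zero: "0 \<otimes> b = 0" "a \<otimes> 0 = 0"
  using tens_scale_left[of 0 0 b] tens_scale_right[of a 0 0] by simp_all

lemma clin_tens: "clin (\<lambda>a. a \<otimes> b)" "clin (\<lambda>b. a \<otimes> b)"
  by (simp_all add: clin_def tens_simps)

lemma tensor_commute:
  fixes f :: "'a::complex_vector \<Rightarrow> 'e::complex_algebra"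
  assumes F: "clin F" and G: "clin G"
    and *: "\<And>a b a' b'. F (a \<otimes> b) * G (a' \<otimes> b') = (G (a' \<otimes> b') * F (a \<otimes> b) :: 'e)"
  shows "F s * G t = G t * F s"
proof (rule clin_tensor_eq[where F = "\<lambda>s. F s * G t"])
  fix a b
  show "F (a \<otimes> b) * G t = G t * F (a \<otimes> b)"
    by (rule clin_tensor_eq[where F = "\<lambda>t. F (a \<otimes> b) * G t"]) (intro clin_times G *)+
qed (intro clin_times F)+

lemma tensor_map_mult:
  assumes f: "clin f" "\<And>a a'. f (a * a') = f a * f a'" and g: "clin g" "\<And>b b'. g (b * b') = g b * g b'"
  shows "tensor_map f g (s * t) = tensor_map f g s * tensor_map f g t"
proof -
  note cl = clin_tensor_map[OF f(1) g(1)]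
  show ?thesis
  proof (rule clin_tensor_eq[where F = "\<lambda>s. tensor_map f g (s * t)"])
    fix a b
    show "tensor_map f g ((a \<otimes> b) * t) = tensor_map f g (a \<otimes> b) * tensor_map f g t"
      by (rule clin_tensor_eq[where F = "\<lambda>t. tensor_map f g ((a \<otimes> b) * t)"])
         ((intro clin_compose[OF cl] clin_times clin_id cl)+,
          simp add: tensor_map_tens[OF f(1) g(1)] tens_times_tens f(2) g(2))
  qed (intro clin_compose[OF cl] clin_times clin_id cl)+
qed

section \<open>Meromorphic functions with values in an algebra\<close>

lemma clin_fun_map: "clin f \<Longrightarrow> clin (fun_map f)"
  unfolding fun_map_def by (intro clin_tensor_map clin_id)

lemma fun_map_tens: "clin f \<Longrightarrow> fun_map f (m \<otimes> b) = m \<otimes> f b"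
  unfolding fun_map_def by (simp add: tensor_map_tens clin_id)

lemma fun_map_mult:
  "clin f \<Longrightarrow> (\<And>b b'. f (b * b') = f b * f b') \<Longrightarrow> fun_map f (p * q) = fun_map f p * fun_map f q"
  unfolding fun_map_def by (rule tensor_map_mult[OF clin_id(1)]) auto

lemma fun_map_const: "clin f \<Longrightarrow> fun_map f (const_fun b) = const_fun (f b)"
  by (simp add: const_fun_def fun_map_tens)

lemma fun_map_fun_map: "clin f \<Longrightarrow> clin g \<Longrightarrow> fun_map f (fun_map g p) = fun_map (\<lambda>x. f (g x)) p"
  by (rule clin_tensor_eq[where F = "\<lambda>p. fun_map f (fun_map g p)"])
     (simp_all add: fun_map_tens clin_fun_map clin_compose[of f g] clin_compose[of "fun_map f" "fun_map g"])

lemma fun_map_id: "fun_map (\<lambda>x. x) p = p"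
  by (rule clin_tensor_eq[where G = "\<lambda>x. x"]) (auto simp: fun_map_tens clin_id intro: clin_fun_map)

lemma fun_map_commute:
  fixes f :: "'a::complex_vector \<Rightarrow> 'e::complex_algebra"
  assumes "clin f" "clin g" "\<And>a b. f a * g b = g b * f a"
  shows "fun_map f p * fun_map g q = fun_map g q * fun_map f p"
  by (rule tensor_commute) (simp_all add: assms clin_fun_map fun_map_tens tens_times_tens mult.commute)

lemma clin_mero_deriv: "clin (mero_deriv v)"
  by (simp add: clin_def mero_deriv_add mero_deriv_scale)

lemma clin_fun_deriv: "clin (fun_deriv v)"
  unfolding fun_deriv_def by (intro clin_tensor_map clin_mero_deriv clin_id)

lemma fun_deriv_tens: "fun_deriv v (m \<otimes> b) = mero_deriv v m \<otimes> b"
  unfolding fun_deriv_def by (simp add: tensor_map_tens clin_mero_deriv clin_id)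

lemma fun_deriv_const: "fun_deriv v (const_fun b) = 0"
  by (simp add: const_fun_def fun_deriv_tens mero_deriv_one tens_zero)

lemma fun_deriv_mult:
  fixes p q :: "('v::complex_normed_vector, 'e::complex_algebra) merof"
  shows "fun_deriv v (p * q) = fun_deriv v p * q + p * fun_deriv v q"
proof -
  note D = clin_fun_deriv[of v]
  show ?thesis
  proof (rule clin_tensor_eq[where F = "\<lambda>p. fun_deriv v (p * q)"])
    fix a :: "'v mero" and b :: 'e
    show "fun_deriv v ((a \<otimes> b) * q) = fun_deriv v (a \<otimes> b) * q + (a \<otimes> b) * fun_deriv v q"
      by (rule clin_tensor_eq[where F = "\<lambda>q. fun_deriv v ((a \<otimes> b) * q)"])
         ((intro clin_compose[OF D] clin_times clin_id clin_add_diff D)+,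
          simp add: fun_deriv_tens tens_times_tens mero_deriv_mult tens_add_left)
  qed (intro clin_compose[OF D] clin_times clin_id clin_add_diff D)+
qed

lemma fun_deriv_commute: "fun_deriv v (fun_deriv w p) = fun_deriv w (fun_deriv v p)"
  by (rule clin_tensor_eq[where F = "\<lambda>p. fun_deriv v (fun_deriv w p)"])
     (simp_all add: fun_deriv_tens mero_deriv_commute[of v w] clin_fun_deriv
        clin_compose[of "fun_deriv v" "fun_deriv w"] clin_compose[of "fun_deriv w" "fun_deriv v"])

lemma fun_map_deriv: "clin f \<Longrightarrow> fun_map f (fun_deriv v p) = fun_deriv v (fun_map f p)"
  by (rule clin_tensor_eq[where F = "\<lambda>p. fun_map f (fun_deriv v p)"])
     (simp_all add: fun_deriv_tens fun_map_tens clin_fun_deriv clin_fun_map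
        clin_compose[of "fun_map f" "fun_deriv v"] clin_compose[of "fun_deriv v" "fun_map f"])

lemma lie_comm_fun_map:
  assumes "clin f" "\<And>b b'. f (b * b') = f b * f b'"
  shows "fun_map f (lie_comm p q) = lie_comm (fun_map f p) (fun_map f q)"
  unfolding lie_comm_def by (simp add: clinD[OF clin_fun_map[OF assms(1)]] fun_map_mult[OF assms])

lemma euler_fun_map:
  assumes "clin f" "\<And>b b'. f (b * b') = f b * f b'"
  shows "fun_map f (euler d x \<mu> p q) = euler d x \<mu> (\<lambda>u. f (p u)) (fun_map f q)"
  unfolding euler_def
  by (simp add: clinD[OF clin_fun_map[OF assms(1)]] fun_map_mult[OF assms] fun_map_const[OF assms(1)] fun_map_deriv[OF assms(1)])

lemma clin_euler: "clin (euler d x \<mu> p)"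
  unfolding euler_def clin_def
  by (simp add: clinD[OF clin_fun_deriv] distrib_left sum.distrib mult_scaleC_right cvec.scale_sum_right)

section \<open>Placement\<close>

lemma slots_nth: "n < N \<Longrightarrow> slots N ps ! n = (case map_of ps (Suc n) of Some u \<Rightarrow> u | None \<Rightarrow> 1)"
  by (simp add: slots_def nth_upt del: upt_Suc)

lemma slots_eqI:
  assumes "\<And>p. p \<in> {1..N} \<Longrightarrow>
    (case map_of ps p of Some u \<Rightarrow> u | None \<Rightarrow> 1) = (case map_of qs p of Some u \<Rightarrow> u | None \<Rightarrow> 1)"
  shows "slots N ps = slots N qs"
  by (rule nth_equalityI) (auto simp: slots_nth assms)

text \<open>\<open>map_of\<close> returns the first match, so only the keys before i have to differ
  from it; position i has list index i - 1.\<close>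

lemma slots_upd:
  assumes "i \<in> {1..N}" "i \<notin> fst ` set ps"
  shows "slots N (ps @ (i, u) # qs) = (slots N (ps @ (i, u') # qs))[i - 1 := u]"
proof (rule nth_equalityI)
  fix n assume "n < length (slots N (ps @ (i, u) # qs))"
  then have n: "n < N" by simp
  have "map_of ps i = None" using assms(2) by (simp add: map_of_eq_None_iff)
  moreover have "n = i - 1 \<longleftrightarrow> Suc n = i" using assms(1) by auto
  ultimately show "slots N (ps @ (i, u) # qs) ! n = (slots N (ps @ (i, u') # qs))[i - 1 := u] ! n"
    using n by (auto simp: slots_nth nth_list_update map_add_def split: option.splits)
qed simp

lemma ptens_list_update:
  assumes "n < length L"
  shows "ptens (L[n := u + v]) = ptens (L[n := u]) + ptens (L[n := v])"
    and "ptens (L[n := c *\<^sub>C u]) = c *\<^sub>C ptens (L[n := u])"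
  using assms by (simp_all add: upd_conv_take_nth_drop ptens_add ptens_scale)

text \<open>Generalises the patterns of \<open>at1\<close> and \<open>at2\<close> to any list of
  positions. The value 0 on lists of another length extends placement from one tensor power to the
  sum of all of them.\<close>

definition placed :: "nat \<Rightarrow> nat list \<Rightarrow> 'u::complex_algebra_1 list \<Rightarrow> 'u tpower" where
  "placed N is us = (if length us = length is then ptens (slots N (zip is us)) else 0)"

definition place :: "nat \<Rightarrow> nat list \<Rightarrow> 'u::complex_algebra_1 tpower \<Rightarrow> 'u tpower" where
  "place N is = tpower_lift (placed N is)"

lemma multilin_placed:
  assumes "distinct is" "set is \<subseteq> {1..N}"
  shows "multilin (placed N is :: 'u::complex_algebra_1 list \<Rightarrow> _)"
proof -
  \<comment> \<open>Varying one entry amounts to updating a fixed list, which reduces multilinearity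
    to \<open>ptens_list_update\<close>. The 0 put at position i is a placeholder that the update
    overwrites.\<close>
  have key: "\<exists>L n. n < length L \<and> (\<forall>u. placed N is (us @ u # ws) = ptens (L[n := u]))"
    if len: "length (us @ undefined # ws) = length is" for us ws :: "'u list"
  proof -
    obtain js i ks where split: "is = js @ i # ks" "length js = length us" "length ks = length ws"
    proof (rule that)
      show "is = take (length us) is @ is ! length us # drop (Suc (length us)) is"
        using len by (intro id_take_nth_drop) auto
    qed (use len in auto)
    have i: "i \<in> {1..N}" "i \<notin> fst ` set (zip js us)"
      using assms split by (auto dest: set_zip_leftD)
    let ?L = "slots N (zip js us @ (i, 0) # zip ks ws)"
    have "placed N is (us @ u # ws) = ptens (?L[i - 1 := u])" for u
      using slots_upd[OF i, of u "zip ks ws" 0] split by (simp add: placed_def)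
    moreover have "i - 1 < length ?L" using i(1) by auto
    ultimately show ?thesis by blast
  qed
  show ?thesis
    unfolding multilin_def
  proof (intro conjI allI)
    fix us ws :: "'u list" and u v and c :: complex
    show "placed N is (us @ (u + v) # ws) = placed N is (us @ u # ws) + placed N is (us @ v # ws)"
      using key[of us ws] by (cases "length us + length ws + 1 = length is") (auto simp: ptens_list_update placed_def)
    show "placed N is (us @ (c *\<^sub>C u) # ws) = c *\<^sub>C placed N is (us @ u # ws)"
      using key[of us ws] by (cases "length us + length ws + 1 = length is") (auto simp: ptens_list_update placed_def)
  qed
qed

lemma multilin_imp_bilin:
  assumes "multilin f" shows "bilin (\<lambda>u v. f [u, v])"
proof -
  have m: "f (us @ (u + v) # ws) = f (us @ u # ws) + f (us @ v # ws)"
    "f (us @ (c *\<^sub>C u) # ws) = c *\<^sub>C f (us @ u # ws)" for us u v ws c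
    using assms by (simp_all add: multilin_def)
  have "f [u + u', v] = f [u, v] + f [u', v]" "f [u, v + v'] = f [u, v] + f [u, v']"
    "f [c *\<^sub>C u, v] = c *\<^sub>C f [u, v]" "f [u, c *\<^sub>C v] = c *\<^sub>C f [u, v]" for u u' v v' c
    using m(1)[of "[]" u u' "[v]"] m(1)[of "[u]" v v' "[]"] m(2)[of "[]" c u "[v]"] m(2)[of "[u]" c v "[]"]
    by simp_all
  then show ?thesis by (simp add: bilin_def)
qed

lemma multilin_imp_clin:
  assumes "multilin f" shows "clin (\<lambda>u. f [u])"
proof -
  have "f ([] @ (u + v) # []) = f ([] @ u # []) + f ([] @ v # [])"
    "f ([] @ (c *\<^sub>C u) # []) = c *\<^sub>C f ([] @ u # [])" for u v c
    using assms unfolding multilin_def by blast+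
  then show ?thesis by (simp add: clin_def)
qed

lemma at1_eq: "at1 N i = (\<lambda>u. placed N [i] [u])"
  by (simp add: fun_eq_iff at1_def placed_def)

lemma clin_at1: "i \<in> {1..N} \<Longrightarrow> clin (at1 N i)"
  unfolding at1_eq by (intro multilin_imp_clin multilin_placed) auto

lemma bilin_at2:
  assumes "i \<in> {1..N}" "j \<in> {1..N}" "i \<noteq> j"
  shows "bilin (\<lambda>u v :: 'u::complex_algebra_1. ptens (slots N [(i, u), (j, v)]))"
proof -
  have "multilin (placed N [i, j] :: 'u list \<Rightarrow> _)" using assms by (intro multilin_placed) auto
  from multilin_imp_bilin[OF this] show ?thesis by (simp add: placed_def)
qed

lemma clin_at2: "i \<in> {1..N} \<Longrightarrow> j \<in> {1..N} \<Longrightarrow> i \<noteq> j \<Longrightarrow> clin (at2 N i j)"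
  unfolding at2_def by (intro clin_tensor_lift bilin_at2)

lemma at2_tens: "i \<in> {1..N} \<Longrightarrow> j \<in> {1..N} \<Longrightarrow> i \<noteq> j \<Longrightarrow> at2 N i j (u \<otimes> v) = ptens (slots N [(i, u), (j, v)])"
  unfolding at2_def by (intro tensor_lift_tens bilin_at2)

lemma clin_place: "distinct is \<Longrightarrow> set is \<subseteq> {1..N} \<Longrightarrow> clin (place N is)"
  unfolding place_def by (intro clin_tpower_lift multilin_placed)

lemma place_ptens:
  "distinct is \<Longrightarrow> set is \<subseteq> {1..N} \<Longrightarrow> length us = length is \<Longrightarrow> place N is (ptens us) = ptens (slots N (zip is us))"
  unfolding place_def by (simp add: tpower_lift_ptens multilin_placed) (simp add: placed_def)

lemma ptens_slots_times:
  "ptens (slots N ps) * ptens (slots N qs) = ptens (map2 (*) (slots N ps) (slots N qs))"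
  for ps :: "(nat \<times> 'u::complex_algebra_1) list"
  by (simp add: ptens_times_ptens)

lemma map2_slots:
  fixes us vs :: "'u::complex_algebra_1 list"
  assumes "length us = length is" "length vs = length is"
  shows "slots N (zip is (map2 (*) us vs)) = map2 (*) (slots N (zip is us)) (slots N (zip is vs))"
proof (rule nth_equalityI)
  have *: "(case map_of (zip is (map2 (*) us vs)) p of Some u \<Rightarrow> u | None \<Rightarrow> 1)
      = (case map_of (zip is us) p of Some u \<Rightarrow> u | None \<Rightarrow> 1) * (case map_of (zip is vs) p of Some u \<Rightarrow> u | None \<Rightarrow> 1)" for p
    using assms
  proof (induction "is" arbitrary: us vs)
    case (Cons i js)
    then show ?case by (cases us; cases vs) auto
  qed simp
  fix n assume "n < length (slots N (zip is (map2 (*) us vs)))"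
  then show "slots N (zip is (map2 (*) us vs)) ! n = map2 (*) (slots N (zip is us)) (slots N (zip is vs)) ! n"
    by (simp add: slots_nth *)
qed simp

text \<open>Positions outside \<open>is\<close> carry 1 * 1 = 1. For lists of different lengths the
  product on the left is 0, and on the right at least one factor has the wrong length and is 0
  too.\<close>

lemma place_mult:
  fixes s t :: "'u::complex_algebra_1 tpower"
  assumes "distinct is" "set is \<subseteq> {1..N}"
  shows "place N is (s * t) = place N is s * place N is t"
proof -
  note cl = clin_place[OF assms]
  have pl: "place N is (ptens us) = placed N is us" for us :: "'u list"
    unfolding place_def by (simp add: tpower_lift_ptens multilin_placed[OF assms])
  show ?thesis
  proof (rule clin_tpower_eq[where F = "\<lambda>s. place N is (s * t)"])
    fix us :: "'u list"
    show "place N is (ptens us * t) = place N is (ptens us) * place N is t"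
    proof (rule clin_tpower_eq[where F = "\<lambda>t. place N is (ptens us * t)"])
      fix vs :: "'u list"
      show "place N is (ptens us * ptens vs) = place N is (ptens us) * place N is (ptens vs)"
        by (auto simp: ptens_times_ptens pl placed_def clinD(3)[OF cl] map2_slots)
    qed (intro clin_compose[OF cl] clin_times clin_id cl)+
  qed (intro clin_compose[OF cl] clin_times clin_id cl)+
qed

section \<open>Commutation at disjoint positions\<close>

text \<open>At every position at least one of the two factors is 1.\<close>

lemma ptens_slots_commute:
  fixes ps qs :: "(nat \<times> 'u::complex_algebra_1) list"
  assumes "fst ` set ps \<inter> fst ` set qs = {}"
  shows "ptens (slots N ps) * ptens (slots N qs) = ptens (slots N qs) * ptens (slots N ps)"
proof -
  have "map2 (*) (slots N ps) (slots N qs) = map2 (*) (slots N qs) (slots N ps)"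
  proof (rule nth_equalityI)
    fix n assume "n < length (map2 (*) (slots N ps) (slots N qs))"
    moreover have "map_of ps p = None \<or> map_of qs p = None" for p
      using assms by (auto simp: map_of_eq_None_iff)
    ultimately show "map2 (*) (slots N ps) (slots N qs) ! n = map2 (*) (slots N qs) (slots N ps) ! n"
      by (auto simp: slots_nth split: option.splits) (metis option.distinct(1))+
  qed simp
  then show ?thesis by (simp add: ptens_slots_times)
qed

lemma at2_commute:
  assumes "i \<in> {1..N}" "j \<in> {1..N}" "i \<noteq> j" "k \<in> {1..N}" "l \<in> {1..N}" "k \<noteq> l" "{i, j} \<inter> {k, l} = {}"
  shows "at2 N i j s * at2 N k l t = at2 N k l t * at2 N i j s"
  by (rule tensor_commute[OF clin_at2 clin_at2]) (use assms in \<open>auto simp: at2_tens intro!: ptens_slots_commute\<close>)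

lemma at1_at2_commute:
  assumes "k \<in> {1..N}" "l \<in> {1..N}" "k \<noteq> l" "i \<notin> {k, l}"
  shows "at1 N i u * at2 N k l t = at2 N k l t * at1 N i u"
proof (rule clin_tensor_eq[where F = "\<lambda>t. at1 N i u * at2 N k l t"])
  fix a b
  show "at1 N i u * at2 N k l (a \<otimes> b) = at2 N k l (a \<otimes> b) * at1 N i u"
    unfolding at2_tens[OF assms(1-3)] at1_def by (rule ptens_slots_commute) (use assms in auto)
qed (intro clin_times clin_at2 assms)+

lemma at1_commute: "i \<noteq> j \<Longrightarrow> at1 N i u * at1 N j w = at1 N j w * at1 N i u"
  unfolding at1_def by (rule ptens_slots_commute) auto

section \<open>The coefficients of the operators\<close>

lemma clin_mid: "clin (mid :: 'u::complex_vector tpower \<Rightarrow> ('a::complex_algebra_1, 'u, 'b::complex_algebra_1) tri)"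
  by (simp add: clin_def mid_def tens_simps)

lemma mid_mult: "mid (z * w) = mid z * mid w"
  by (simp add: mid_def tens_times_tens)

section \<open>Left inverses of the embeddings of values\<close>

text \<open>As 1 \<noteq> 0, the unit is linearly independent, and a functional prescribed on it
  extends to the whole algebra.\<close>

lemma unit_functional:
  obtains \<phi> :: "'a::complex_algebra_1 \<Rightarrow> complex"
  where "\<And>a b. \<phi> (a + b) = \<phi> a + \<phi> b" "\<And>c a. \<phi> (c *\<^sub>C a) = c * \<phi> a" "\<phi> 1 = 1"
proof -
  interpret vector_space_pair "scaleC :: complex \<Rightarrow> 'a \<Rightarrow> 'a" "(*) :: complex \<Rightarrow> complex \<Rightarrow> complex"
    by unfold_locales (auto simp: algebra_simps)
  have "cvec.independent {1 :: 'a}" by (simp add: cvec.independent_insert)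
  from linear_independent_extend[OF this, of "\<lambda>_. 1"] obtain \<phi> where
    \<phi>: "Vector_Spaces.linear (*\<^sub>C) (*) \<phi>" "\<phi> (1 :: 'a) = 1" by auto
  show ?thesis by (rule that[of \<phi>]) (use \<phi> linear_add linear_scale in auto)
qed

text \<open>Functionals with value 1 at the unit, applied to the two outer factors, turn 1 \<otimes>
  z \<otimes> 1 back into z. This brings vanishing of operator coefficients back to equations with
  values in tensor powers of U.\<close>

lemma mid_left_inverse:
  obtains L :: "('a::complex_algebra_1, 'u::complex_vector, 'b::complex_algebra_1) tri \<Rightarrow> 'u tpower"
  where "clin L" "\<And>z. L (mid z) = z"
proof -
  obtain \<phi> :: "'a \<Rightarrow> complex" where
    \<phi>: "\<And>a b. \<phi> (a + b) = \<phi> a + \<phi> b" "\<And>c a. \<phi> (c *\<^sub>C a) = c * \<phi> a" "\<phi> 1 = 1"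
    using unit_functional by blast
  obtain \<psi> :: "'b \<Rightarrow> complex" where
    \<psi>: "\<And>a b. \<psi> (a + b) = \<psi> a + \<psi> b" "\<And>c a. \<psi> (c *\<^sub>C a) = c * \<psi> a" "\<psi> 1 = 1"
    using unit_functional by blast
  have 1: "bilin (\<lambda>(z::'u tpower) b. \<psi> b *\<^sub>C z)"
    by (simp add: bilin_def \<psi> scaleC_add_left scaleC_add_right scaleC_scaleC mult.commute)
  have 2: "bilin (\<lambda>a w. \<phi> a *\<^sub>C tensor_lift (\<lambda>(z::'u tpower) b. \<psi> b *\<^sub>C z) w)"
    by (simp add: bilin_def \<phi> scaleC_add_left scaleC_add_right scaleC_scaleC mult.commute
        tensor_lift_add[OF 1] tensor_lift_scale[OF 1])
  show ?thesis
    by (rule that[OF clin_tensor_lift[OF 2]])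
       (simp add: mid_def tensor_lift_tens[OF 1] tensor_lift_tens[OF 2] \<phi> \<psi> scaleC_one)
qed

lemma fun_map_mid_inj:
  assumes "fun_map (mid :: _ \<Rightarrow> ('a::complex_algebra_1, 'u::complex_vector, 'b::complex_algebra_1) tri) p = 0"
  shows "p = 0"
proof -
  obtain L :: "('a, 'u, 'b) tri \<Rightarrow> 'u tpower" where L: "clin L" "\<And>z. L (mid z) = z"
    using mid_left_inverse by blast
  have "fun_map L (fun_map (mid :: _ \<Rightarrow> ('a, 'u, 'b) tri) p) = p"
    by (simp add: fun_map_fun_map[OF L(1) clin_mid] L(2) fun_map_id)
  then show ?thesis by (simp add: assms clinD(3)[OF clin_fun_map[OF L(1)]])
qed

lemma slots_2: "slots 2 [(1, u), (2, v)] = [u, v]"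
  by (simp add: slots_def numeral_2_eq_2 upt_rec)

text \<open>The tensor square of U occurs both as \<open>tensor\<close> and as the summand of
  \<open>tpower\<close> spanned by lists of length 2; reading off the two entries leads back to the
  former.\<close>

lemma at2_left_inverse:
  obtains L :: "'u::complex_algebra_1 tpower \<Rightarrow> ('u, 'u) tensor"
  where "clin L" "\<And>t. L (at2 2 1 2 t) = t"
proof -
  let ?f = "\<lambda>us. if length us = 2 then us ! 0 \<otimes> us ! 1 else (0 :: ('u, 'u) tensor)"
  have m: "multilin ?f"
    unfolding multilin_def by (auto simp: nth_append nth_Cons' tens_simps length_Suc_conv numeral_2_eq_2 Suc_le_eq)
  have cl: "clin (tpower_lift ?f)" by (rule clin_tpower_lift[OF m])
  have at: "clin (at2 2 1 2 :: ('u, 'u) tensor \<Rightarrow> _)" by (rule clin_at2) auto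
  have "tpower_lift ?f (at2 2 1 2 t) = t" for t
    by (rule clin_tensor_eq[where F = "\<lambda>t. tpower_lift ?f (at2 2 1 2 t)"])
       (simp_all add: clin_compose[OF cl at] clin_id at2_tens tpower_lift_ptens[OF m] slots_2 del: One_nat_def)
  with cl show ?thesis using that by blast
qed

section \<open>Coefficients as \<open>fun_map\<close> images, and their commutation\<close>

lemma r_tri_at_eq:
  assumes "i \<in> {1..N}" "j \<in> {1..N}" "i \<noteq> j"
  shows "r_tri_at N i j r = fun_map (\<lambda>t. mid (at2 N i j t)) r"
  unfolding r_tri_at_def r_at_def by (rule fun_map_fun_map[OF clin_mid clin_at2[OF assms]])

definition kap :: "nat \<Rightarrow> nat \<Rightarrow> ('a::complex_algebra_1, ('u::complex_algebra_1, 'b::complex_algebra_1) tensor) tensor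
    \<Rightarrow> ('a, 'u, 'b) tri" where
  "kap N i = tensor_map id (tensor_map (at1 N i) id)"

lemma kappa_at_eq: "kappa_at N i \<kappa> = fun_map (kap N i) \<kappa>"
  by (simp add: kappa_at_def kap_def)

lemma clin_kap: "i \<in> {1..N} \<Longrightarrow> clin (kap N i)"
  unfolding kap_def by (intro clin_tensor_map clin_id clin_at1)

lemma kap_tens: "i \<in> {1..N} \<Longrightarrow> kap N i (a \<otimes> u \<otimes> b) = a \<otimes> at1 N i u \<otimes> b"
  unfolding kap_def by (simp add: tensor_map_tens clin_tensor_map clin_id clin_at1)

lemma kap_eqI:
  assumes "clin F" "clin G" "\<And>a u b. F (a \<otimes> u \<otimes> b) = G (a \<otimes> u \<otimes> b)"
  shows "F t = G t"
proof (rule clin_tensor_eq[OF assms(1,2)])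
  fix a w
  show "F (a \<otimes> w) = G (a \<otimes> w)"
    by (rule clin_tensor_eq[OF clin_compose[OF assms(1) clin_tens(2)] clin_compose[OF assms(2) clin_tens(2)] assms(3)])
qed

lemma kap_mid_commute:
  assumes "i \<in> {1..N}" "\<And>u. at1 N i u * w = w * at1 N i u"
  shows "kap N i t * mid w = mid w * kap N i t"
proof (rule kap_eqI[where F = "\<lambda>t. kap N i t * mid w"])
  show "kap N i (a \<otimes> u \<otimes> b) * mid w = mid w * kap N i (a \<otimes> u \<otimes> b)" for a u b
    unfolding kap_tens[OF assms(1)] by (simp add: mid_def tens_times_tens assms(2))
qed (intro clin_times clin_kap assms(1))+

lemma clin_mid_at1: "i \<in> {1..N} \<Longrightarrow> clin (\<lambda>u. mid (at1 N i u))"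
  by (rule clin_compose[OF clin_mid clin_at1])

lemma clin_mid_at2: "i \<in> {1..N} \<Longrightarrow> j \<in> {1..N} \<Longrightarrow> i \<noteq> j \<Longrightarrow> clin (\<lambda>u. mid (at2 N i j u))"
  by (rule clin_compose[OF clin_mid clin_at2])

lemma const_at1_eq: "i \<in> {1..N} \<Longrightarrow> const_fun (mid (at1 N i u)) = fun_map (\<lambda>u. mid (at1 N i u)) (const_fun u)"
  by (simp add: fun_map_const[OF clin_mid_at1])

lemma r_r_commute:
  assumes "i \<in> {1..N}" "j \<in> {1..N}" "i \<noteq> j" "k \<in> {1..N}" "l \<in> {1..N}" "k \<noteq> l" "{i, j} \<inter> {k, l} = {}"
  shows "r_tri_at N i j p * r_tri_at N k l q = r_tri_at N k l q * r_tri_at N i j p"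
  unfolding r_tri_at_eq[OF assms(1-3)] r_tri_at_eq[OF assms(4-6)]
  by (rule fun_map_commute[OF clin_mid_at2[OF assms(1-3)] clin_mid_at2[OF assms(4-6)]])
     (simp add: mid_mult[symmetric] at2_commute[OF assms])

lemma kappa_r_commute:
  assumes "i \<in> {1..N}" "k \<in> {1..N}" "l \<in> {1..N}" "k \<noteq> l" "i \<notin> {k, l}"
  shows "kappa_at N i \<kappa> * r_tri_at N k l q = r_tri_at N k l q * kappa_at N i \<kappa>"
  unfolding kappa_at_eq r_tri_at_eq[OF assms(2-4)]
  by (intro fun_map_commute clin_kap clin_mid_at2 kap_mid_commute at1_at2_commute assms)

lemma const_r_commute:
  assumes "i \<in> {1..N}" "k \<in> {1..N}" "l \<in> {1..N}" "k \<noteq> l" "i \<notin> {k, l}"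
  shows "const_fun (mid (at1 N i u)) * r_tri_at N k l q = r_tri_at N k l q * const_fun (mid (at1 N i u))"
  unfolding const_at1_eq[OF assms(1)] r_tri_at_eq[OF assms(2-4)]
  by (rule fun_map_commute[OF clin_mid_at1[OF assms(1)] clin_mid_at2[OF assms(2-4)]])
     (simp add: mid_mult[symmetric] at1_at2_commute[OF assms(2-5)])

lemma const_kappa_commute:
  assumes "i \<in> {1..N}" "j \<in> {1..N}" "i \<noteq> j"
  shows "const_fun (mid (at1 N i u)) * kappa_at N j \<kappa> = kappa_at N j \<kappa> * const_fun (mid (at1 N i u))"
  unfolding const_at1_eq[OF assms(1)] kappa_at_eq
  by (rule fun_map_commute[OF clin_mid_at1[OF assms(1)] clin_kap[OF assms(2)]],
      rule kap_mid_commute[OF assms(2), symmetric], rule at1_commute) (use assms in auto)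

section \<open>Commutators of first order operators\<close>

lemma clin_lie_comm:
  fixes a :: "'a::complex_algebra"
  shows "clin (lie_comm a)" "clin (\<lambda>b. lie_comm b a)"
  by (simp_all add: clin_def lie_comm_def algebra_simps mult_scaleC_left mult_scaleC_right cvec.scale_right_diff_distrib)

lemmas lie_comm_linear = clinD[OF clin_lie_comm(1)] clinD[OF clin_lie_comm(2)]

lemma lie_comm_eq_0: "a * b = b * a \<Longrightarrow> lie_comm a b = 0"
  by (simp add: lie_comm_def)

lemma euler_commutator:
  fixes d :: nat and x :: "nat \<Rightarrow> 'u" and \<mu> :: "nat \<Rightarrow> 'v::complex_normed_vector" and K1 K2 f :: "('v::complex_normed_vector, 'e::complex_algebra) merof"
  assumes pq: "\<And>u w. p u * q w = q w * p u"
  defines "D1 \<equiv> \<lambda>f. euler d x \<mu> p f - K1 * f" and "D2 \<equiv> \<lambda>f. euler d x \<mu> q f - K2 * f"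
  shows "D1 (D2 f) - D2 (D1 f) = (lie_comm K1 K2 - euler d x \<mu> p K2 + euler d x \<mu> q K1) * f
     + (\<Sum>k=1..d. (lie_comm (const_fun (q (x k))) K1 - lie_comm (const_fun (p (x k))) K2) * fun_deriv (\<mu> k) f)"
proof -
  let ?E = "euler d x \<mu>" and ?c = "\<lambda>p k. const_fun (p (x k))" and ?D = "\<lambda>k. fun_deriv (\<mu> k)"
  have diff: "?E p (a - b) = ?E p a - ?E p b" for p a b
    by (rule clinD(5)[OF clin_euler])
  have leibniz: "?E p (K * f) = ?E p K * f + (\<Sum>k=1..d. ?c p k * K * ?D k f)" for p K
    by (simp add: euler_def fun_deriv_mult distrib_left sum.distrib sum_distrib_right mult.assoc)
  \<comment> \<open>The coefficients of the Euler operators are constant, so their composition has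
    no first order terms.\<close>
  have EE: "?E p (?E q f) = (\<Sum>k=1..d. \<Sum>l=1..d. ?c p k * ?c q l * ?D k (?D l f))" for p q
    by (simp add: euler_def clinD(6)[OF clin_fun_deriv] fun_deriv_mult fun_deriv_const sum_distrib_left mult.assoc)
  have cc: "?c p k * ?c q l = ?c q l * ?c p k" for k l
    by (simp add: const_fun_def tens_times_tens pq)
  have "?E q (?E p f) = (\<Sum>l=1..d. \<Sum>k=1..d. ?c q k * ?c p l * ?D k (?D l f))"
    unfolding EE by (rule sum.swap)
  also have "\<dots> = ?E p (?E q f)"
    unfolding EE by (intro sum.cong refl arg_cong2[where f = "(*)"] cc[symmetric] fun_deriv_commute)
  finally have comm: "?E q (?E p f) = ?E p (?E q f)" .
  have "(\<Sum>k=1..d. (lie_comm (?c q k) K1 - lie_comm (?c p k) K2) * ?D k f)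
      = (\<Sum>k=1..d. ?c q k * K1 * ?D k f) - K1 * ?E q f - (\<Sum>k=1..d. ?c p k * K2 * ?D k f) + K2 * ?E p f"
    by (simp add: lie_comm_def left_diff_distrib sum_subtractf euler_def sum_distrib_left mult.assoc)
  then show ?thesis
    unfolding D1_def D2_def
    by (simp add: diff leibniz comm lie_comm_def algebra_simps)
qed

text \<open>In the application \<open>a s\<close> and \<open>b s\<close> are the r-terms joining
  site s to i and to j, and \<open>M\<close>, \<open>P\<close> those joining i and j. For different
  s, t the pairs of sites are disjoint, so the double sum of commutators collapses to its
  diagonal.\<close>

lemma zeroth_order_decomposition:
  fixes k1 k2 M P :: "'e::complex_algebra" and a b :: "nat \<Rightarrow> 'e"
  assumes "finite S" and E: "clin E" and F: "clin F"
    and "\<And>s. s \<in> S \<Longrightarrow> k1 * b s = b s * k1" "\<And>s. s \<in> S \<Longrightarrow> a s * k2 = k2 * a s"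
    and "\<And>s t. s \<in> S \<Longrightarrow> t \<in> S \<Longrightarrow> s \<noteq> t \<Longrightarrow> a s * b t = b t * a s"
  shows "lie_comm (k1 + M + (\<Sum>s\<in>S. a s)) (k2 + P + (\<Sum>s\<in>S. b s))
      - E (k2 + P + (\<Sum>s\<in>S. b s)) + F (k1 + M + (\<Sum>s\<in>S. a s))
    = (lie_comm (k1 + M) (k2 + P) + F (M + k1) - E (P + k2))
      + (\<Sum>s\<in>S. lie_comm M (b s) + lie_comm (a s) P + lie_comm (a s) (b s) - E (b s) + F (a s))"
proof -
  have "(\<Sum>s\<in>S. \<Sum>t\<in>S. lie_comm (a s) (b t)) = (\<Sum>s\<in>S. \<Sum>t\<in>S. if s = t then lie_comm (a s) (b s) else 0)"
    using assms(6) by (intro sum.cong refl) (auto intro: lie_comm_eq_0)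
  then have ab: "(\<Sum>s\<in>S. \<Sum>t\<in>S. lie_comm (a s) (b t)) = (\<Sum>s\<in>S. lie_comm (a s) (b s))"
    using assms(1) by simp
  have swap: "(\<Sum>s\<in>S. \<Sum>t\<in>S. lie_comm (a t) (b s)) = (\<Sum>s\<in>S. \<Sum>t\<in>S. lie_comm (a s) (b t))"
    by (rule sum.swap)
  have k1: "(\<Sum>s\<in>S. lie_comm k1 (b s)) = 0" using assms(4) by (intro sum.neutral ballI lie_comm_eq_0)
  have k2: "(\<Sum>s\<in>S. lie_comm (a s) k2) = 0" using assms(5) by (intro sum.neutral ballI lie_comm_eq_0)
  show ?thesis
    by (simp add: lie_comm_linear clinD[OF E] clinD[OF F] sum.distrib sum_subtractf k1 k2 swap ab)
qed

section \<open>Splitting the multiplication parts by sites\<close>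

text \<open>\<open>\<D>\<^sub>i = E\<^sub>i - mult_part i\<close>\<close>

definition mult_part where
  "mult_part rp rm \<kappa> N i = (\<Sum>s=1..<i. r_tri_at N s i rp) + kappa_at N i \<kappa> + (\<Sum>s=Suc i..N. r_tri_at N i s rm)"

lemma Dop_eq: "Dop d x \<mu> rp rm \<kappa> N i f = euler d x \<mu> (\<lambda>u. mid (at1 N i u)) f - mult_part rp rm \<kappa> N i * f"
  by (simp add: Dop_def mult_part_def distrib_right sum_distrib_right)

text \<open>Merges the two sums of \<open>mult_part\<close> into one over all s \<noteq> i, so that
  the contribution of a site can be split off whichever side it lies on.\<close>

definition r_term where
  "r_term rp rm N i s = (if s < i then r_tri_at N s i rp else r_tri_at N i s rm)"

lemma mult_part_eq:
  assumes "i \<in> {1..N}"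
  shows "mult_part rp rm \<kappa> N i = kappa_at N i \<kappa> + (\<Sum>s\<in>{1..N} - {i}. r_term rp rm N i s)" (is "_ = _ + sum ?f _")
proof -
  have "{1..N} - {i} = {1..<i} \<union> {Suc i..N}" using assms by auto
  then have "sum ?f ({1..N} - {i}) = sum ?f ({1..<i} \<union> {Suc i..N})" by (rule arg_cong)
  also have "\<dots> = sum ?f {1..<i} + sum ?f {Suc i..N}"
    by (rule sum.union_disjoint) auto
  also have "\<dots> = (\<Sum>s=1..<i. r_tri_at N s i rp) + (\<Sum>s=Suc i..N. r_tri_at N i s rm)"
    by (intro arg_cong2[where f = "(+)"] sum.cong) (auto simp: r_term_def)
  finally show ?thesis by (simp add: mult_part_def)
qed

lemma mult_part_split:
  assumes "i \<in> {1..N}" "j \<in> {1..N}" "i < j"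
  shows "mult_part rp rm \<kappa> N i = kappa_at N i \<kappa> + r_tri_at N i j rm + (\<Sum>s\<in>{1..N} - {i, j}. r_term rp rm N i s)"
    and "mult_part rp rm \<kappa> N j = kappa_at N j \<kappa> + r_tri_at N i j rp + (\<Sum>s\<in>{1..N} - {i, j}. r_term rp rm N j s)"
proof -
  have "(\<Sum>s\<in>{1..N} - {i}. r_term rp rm N i s) = r_term rp rm N i j + (\<Sum>s\<in>{1..N} - {i} - {j}. r_term rp rm N i s)"
    using assms by (intro sum.remove) auto
  moreover have "{1..N} - {i} - {j} = {1..N} - {i, j}" by auto
  ultimately show "mult_part rp rm \<kappa> N i = kappa_at N i \<kappa> + r_tri_at N i j rm + (\<Sum>s\<in>{1..N} - {i, j}. r_term rp rm N i s)"
    using assms by (simp add: mult_part_eq r_term_def[of _ _ _ i j] add.assoc)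
  have "(\<Sum>s\<in>{1..N} - {j}. r_term rp rm N j s) = r_term rp rm N j i + (\<Sum>s\<in>{1..N} - {j} - {i}. r_term rp rm N j s)"
    using assms by (intro sum.remove) auto
  moreover have "{1..N} - {j} - {i} = {1..N} - {i, j}" by auto
  ultimately show "mult_part rp rm \<kappa> N j = kappa_at N j \<kappa> + r_tri_at N i j rp + (\<Sum>s\<in>{1..N} - {i, j}. r_term rp rm N j s)"
    using assms by (simp add: mult_part_eq r_term_def[of _ _ _ j i] add.assoc)
qed

text \<open>For \<open>i < j\<close>, the coefficient of order zero of \<open>[\<D>\<^sub>i, \<D>\<^sub>j]\<close>. It splits into a two-site term \<open>CR_at\<close>
  and, for every further site \<open>s\<close>, a term \<open>third_site\<close> that is \<open>CYB1\<close>, \<open>CYB2\<close> or \<open>CYB3\<close> according to the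
  position of \<open>s\<close> relative to \<open>i\<close> and \<open>j\<close>.\<close>

definition commutator_order0 where
  "commutator_order0 d x \<mu> rp rm \<kappa> N i j = lie_comm (mult_part rp rm \<kappa> N i) (mult_part rp rm \<kappa> N j)
     - euler d x \<mu> (\<lambda>u. mid (at1 N i u)) (mult_part rp rm \<kappa> N j) + euler d x \<mu> (\<lambda>u. mid (at1 N j u)) (mult_part rp rm \<kappa> N i)"

definition CR_at where
  "CR_at d x \<mu> rp rm \<kappa> N i j =
     lie_comm (kappa_at N i \<kappa> + r_tri_at N i j rm) (kappa_at N j \<kappa> + r_tri_at N i j rp)
     + euler d x \<mu> (\<lambda>u. mid (at1 N j u)) (r_tri_at N i j rm + kappa_at N i \<kappa>)
     - euler d x \<mu> (\<lambda>u. mid (at1 N i u)) (r_tri_at N i j rp + kappa_at N j \<kappa>)"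

definition third_site where
  "third_site d x \<mu> rp rm N i j s = lie_comm (r_tri_at N i j rm) (r_term rp rm N j s)
     + lie_comm (r_term rp rm N i s) (r_tri_at N i j rp) + lie_comm (r_term rp rm N i s) (r_term rp rm N j s)
     - euler d x \<mu> (\<lambda>u. mid (at1 N i u)) (r_term rp rm N j s) + euler d x \<mu> (\<lambda>u. mid (at1 N j u)) (r_term rp rm N i s)"

lemma commutator_order0_eq:
  assumes "i \<in> {1..N}" "j \<in> {1..N}" "i < j"
  shows "commutator_order0 d x \<mu> rp rm \<kappa> N i j = CR_at d x \<mu> rp rm \<kappa> N i j + (\<Sum>s\<in>{1..N} - {i, j}. third_site d x \<mu> rp rm N i j s)"
  unfolding commutator_order0_def mult_part_split[OF assms] CR_at_def third_site_def
proof (rule zeroth_order_decomposition)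
  fix s t assume s: "s \<in> {1..N} - {i, j}"
  show "kappa_at N i \<kappa> * r_term rp rm N j s = r_term rp rm N j s * kappa_at N i \<kappa>"
    using s assms by (auto simp: r_term_def intro!: kappa_r_commute)
  show "r_term rp rm N i s * kappa_at N j \<kappa> = kappa_at N j \<kappa> * r_term rp rm N i s"
    using s assms by (auto simp: r_term_def intro!: kappa_r_commute[symmetric])
  assume t: "t \<in> {1..N} - {i, j}" "s \<noteq> t"
  show "r_term rp rm N i s * r_term rp rm N j t = r_term rp rm N j t * r_term rp rm N i s"
    using s t assms by (auto simp: r_term_def intro!: r_r_commute)
qed (auto intro: clin_euler)


section \<open>Transport of identities from two or three sites to N sites\<close>

lemma at2_mult:
  fixes s t :: "('u::complex_algebra_1, 'u) tensor"
  assumes "i \<in> {1..N}" "j \<in> {1..N}" "i \<noteq> j"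
  shows "at2 N i j (s * t) = at2 N i j s * at2 N i j t"
proof -
  note cl = clin_at2[OF assms]
  show ?thesis
  proof (rule clin_tensor_eq[where F = "\<lambda>s. at2 N i j (s * t)"])
    fix a b :: 'u
    show "at2 N i j ((a \<otimes> b) * t) = at2 N i j (a \<otimes> b) * at2 N i j t"
    proof (rule clin_tensor_eq[where F = "\<lambda>t. at2 N i j ((a \<otimes> b) * t)"])
      fix a' b' :: 'u
      show "at2 N i j ((a \<otimes> b) * (a' \<otimes> b')) = at2 N i j (a \<otimes> b) * at2 N i j (a' \<otimes> b')"
        using map2_slots[of "[a, b]" "[i, j]" "[a', b']" N]
        by (simp add: tens_times_tens at2_tens[OF assms] ptens_slots_times)
    qed (intro clin_compose[OF cl] clin_times clin_id cl)+
  qed (intro clin_compose[OF cl] clin_times clin_id cl)+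
qed

lemma at2_one:
  assumes "i \<in> {1..N}" "j \<in> {1..N}" "i \<noteq> j"
  shows "at2 N i j (u \<otimes> 1) = at1 N i u" "at2 N i j (1 \<otimes> u) = at1 N j u"
  unfolding at2_tens[OF assms] at1_def
  by (rule arg_cong[where f = ptens], rule slots_eqI, use assms in auto)+

lemma map_of_placed:
  assumes "distinct is" "n < length is" "fst ` set ps \<subseteq> {1..length is}"
  shows "map_of (map (\<lambda>(m, u). (is ! (m - 1), u)) ps) (is ! n) = map_of ps (Suc n)"
  using assms(3)
proof (induction ps)
  case (Cons mu ps)
  obtain m u where mu: "mu = (m, u)" by force
  have "m \<in> {1..length is}" using Cons.prems mu by auto
  then have "is ! n = is ! (m - 1) \<longleftrightarrow> Suc n = m"
    using assms(1,2) by (subst nth_eq_iff_index_eq) auto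
  then show ?case using Cons mu by auto
qed simp

text \<open>Transitivity of placement: site m of a block placed along \<open>is\<close> becomes site
  \<open>is ! (m - 1)\<close>, as sites count from 1 and list indices from 0.\<close>

lemma slots_zip_slots:
  assumes "distinct is" "fst ` set ps \<subseteq> {1..length is}"
  shows "slots N (zip is (slots (length is) ps)) = slots N (map (\<lambda>(m, u). (is ! (m - 1), u)) ps)"
proof (rule slots_eqI)
  fix p
  show "(case map_of (zip is (slots (length is) ps)) p of Some u \<Rightarrow> u | None \<Rightarrow> 1)
    = (case map_of (map (\<lambda>(m, u). (is ! (m - 1), u)) ps) p of Some u \<Rightarrow> u | None \<Rightarrow> 1)"
  proof (cases "p \<in> set is")
    case True
    then obtain n where n: "n < length is" "p = is ! n" by (auto simp: in_set_conv_nth)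
    then show ?thesis
      using map_of_placed[OF assms(1) n(1) assms(2)] assms(1)
      by (simp add: map_of_zip_nth slots_nth)
  next
    case False
    have "map_of (map (\<lambda>(m, u). (is ! (m - 1), u)) ps) p = None"
      using False assms(2) nth_mem[of _ "is"] by (force simp: map_of_eq_None_iff)
    moreover have "map_of (zip is (slots (length is) ps)) p = None"
      using False by (auto simp: map_of_eq_None_iff dest: set_zip_leftD)
    ultimately show ?thesis by (simp only: option.case)
  qed
qed

lemma place_at1:
  assumes "distinct is" "set is \<subseteq> {1..N}" "a \<in> {1..length is}"
  shows "place N is (at1 (length is) a u) = at1 N (is ! (a - 1)) u"
  using assms(3) by (simp add: at1_def place_ptens[OF assms(1,2)] slots_zip_slots[OF assms(1)])

lemma place_at2:
  assumes "distinct is" "set is \<subseteq> {1..N}" "a \<in> {1..length is}" "b \<in> {1..length is}" "a \<noteq> b"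
  shows "place N is (at2 (length is) a b t) = at2 N (is ! (a - 1)) (is ! (b - 1)) t"
proof -
  have ab: "is ! (a - 1) \<in> {1..N}" "is ! (b - 1) \<in> {1..N}" "is ! (a - 1) \<noteq> is ! (b - 1)"
    using assms nth_mem[of "a - 1" "is"] nth_mem[of "b - 1" "is"]
    by (auto simp: nth_eq_iff_index_eq subset_iff)
  show ?thesis
  proof (rule clin_tensor_eq[where F = "\<lambda>t. place N is (at2 (length is) a b t)"])
    fix u v
    show "place N is (at2 (length is) a b (u \<otimes> v)) = at2 N (is ! (a - 1)) (is ! (b - 1)) (u \<otimes> v)"
      unfolding at2_tens[OF ab] at2_tens[OF assms(3-5)]
      using assms(3,4) by (simp add: place_ptens[OF assms(1,2)] slots_zip_slots[OF assms(1)])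
  qed (intro clin_compose[OF clin_place[OF assms(1,2)]] clin_at2 ab assms(3-5))+
qed

text \<open>Under \<open>fun_map\<close> this carries identities on \<open>length is\<close> sites
  to the sites listed in \<open>is\<close>, the outer algebras staying fixed.\<close>

definition place_tri :: "nat \<Rightarrow> nat list \<Rightarrow>
    ('a::complex_algebra_1, 'u::complex_algebra_1, 'b::complex_algebra_1) tri \<Rightarrow> ('a, 'u, 'b) tri" where
  "place_tri N is = tensor_map id (tensor_map (place N is) id)"

context
  fixes "is" :: "nat list" and N :: nat
  assumes dis: "distinct is" "set is \<subseteq> {1..N}"
begin

lemma clin_place_tri: "clin (place_tri N is)"
  unfolding place_tri_def by (intro clin_tensor_map clin_id clin_place dis)

lemma place_tri_tens: "place_tri N is (a \<otimes> z \<otimes> b) = a \<otimes> place N is z \<otimes> b"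
proof -
  note cl = clin_place[OF dis]
  show ?thesis
    unfolding place_tri_def by (simp add: tensor_map_tens clin_tensor_map clin_id cl)
qed

lemma place_tri_mid: "place_tri N is (mid z) = mid (place N is z)"
  by (simp add: mid_def place_tri_tens)

lemma place_tri_mult: "place_tri N is (s * t) = place_tri N is s * place_tri N is t"
  unfolding place_tri_def
  by (intro tensor_map_mult clin_tensor_map clin_id clin_place dis place_mult) auto

lemma place_tri_r_tri_at:
  assumes "a \<in> {1..length is}" "b \<in> {1..length is}" "a \<noteq> b"
  shows "fun_map (place_tri N is) (r_tri_at (length is) a b r) = r_tri_at N (is ! (a - 1)) (is ! (b - 1)) r"
proof -
  have ab: "is ! (a - 1) \<in> {1..N}" "is ! (b - 1) \<in> {1..N}" "is ! (a - 1) \<noteq> is ! (b - 1)"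
    using assms dis nth_mem[of "a - 1" "is"] nth_mem[of "b - 1" "is"]
    by (auto simp: nth_eq_iff_index_eq subset_iff)
  show ?thesis
    unfolding r_tri_at_eq[OF assms] r_tri_at_eq[OF ab]
    by (simp only: fun_map_fun_map[OF clin_place_tri clin_mid_at2[OF assms]] place_tri_mid place_at2[OF dis assms])
qed

lemma place_tri_kappa_at:
  fixes \<kappa> :: "('v::complex_normed_vector,
      ('a::complex_algebra_1, ('u::complex_algebra_1, 'b::complex_algebra_1) tensor) tensor) merof"
  assumes "a \<in> {1..length is}"
  shows "fun_map (place_tri N is) (kappa_at (length is) a \<kappa>) = kappa_at N (is ! (a - 1)) \<kappa>"
proof -
  have a: "is ! (a - 1) \<in> {1..N}" using assms dis nth_mem[of "a - 1" "is"] by (auto simp: subset_iff)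
  have "place_tri N is (kap (length is) a t) = kap N (is ! (a - 1)) t"
    for t :: "('a, ('u, 'b) tensor) tensor"
    by (rule kap_eqI[OF clin_compose[OF clin_place_tri clin_kap[OF assms]] clin_kap[OF a]])
       (simp only: kap_tens[OF assms] kap_tens[OF a] place_tri_tens place_at1[OF dis assms])
  then show ?thesis
    unfolding kappa_at_eq by (simp add: fun_map_fun_map[OF clin_place_tri clin_kap[OF assms]])
qed

lemma place_tri_euler:
  assumes "a \<in> {1..length is}"
  shows "fun_map (place_tri N is) (euler d x \<mu> (\<lambda>u. mid (at1 (length is) a u)) q)
    = euler d x \<mu> (\<lambda>u. mid (at1 N (is ! (a - 1)) u)) (fun_map (place_tri N is) q)"
  by (simp only: euler_fun_map[OF clin_place_tri place_tri_mult] place_tri_mid place_at1[OF dis assms])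

end

lemma CR_eq: "CR d x \<mu> rp rm \<kappa> = CR_at d x \<mu> rp rm \<kappa> 2 1 2"
  by (simp add: CR_def CR_at_def Let_def)

text \<open>Placement respects sums, commutators and Euler operators and sends sites 1, 2 to i, j,
  so the reflection equation on two sites governs all pairs.\<close>

lemma CR_at_place:
  assumes "i \<in> {1..N}" "j \<in> {1..N}" "i \<noteq> j"
  shows "CR_at d x \<mu> rp rm \<kappa> N i j = fun_map (place_tri N [i, j]) (CR d x \<mu> rp rm \<kappa>)"
proof -
  have dis: "distinct [i, j]" "set [i, j] \<subseteq> {1..N}" using assms by auto
  have len: "length [i, j] = 2" "1 \<in> {1..length [i, j]}" "2 \<in> {1..length [i, j]}"
    "[i, j] ! (1 - 1) = i" "[i, j] ! (2 - 1) = j" "(1::nat) \<noteq> 2" by auto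
  note r = place_tri_r_tri_at[OF dis len(2,3,6), unfolded len(1,4,5)]
  note k = place_tri_kappa_at[OF dis len(2), unfolded len(1,4,5)] place_tri_kappa_at[OF dis len(3), unfolded len(1,4,5)]
  note E = place_tri_euler[OF dis len(2), unfolded len(1,4,5)] place_tri_euler[OF dis len(3), unfolded len(1,4,5)]
  have cl: "clin (fun_map (place_tri N [i, j]))" by (rule clin_fun_map[OF clin_place_tri[OF dis]])
  show ?thesis
    unfolding CR_eq CR_at_def
    by (simp only: clinD[OF cl] lie_comm_fun_map[OF clin_place_tri[OF dis] place_tri_mult[OF dis]] r k E)
qed

text \<open>\<open>H\<close> sends \<open>z\<close> to \<open>z\<^sub>a\<^sub>b\<^sub>c\<close>.\<close>

definition places3 where
  "places3 H N a b c \<longleftrightarrow> clin H \<and> (\<forall>z w. H (z * w) = H z * H w)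
     \<and> (\<forall>t. H (at2 3 1 2 t) = mid (at2 N a b t)) \<and> (\<forall>t. H (at2 3 1 3 t) = mid (at2 N a c t))
     \<and> (\<forall>t. H (at2 3 2 3 t) = mid (at2 N b c t))
     \<and> (\<forall>u. H (at1 3 1 u) = mid (at1 N a u)) \<and> (\<forall>u. H (at1 3 2 u) = mid (at1 N b u))
     \<and> (\<forall>u. H (at1 3 3 u) = mid (at1 N c u))"

text \<open>Serves the passage from commuting operators on three sites to the equations;
  \<open>places3_place\<close> serves the converse on N sites.\<close>

lemma places3_mid: "places3 mid 3 1 2 3"
  by (simp add: places3_def clin_mid mid_mult)

lemma places3_place:
  assumes "a \<in> {1..N}" "b \<in> {1..N}" "c \<in> {1..N}" "a \<noteq> b" "a \<noteq> c" "b \<noteq> c"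
  shows "places3 (\<lambda>z. mid (place N [a, b, c] z)) N a b c"
proof -
  have dis: "distinct [a, b, c]" "set [a, b, c] \<subseteq> {1..N}" using assms by auto
  have len: "length [a, b, c] = 3" "[a, b, c] ! (1 - 1) = a" "[a, b, c] ! (2 - 1) = b" "[a, b, c] ! (3 - 1) = c"
    by auto
  have m: "1 \<in> {1..length [a, b, c]}" "2 \<in> {1..length [a, b, c]}" "3 \<in> {1..length [a, b, c]}"
    "(1::nat) \<noteq> 2" "(1::nat) \<noteq> 3" "(2::nat) \<noteq> 3" by auto
  show ?thesis
    unfolding places3_def
    by (simp only: clin_compose[OF clin_mid clin_place[OF dis]] place_mult[OF dis] mid_mult
        place_at1[OF dis m(1), unfolded len] place_at1[OF dis m(2), unfolded len] place_at1[OF dis m(3), unfolded len]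
        place_at2[OF dis m(1,2,4), unfolded len] place_at2[OF dis m(1,3,5), unfolded len]
        place_at2[OF dis m(2,3,6), unfolded len] simp_thms)
qed

text \<open>With \<open>H\<close> abstract, one computation serves both implications of the
  equivalence: \<open>H\<close> is \<open>mid\<close> on three sites in one and a placement into N
  sites in the other.\<close>

lemma places3_CYB:
  fixes rp rm :: "('v::complex_normed_vector, ('u::complex_algebra_1, 'u) tensor) merof"
  assumes H: "places3 H N a b c" and abc: "a \<in> {1..N}" "b \<in> {1..N}" "c \<in> {1..N}" "a < b" "b < c"
  shows "fun_map H (CYB1 d x \<mu> rp rm) = third_site d x \<mu> rp rm N b c a"
    and "fun_map H (CYB2 d x \<mu> rp rm) = third_site d x \<mu> rp rm N a c b"
    and "fun_map H (CYB3 d x \<mu> rp rm) = third_site d x \<mu> rp rm N a b c"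
proof -
  have cl: "clin H" and mult: "\<And>z w. H (z * w) = H z * H w" using H by (auto simp: places3_def)
  have "fun_map H (r_at 3 i j r) = fun_map (\<lambda>t. H (at2 3 i j t)) r" if "i \<in> {1..3}" "j \<in> {1..3}" "i \<noteq> j"
    for i j and r :: "('v, ('u, 'u) tensor) merof"
    unfolding r_at_def by (rule fun_map_fun_map[OF cl clin_at2[OF that]])
  from this[of 1 2] this[of 1 3] this[of 2 3]
  have r: "fun_map H (r_at 3 1 2 r) = r_tri_at N a b r" "fun_map H (r_at 3 1 3 r) = r_tri_at N a c r"
    "fun_map H (r_at 3 2 3 r) = r_tri_at N b c r"
    for r :: "('v, ('u, 'u) tensor) merof"
    using H abc by (simp_all add: places3_def r_tri_at_eq)
  have E: "(\<lambda>u. H (at1 3 1 u)) = (\<lambda>u. mid (at1 N a u))" "(\<lambda>u. H (at1 3 2 u)) = (\<lambda>u. mid (at1 N b u))"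
    "(\<lambda>u. H (at1 3 3 u)) = (\<lambda>u. mid (at1 N c u))"
    using H by (simp_all add: places3_def)
  \<comment> \<open>\<open>CYB1\<close> and \<open>CYB3\<close> each contain one of these
    commutators in the opposite order, with a minus sign.\<close>
  have swap: "lie_comm (r_tri_at N b c rm) (r_tri_at N a c rp) = - lie_comm (r_tri_at N a c rp) (r_tri_at N b c rm)"
    "lie_comm (r_tri_at N a c rm) (r_tri_at N a b rp) = - lie_comm (r_tri_at N a b rp) (r_tri_at N a c rm)"
    by (simp_all add: lie_comm_def)
  note simps = Let_def clinD[OF clin_fun_map[OF cl]] lie_comm_fun_map[OF cl mult] euler_fun_map[OF cl mult] r E third_site_def r_term_def
  show "fun_map H (CYB1 d x \<mu> rp rm) = third_site d x \<mu> rp rm N b c a"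
    unfolding CYB1_def simps using abc by (simp add: swap)
  show "fun_map H (CYB2 d x \<mu> rp rm) = third_site d x \<mu> rp rm N a c b"
    unfolding CYB2_def simps using abc by simp
  show "fun_map H (CYB3 d x \<mu> rp rm) = third_site d x \<mu> rp rm N a b c"
    unfolding CYB3_def simps using abc by (simp add: swap)
qed

section \<open>Right unital coefficients\<close>

text \<open>The type \<open>tri\<close> has no unit, since \<open>tpower\<close> is the sum of all tensor powers; the unit of
  \<open>coeff_ring N\<close> is a right unit only for elements in the \<open>N\<close>-th summand.\<close>

definition right_unital :: "nat \<Rightarrow> ('v::complex_normed_vector,
    ('a::complex_algebra_1, 'u::complex_algebra_1, 'b::complex_algebra_1) tri) merof \<Rightarrow> bool" where
  "right_unital N p \<longleftrightarrow> p * const_fun (mid (ptens (replicate N 1))) = p"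

lemma right_unital_add: "right_unital N p \<Longrightarrow> right_unital N q \<Longrightarrow> right_unital N (p + q)"
  by (simp add: right_unital_def distrib_right)

lemma right_unital_diff: "right_unital N p \<Longrightarrow> right_unital N q \<Longrightarrow> right_unital N (p - q)"
  by (simp add: right_unital_def left_diff_distrib)

lemma right_unital_mult: "right_unital N q \<Longrightarrow> right_unital N (p * q)"
  by (simp add: right_unital_def mult.assoc)

lemma right_unital_sum: "(\<And>s. s \<in> S \<Longrightarrow> right_unital N (p s)) \<Longrightarrow> right_unital N (\<Sum>s\<in>S. p s)"
  by (simp add: right_unital_def sum_distrib_right)

lemma right_unital_lie_comm: "right_unital N p \<Longrightarrow> right_unital N q \<Longrightarrow> right_unital N (lie_comm p q)"
  unfolding lie_comm_def by (intro right_unital_diff right_unital_mult)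

text \<open>The unit is constant, so the product rule leaves only the derivative of p.\<close>

lemma right_unital_deriv:
  assumes "right_unital N p" shows "right_unital N (fun_deriv v p)"
  using fun_deriv_mult[of v p "const_fun (mid (ptens (replicate N 1)))"] assms
  by (simp add: right_unital_def fun_deriv_const)

lemma right_unital_euler: "right_unital N p \<Longrightarrow> right_unital N (euler d x \<mu> e p)"
  unfolding euler_def by (intro right_unital_sum right_unital_mult right_unital_deriv)

lemma right_unital_fun_map:
  assumes "clin f" "\<And>b. f b * mid (ptens (replicate N 1)) = f b"
  shows "right_unital N (fun_map f p)"
  unfolding right_unital_def
  by (rule clin_tensor_eq[where G = "fun_map f"])
     (auto simp: fun_map_tens[OF assms(1)] const_fun_def tens_times_tens assms(2)
       intro!: clin_times clin_fun_map assms(1))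

lemma ptens_slots_unit: "ptens (slots N ps) * ptens (replicate N 1) = ptens (slots N ps)"
  for ps :: "(nat \<times> 'u::complex_algebra_1) list"
proof -
  have "map2 (*) (slots N ps) (replicate N 1) = slots N ps"
    by (rule nth_equalityI) auto
  then show ?thesis by (simp add: ptens_times_ptens)
qed

lemma right_unital_r_tri_at:
  assumes "i \<in> {1..N}" "j \<in> {1..N}" "i \<noteq> j"
  shows "right_unital N (r_tri_at N i j r)"
  unfolding r_tri_at_eq[OF assms]
proof (rule right_unital_fun_map[OF clin_mid_at2[OF assms]])
  fix t
  have "at2 N i j t * ptens (replicate N 1) = at2 N i j t"
    by (rule clin_tensor_eq[where G = "at2 N i j"])
       (simp_all only: at2_tens[OF assms] ptens_slots_unit clin_times(2) clin_at2[OF assms])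
  then show "mid (at2 N i j t) * mid (ptens (replicate N 1)) = mid (at2 N i j t)"
    by (simp add: mid_mult[symmetric])
qed

lemma right_unital_kappa_at:
  assumes "i \<in> {1..N}"
  shows "right_unital N (kappa_at N i \<kappa>)"
  unfolding kappa_at_eq
proof (rule right_unital_fun_map[OF clin_kap[OF assms]])
  fix t
  show "kap N i t * mid (ptens (replicate N 1)) = kap N i t"
    by (rule kap_eqI[where G = "kap N i"])
       (simp_all only: kap_tens[OF assms] clin_times(2) clin_kap[OF assms] mid_def tens_times_tens
          at1_def ptens_slots_unit mult_1_right)
qed

lemma right_unital_at1: "right_unital N (const_fun (mid (at1 N i u)))"
  by (simp add: right_unital_def const_fun_def tens_times_tens mid_mult[symmetric] at1_def ptens_slots_unit)

lemma right_unital_mult_part: "i \<in> {1..N} \<Longrightarrow> right_unital N (mult_part rp rm \<kappa> N i)"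
  unfolding mult_part_def
  by (intro right_unital_add right_unital_sum right_unital_kappa_at right_unital_r_tri_at) auto

section \<open>The commutator as a first order operator\<close>

text \<open>The coefficient of \<open>\<partial>\<^bsub>\<mu>\<^sub>k\<^esub>\<close> in \<open>[\<D>\<^sub>i, \<D>\<^sub>j]\<close>.\<close>

definition commutator_order1 where
  "commutator_order1 x rp rm \<kappa> N i j k = lie_comm (const_fun (mid (at1 N j (x k)))) (mult_part rp rm \<kappa> N i)
     - lie_comm (const_fun (mid (at1 N i (x k)))) (mult_part rp rm \<kappa> N j)"

lemma op_comm_Dop:
  assumes "i \<noteq> j"
  shows "op_comm (Dop d x \<mu> rp rm \<kappa> N i) (Dop d x \<mu> rp rm \<kappa> N j) f =
    commutator_order0 d x \<mu> rp rm \<kappa> N i j * f + (\<Sum>k=1..d. commutator_order1 x rp rm \<kappa> N i j k * fun_deriv (\<mu> k) f)"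
  unfolding op_comm_def Dop_eq commutator_order0_def commutator_order1_def
  by (rule euler_commutator) (simp add: mid_mult[symmetric] at1_commute[OF assms])

lemma tens_unit_in_coeff_ring:
  "m \<otimes> mid (ptens (replicate N 1)) \<in> coeff_ring N"
  unfolding coeff_ring_def mid_def by (intro cvec.span_base CollectI exI conjI, rule refl) simp

text \<open>Evaluating the commutator at the unit gives its coefficient of order zero, and then evaluating
  it at the coordinate functions \<open>l k\<close> gives the coefficients of order one.\<close>

lemma op_comm_Dop_eq_0_iff:
  fixes l :: "nat \<Rightarrow> 'v::complex_normed_vector mero"
  assumes l: "\<And>j k. j \<in> {1..d} \<Longrightarrow> k \<in> {1..d} \<Longrightarrow> mero_deriv (\<mu> j) (l k) = (if j = k then 1 else 0)"
    and ij: "i \<in> {1..N}" "j \<in> {1..N}" "i \<noteq> j"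
  shows "diff_op_eq N (op_comm (Dop d x \<mu> rp rm \<kappa> N i) (Dop d x \<mu> rp rm \<kappa> N j)) (\<lambda>_. 0)
    \<longleftrightarrow> commutator_order0 d x \<mu> rp rm \<kappa> N i j = 0 \<and> (\<forall>k\<in>{1..d}. commutator_order1 x rp rm \<kappa> N i j k = 0)"
    (is "?L \<longleftrightarrow> ?Z = 0 \<and> (\<forall>k\<in>_. ?C k = 0)")
proof
  assume "?Z = 0 \<and> (\<forall>k\<in>{1..d}. ?C k = 0)"
  then show ?L by (simp add: diff_op_eq_def op_comm_Dop[OF ij(3)])
next
  assume L: ?L
  have eq: "?Z * (m \<otimes> mid (ptens (replicate N 1)))
      + (\<Sum>k=1..d. ?C k * (mero_deriv (\<mu> k) m \<otimes> mid (ptens (replicate N 1)))) = 0" for m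
    using L[unfolded diff_op_eq_def op_comm_Dop[OF ij(3)], THEN bspec, OF tens_unit_in_coeff_ring[of m]]
    by (simp only: fun_deriv_tens)
  have "right_unital N ?Z"
    unfolding commutator_order0_def
    by (intro right_unital_add right_unital_diff right_unital_lie_comm right_unital_euler right_unital_mult_part ij)
  then have Z: "?Z = 0"
    using eq[of 1] by (simp add: right_unital_def const_fun_def mero_deriv_one tens_zero)
  have "?C k = 0" if k: "k \<in> {1..d}" for k
  proof -
    have "(\<Sum>m=1..d. ?C m * (mero_deriv (\<mu> m) (l k) \<otimes> mid (ptens (replicate N 1))))
        = (\<Sum>m=1..d. if m = k then ?C m * const_fun (mid (ptens (replicate N 1))) else 0)"
      using k by (intro sum.cong) (auto simp: l const_fun_def tens_zero)
    also have "\<dots> = ?C k * const_fun (mid (ptens (replicate N 1)))"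
      using k by simp
    also have "\<dots> = ?C k"
    proof -
      have "right_unital N (?C k)"
        unfolding commutator_order1_def by (intro right_unital_diff right_unital_lie_comm right_unital_at1 right_unital_mult_part ij)
      then show ?thesis by (simp add: right_unital_def)
    qed
    finally show ?thesis using eq[of "l k"] Z by simp
  qed
  with Z show "?Z = 0 \<and> (\<forall>k\<in>{1..d}. ?C k = 0)" by blast
qed

lemma commutator_order1_eq:
  assumes ij: "i \<in> {1..N}" "j \<in> {1..N}" "i < j"
  shows "commutator_order1 x rp rm \<kappa> N i j k = fun_map (\<lambda>t. mid (at2 N i j t))
    (lie_comm (const_fun (1 \<otimes> x k)) rm - lie_comm (const_fun (x k \<otimes> 1)) rp)"
proof -
  have ne: "i \<noteq> j" using ij by simp
  let ?h = "\<lambda>t. mid (at2 N i j t)"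
  have h: "clin ?h" "\<And>s t. ?h (s * t) = ?h s * ?h t"
    using clin_mid_at2[OF ij(1,2) ne] by (simp_all add: at2_mult[OF ij(1,2) ne] mid_mult)
  have 1: "lie_comm (const_fun (mid (at1 N j u))) (mult_part rp rm \<kappa> N i)
      = lie_comm (const_fun (mid (at1 N j u))) (r_tri_at N i j rm)" (is "lie_comm ?c _ = _") for u
  proof -
    have "lie_comm ?c (kappa_at N i \<kappa>) = 0"
      using ij by (intro lie_comm_eq_0 const_kappa_commute) auto
    moreover have "lie_comm ?c (r_term rp rm N i s) = 0" if "s \<in> {1..N} - {i, j}" for s
      using that ij unfolding r_term_def by (intro lie_comm_eq_0) (auto intro!: const_r_commute)
    then have "(\<Sum>s\<in>{1..N} - {i, j}. lie_comm ?c (r_term rp rm N i s)) = 0"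
      by (intro sum.neutral ballI)
    ultimately show ?thesis by (simp add: mult_part_split(1)[OF ij] lie_comm_linear)
  qed
  have 2: "lie_comm (const_fun (mid (at1 N i u))) (mult_part rp rm \<kappa> N j)
      = lie_comm (const_fun (mid (at1 N i u))) (r_tri_at N i j rp)" (is "lie_comm ?c _ = _") for u
  proof -
    have "lie_comm ?c (kappa_at N j \<kappa>) = 0"
      using ij by (intro lie_comm_eq_0 const_kappa_commute) auto
    moreover have "lie_comm ?c (r_term rp rm N j s) = 0" if "s \<in> {1..N} - {i, j}" for s
      using that ij unfolding r_term_def by (intro lie_comm_eq_0) (auto intro!: const_r_commute)
    then have "(\<Sum>s\<in>{1..N} - {i, j}. lie_comm ?c (r_term rp rm N j s)) = 0"
      by (intro sum.neutral ballI)
    ultimately show ?thesis by (simp add: mult_part_split(2)[OF ij] lie_comm_linear)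
  qed
  show ?thesis
    unfolding commutator_order1_def 1 2 r_tri_at_eq[OF ij(1,2) ne]
    by (simp only: clinD[OF clin_fun_map[OF h(1)]] lie_comm_fun_map[OF h] fun_map_const[OF h(1)]
        at2_one[OF ij(1,2) ne])
qed

text \<open>Combines the left inverses of \<open>mid\<close> and \<open>at2 2 1 2\<close>, so that
  the order one coefficients for N = 2 determine the defect of a-compatibility.\<close>

lemma fun_map_mid_at2_inj:
  assumes "fun_map (\<lambda>t. mid (at2 2 1 2 t) ::
    ('a::complex_algebra_1, 'u::complex_algebra_1, 'b::complex_algebra_1) tri) p = 0"
  shows "p = 0"
proof -
  have cl: "clin (at2 2 1 2 :: ('u, 'u) tensor \<Rightarrow> _)" by (rule clin_at2) auto
  obtain L :: "'u tpower \<Rightarrow> ('u, 'u) tensor" where L: "clin L" "\<And>t. L (at2 2 1 2 t) = t"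
    using at2_left_inverse by blast
  have "fun_map (mid :: _ \<Rightarrow> ('a, 'u, 'b) tri) (fun_map (at2 2 1 2) p) = 0"
    using assms by (simp only: fun_map_fun_map[OF clin_mid cl])
  then have "fun_map L (fun_map (at2 2 1 2) p) = 0"
    using fun_map_mid_inj clinD(3)[OF clin_fun_map[OF L(1)]] by metis
  then show ?thesis by (simp only: fun_map_fun_map[OF L(1) cl] L(2) fun_map_id)
qed

text \<open>The defect of compatibility is linear in the element of \<open>\<aa>\<close>, while the
  coefficients of the commutator show its values on the basis.\<close>

lemma a_compatible_iff:
  assumes "is_basis \<aa> d x"
  shows "a_compatible \<aa> rp rm \<longleftrightarrow>
    (\<forall>k\<in>{1..d}. lie_comm (const_fun (1 \<otimes> x k)) rm - lie_comm (const_fun (x k \<otimes> 1)) rp = 0)"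
    (is "_ \<longleftrightarrow> (\<forall>k\<in>_. ?F (x k) = 0)")
proof -
  have span: "cvec.span (x ` {1..d}) = \<aa>" using assms by (simp add: is_basis_def)
  have "clin (\<lambda>y. lie_comm (const_fun (1 \<otimes> y)) rm)" "clin (\<lambda>y. lie_comm (const_fun (y \<otimes> 1)) rp)"
    by (simp_all add: clin_def const_fun_def tens_simps lie_comm_linear)
  then have F: "clin ?F" by (rule clin_add_diff(2))
  have "?F y = 0" if "\<forall>k\<in>{1..d}. ?F (x k) = 0" "y \<in> cvec.span (x ` {1..d})" for y
    using that(2)
  proof (induction rule: cvec.span_induct_alt)
    case base
    show ?case by (rule clinD(3)[OF F])
  next
    case (step c b z)
    then obtain k where "k \<in> {1..d}" "b = x k" by blast
    then have "?F b = 0" using that(1) by blast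
    then show ?case using step(2) by (simp only: clinD(1,2)[OF F]) simp
  qed
  moreover have "a_compatible \<aa> rp rm \<longleftrightarrow> (\<forall>y\<in>\<aa>. ?F y = 0)"
    unfolding a_compatible_def right_minus_eq by (intro ball_cong[OF refl] eq_commute)
  moreover have "x k \<in> \<aa>" if "k \<in> {1..d}" for k
    unfolding span[symmetric] using that by (intro cvec.span_base imageI)
  ultimately show ?thesis unfolding span by blast
qed

lemma CR_at_eq_0:
  assumes "CR d x \<mu> rp rm \<kappa> = 0" "i \<in> {1..N}" "j \<in> {1..N}" "i < j"
  shows "CR_at d x \<mu> rp rm \<kappa> N i j = 0"
proof -
  have ne: "i \<noteq> j" using assms(4) by simp
  show ?thesis
    unfolding CR_at_place[OF assms(2,3) ne] assms(1)
    by (intro clinD(3) clin_fun_map clin_place_tri) (use assms(2,3) ne in auto)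
qed

theorem corollary3p4:
  fixes \<aa> :: "'u::complex_algebra_1 set"
    and ev :: "'v::complex_normed_vector \<Rightarrow> 'u \<Rightarrow> complex"
    and d :: nat and x :: "nat \<Rightarrow> 'u" and \<mu> :: "nat \<Rightarrow> 'v"
    and rp rm :: "('v, ('u, 'u) tensor) merof"
    and \<kappa> :: "('v, ('a::complex_algebra_1, ('u, 'b::complex_algebra_1) tensor) tensor) merof"
  assumes "cvec.subspace \<aa>"
    and "is_dual \<aa> ev"
    and "is_basis \<aa> d x"
    and "is_dual_basis ev d x \<mu>"
  shows "(\<forall>N\<ge>2. \<forall>i\<in>{1..N}. \<forall>j\<in>{1..N}.
            diff_op_eq N (op_comm (Dop d x \<mu> rp rm \<kappa> N i) (Dop d x \<mu> rp rm \<kappa> N j)) (\<lambda>_. 0))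
         \<longleftrightarrow>
         (a_compatible \<aa> rp rm \<and>
          CYB1 d x \<mu> rp rm = 0 \<and> CYB2 d x \<mu> rp rm = 0 \<and> CYB3 d x \<mu> rp rm = 0 \<and>
          CR d x \<mu> rp rm \<kappa> = 0)"
    (is "?commute \<longleftrightarrow> ?equations")
proof -
  obtain l :: "nat \<Rightarrow> 'v mero" where
    l: "\<And>j k. j \<in> {1..d} \<Longrightarrow> k \<in> {1..d} \<Longrightarrow> mero_deriv (\<mu> j) (l k) = (if j = k then 1 else 0)"
    using coordinate_mero[OF assms(2-4)] by blast
  let ?D = "Dop d x \<mu> rp rm \<kappa>" and ?Z = "commutator_order0 d x \<mu> rp rm \<kappa>" and ?C = "commutator_order1 x rp rm \<kappa>"
  let ?CR = "CR_at d x \<mu> rp rm \<kappa>"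
  let ?Y = "third_site d x \<mu> rp rm :: nat \<Rightarrow> nat \<Rightarrow> nat \<Rightarrow> nat \<Rightarrow> ('v, ('a, 'u, 'b) tri) merof"
  let ?F = "\<lambda>k. lie_comm (const_fun (1 \<otimes> x k)) rm - lie_comm (const_fun (x k \<otimes> 1)) rp"
  have iff: "diff_op_eq N (op_comm (?D N i) (?D N j)) (\<lambda>_. 0) \<longleftrightarrow> ?Z N i j = 0 \<and> (\<forall>k\<in>{1..d}. ?C N i j k = 0)"
    if "i \<in> {1..N}" "j \<in> {1..N}" "i < j" for N i j
    using that(3) by (intro op_comm_Dop_eq_0_iff[OF l that(1,2)]) auto
  show ?thesis
  proof
    assume comm: ?commute
    have Z: "?Z N i j = 0" and C: "\<forall>k\<in>{1..d}. ?C N i j k = 0"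
      if "N \<ge> 2" "i \<in> {1..N}" "j \<in> {1..N}" "i < j" for N i j
    proof -
      have "diff_op_eq N (op_comm (?D N i) (?D N j)) (\<lambda>_. 0)" using comm that by blast
      then show "?Z N i j = 0" "\<forall>k\<in>{1..d}. ?C N i j k = 0"
        using iff[OF that(2-4)] by simp_all
    qed
    have m2: "1 \<in> {1..2::nat}" "2 \<in> {1..2::nat}" "(1::nat) < 2" by auto
    have "?F k = 0" if "k \<in> {1..d}" for k
    proof (rule fun_map_mid_at2_inj)
      show "fun_map (\<lambda>t. mid (at2 2 1 2 t) :: ('a, 'u, 'b) tri) (?F k) = 0"
        using C[OF order.refl m2] that by (simp only: commutator_order1_eq[OF m2])
    qed
    then have compat: "a_compatible \<aa> rp rm" unfolding a_compatible_iff[OF assms(3)] by blast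
    \<comment> \<open>For N = 2 there is no third site, and only the two-site term remains.\<close>
    have empty: "{1..2} - {1, 2::nat} = {}" by auto
    have CR: "CR d x \<mu> rp rm \<kappa> = 0"
      using Z[OF order.refl m2] unfolding commutator_order0_eq[OF m2] CR_eq empty by (simp only: sum.empty add_0_right)
    \<comment> \<open>For N = 3 each pair leaves exactly one third site, so once the two-site term
      is removed each coefficient is a single Yang-Baxter expression.\<close>
    have Y: "(\<Sum>s\<in>{1..3} - {i, j}. ?Y 3 i j s) = 0"
      if ij: "i \<in> {1..3}" "j \<in> {1..3}" "i < j" for i j
      using Z[OF _ ij] unfolding commutator_order0_eq[OF ij] CR_at_eq_0[OF CR ij] by simp
    have m3: "1 \<in> {1..3::nat}" "2 \<in> {1..3::nat}" "3 \<in> {1..3::nat}" "(1::nat) < 2" "(2::nat) < 3" "(1::nat) < 3"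
      by auto
    have sets: "{1..3} - {2, 3} = {1::nat}" "{1..3} - {1, 3} = {2::nat}" "{1..3} - {1, 2} = {3::nat}"
      by auto
    \<comment> \<open>The Yang-Baxter expressions do not mention the outer algebras, so the types in
      the target of \<open>mid\<close> have to be given explicitly.\<close>
    note CYB = places3_CYB[OF places3_mid m3(1-5), where ?'a = 'a and ?'b = 'b, of d x \<mu> rp rm]
    have "CYB1 d x \<mu> rp rm = 0"
      by (rule fun_map_mid_inj[where ?'a = 'a and ?'b = 'b]) (use Y[OF m3(2,3,5)] in \<open>simp add: sets CYB(1) del: One_nat_def\<close>)
    moreover have "CYB2 d x \<mu> rp rm = 0"
      by (rule fun_map_mid_inj[where ?'a = 'a and ?'b = 'b]) (use Y[OF m3(1,3,6)] in \<open>simp add: sets CYB(2) del: One_nat_def\<close>)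
    moreover have "CYB3 d x \<mu> rp rm = 0"
      by (rule fun_map_mid_inj[where ?'a = 'a and ?'b = 'b]) (use Y[OF m3(1,2,4)] in \<open>simp add: sets CYB(3) del: One_nat_def\<close>)
    ultimately show ?equations using compat CR by blast
  next
    assume eqs: ?equations
    have less: "diff_op_eq N (op_comm (?D N i) (?D N j)) (\<lambda>_. 0)"
      if ij: "i \<in> {1..N}" "j \<in> {1..N}" "i < j" for N i j
    proof -
      have ne: "i \<noteq> j" using ij by simp
      have "?C N i j k = 0" if "k \<in> {1..d}" for k
      proof -
        have "?F k = 0" using eqs that unfolding a_compatible_iff[OF assms(3)] by blast
        then show ?thesis
          unfolding commutator_order1_eq[OF ij] using clinD(3)[OF clin_fun_map[OF clin_mid_at2[OF ij(1,2) ne]]] by simp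
      qed
      moreover have "?CR N i j = 0" using eqs by (intro CR_at_eq_0 ij) blast
      moreover have "?Y N i j s = 0" if s: "s \<in> {1..N} - {i, j}" for s
      proof -
        have zero: "fun_map (\<lambda>z. mid (place N [a, b, c] z) :: ('a, 'u, 'b) tri) 0
            = (0 :: ('v, ('a, 'u, 'b) tri) merof)"
          if "a \<in> {1..N}" "b \<in> {1..N}" "c \<in> {1..N}" "a < b" "b < c" for a b c
          by (rule clinD(3)[OF clin_fun_map[OF clin_compose[OF clin_mid clin_place]]]) (use that in auto)
        have Y: "?Y N b c a = 0" "?Y N a c b = 0" "?Y N a b c = 0"
          if abc: "a \<in> {1..N}" "b \<in> {1..N}" "c \<in> {1..N}" "a < b" "b < c" for a b c
        proof -
          have "places3 (\<lambda>z. mid (place N [a, b, c] z) :: ('a, 'u, 'b) tri) N a b c"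
            using abc by (intro places3_place) auto
          note Y_eq = places3_CYB[OF this abc, of d x \<mu> rp rm]
          show "?Y N b c a = 0" "?Y N a c b = 0" "?Y N a b c = 0"
            using eqs zero[OF abc] by (simp_all add: Y_eq[symmetric])
        qed
        \<comment> \<open>The sites s, i, j in increasing order are the a < b < c of
          \<open>Y\<close>.\<close>
        consider "s < i" | "i < s" "s < j" | "j < s" using s by force
        then show ?thesis using Y s ij by cases auto
      qed
      ultimately show ?thesis unfolding iff[OF ij] commutator_order0_eq[OF ij] by simp
    qed
    \<comment> \<open>Antisymmetry of the commutator reduces i > j to the case treated
      above.\<close>
    have sym: "diff_op_eq N (op_comm P Q) (\<lambda>_. 0)" if "diff_op_eq N (op_comm Q P) (\<lambda>_. 0)"
      for N :: nat and P Q :: "('v, ('a, 'u, 'b) tri) merof \<Rightarrow> ('v, ('a, 'u, 'b) tri) merof"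
      using that by (simp add: diff_op_eq_def op_comm_def)
    have self: "diff_op_eq N (op_comm P P) (\<lambda>_. 0)"
      for N :: nat and P :: "('v, ('a, 'u, 'b) tri) merof \<Rightarrow> ('v, ('a, 'u, 'b) tri) merof"
      by (simp add: diff_op_eq_def op_comm_def)
    show ?commute
    proof (intro allI impI ballI)
      fix N i j :: nat assume "i \<in> {1..N}" "j \<in> {1..N}"
      then show "diff_op_eq N (op_comm (?D N i) (?D N j)) (\<lambda>_. 0)"
        using less sym self by (cases i j rule: linorder_cases) auto
    qed
  qed
qed

end
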